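(* Let $R$ be a nonzero non-degenerate linear Jordan algebra over a ring $F$ with $1/6$. Then $P(R)$ is an algebra of $\mathfrak M$-quotients of $R$; $P(R)$ embeds into $Q_m(R)$ identically on $R$; $$O(P(R))\subseteq Q_m(P(R))=O(Q_m(P(R)));$$ and $Q_m(P(R))_B$ is an algebra of $\mathfrak M$-quotients of $O(P(R))_B$ for any ultrafilter $B$ in $B(R)$.
   Context: $F$ is an associative commutative ring with $1$ containing $1/6$; algebras are linear. $M(R)$ is the associative subalgebra of $\mathrm{End}_F(R)$ generated by all operators $l_x:y\mapsto xy$, $r_x:y\mapsto yx$, and $M(R)'=F\,\mathrm{Id}_R+M(R)$, acting on the right. $R$ is semiprime if $I^2\ne\{0\}$ for all nonzero ideals $I$. A linear Jordan algebra $R$ is non-degenerate if there is no $0\ne x\in R$ with $2x(xy)-x^2y=0$ for all $y\in R$ (this implies semiprimeness). For nonzero semiprime $R$: $I(R)$ is an injective hull of the right $M(R)'$-module $R$; $P(R)=\mathrm{End}(I(R))_{M(R)'}R$; $\mathrm{CM}(R)=\mathrm{End}(P(R))_{M(R)'}$ (commutative, von Neumann regular). $P(R)=\mathrm{CM}(R)R$ is regarded as a $\mathrm{CM}(R)$-algebra, multiplication extended from $R$ by $\mathrm{CM}(R)$-linearity; $M(P(R))'=\mathrm{CM}(R)\mathrm{Id}+M(P(R))$; $I(P(R))$ is an injective hull of the right $M(P(R))'$-module $P(R)$. $B(R)$ is the set of idempotents of $\mathrm{CM}(R)$, a Boolean ring with multiplication of $\mathrm{CM}(R)$, addition $\alpha\oplus\beta=(\alpha-\beta)^2$,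 order $\alpha\le\beta$ iff $\alpha\beta=\alpha$. A subset of $B(R)$ is dense if its annihilator in $B(R)$ is zero, orthogonal if distinct elements have zero product. $S\subseteq I(P(R))$ is orthogonally complete if for every dense orthogonal $\{\xi_a\}_{a\in I}\subseteq B(R)$ and $\{x_a\}_{a\in I}\subseteq S$ there is $x\in S$ (unique, denoted $\sum^\perp_{a\in I}\xi_ax_a$) with $\xi_ax=\xi_ax_a$ for all $a$; $O(S)$ is the intersection of all orthogonally complete subsets of $I(P(R))$ containing $S$ (it is the set of all $\sum^\perp\xi_ax_a$, $x_a\in S$). $O(P(R))$ is a $\mathrm{CM}(R)$-algebra with $\sum^\perp\xi_ax_a\star\sum^\perp\chi_by_b=\sum^\perp\xi_a\chi_b(x_a\star y_b)$, $\star=+,\cdot$. An ultrafilter in $B(R)$ is $B\subseteq B(R)\setminus\{0\}$ closed under products, upward closed for $\le$, and such that for each $\alpha\in B(R)$ either $\alpha\in B$ or $\mathrm{Id}-\alpha\in B$. With $P=B(R)\setminus B$, $PS=\{\alpha x\mid\alpha\in P,x\in S\}$, $S_B=S/(S\cap PS)$. A linear Jordan algebra $Q$ is an algebra of $\mathfrak M$-quotients of a linear Jordan algebra $R$ if $R$ is a subalgebra of $Q$ and for every $0\ne q\in Q$ there is an ideal $I$ of $R$ with $\mathrm{Ann}_RI=\{x\in R\mid xI=\{x,I,R\}=\{0\}\}=\{0\}$ and $\{0\}\ne Iq\subseteq R$, where $\{x,z,y\}=(xz)y+(yz)x-(xy)z$. For non-degenerate $R$ over a ring with $1/6$, $Q_m(R)$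 denotes the maximal algebra of $\mathfrak M$-quotients of $R$: the algebra of $\mathfrak M$-quotients into which every algebra of $\mathfrak M$-quotients of $R$ embeds identically on $R$ (it is known to exist and be unique up to an isomorphism identical on $R$; it is realized as the degree $1$ component of the maximal Lie algebra of quotients of the $3$-graded Tits–Kantor–Koecher algebra of the Jordan pair $(R,R)$). $Q_m(P(R))$ is formed for $P(R)$ as a $\mathrm{CM}(R)$-algebra; it is identified, by an embedding identical on $P(R)$, with an $M(P(R))'$-submodule of $I(P(R))$, $P(R)$ being essential in it. *)

theory Defs
  imports "HOL-Algebra.Module" "HOL-Algebra.QuotRing" "HOL-Algebra.Generated_Groups"
begin

section \<open>Nonassociative and linear Jordan algebras\<close>

text \<open>
  A (not necessarily associative) algebra over \<open>F\<close> is stored in the record type \<^type>\<open>module\<close>;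
  its product is the field \<^const>\<open>mult\<close>, and the field \<^const>\<open>one\<close> is never used.
\<close>

locale nonassoc_algebra = module F A
  for F :: "'f ring" and A :: "('f, 'a) module" +
  assumes six_unit: "add_pow F (6::nat) \<one>\<^bsub>F\<^esub> \<in> Units F"
    and mult_closed: "\<lbrakk>x \<in> carrier A; y \<in> carrier A\<rbrakk> \<Longrightarrow> x \<otimes>\<^bsub>A\<^esub> y \<in> carrier A"
    and mult_add_left: "\<lbrakk>x \<in> carrier A; y \<in> carrier A; z \<in> carrier A\<rbrakk>
          \<Longrightarrow> (x \<oplus>\<^bsub>A\<^esub> y) \<otimes>\<^bsub>A\<^esub> z = (x \<otimes>\<^bsub>A\<^esub> z) \<oplus>\<^bsub>A\<^esub> (y \<otimes>\<^bsub>A\<^esub> z)"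
    and mult_add_right: "\<lbrakk>x \<in> carrier A; y \<in> carrier A; z \<in> carrier A\<rbrakk>
          \<Longrightarrow> x \<otimes>\<^bsub>A\<^esub> (y \<oplus>\<^bsub>A\<^esub> z) = (x \<otimes>\<^bsub>A\<^esub> y) \<oplus>\<^bsub>A\<^esub> (x \<otimes>\<^bsub>A\<^esub> z)"
    and mult_smult_left: "\<lbrakk>c \<in> carrier F; x \<in> carrier A; y \<in> carrier A\<rbrakk>
          \<Longrightarrow> (c \<odot>\<^bsub>A\<^esub> x) \<otimes>\<^bsub>A\<^esub> y = c \<odot>\<^bsub>A\<^esub> (x \<otimes>\<^bsub>A\<^esub> y)"
    and mult_smult_right: "\<lbrakk>c \<in> carrier F; x \<in> carrier A; y \<in> carrier A\<rbrakk>
          \<Longrightarrow> x \<otimes>\<^bsub>A\<^esub> (c \<odot>\<^bsub>A\<^esub> y) = c \<odot>\<^bsub>A\<^esub> (x \<otimes>\<^bsub>A\<^esub> y)"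

locale jordan_algebra = nonassoc_algebra F A
  for F :: "'f ring" and A :: "('f, 'a) module" +
  assumes mult_comm: "\<lbrakk>x \<in> carrier A; y \<in> carrier A\<rbrakk> \<Longrightarrow> x \<otimes>\<^bsub>A\<^esub> y = y \<otimes>\<^bsub>A\<^esub> x"
    and jordan_identity: "\<lbrakk>x \<in> carrier A; y \<in> carrier A\<rbrakk>
          \<Longrightarrow> ((x \<otimes>\<^bsub>A\<^esub> x) \<otimes>\<^bsub>A\<^esub> y) \<otimes>\<^bsub>A\<^esub> x = (x \<otimes>\<^bsub>A\<^esub> x) \<otimes>\<^bsub>A\<^esub> (y \<otimes>\<^bsub>A\<^esub> x)"

definition nondegenerate :: "('f, 'a) module \<Rightarrow> bool" where
  "nondegenerate A \<longleftrightarrow>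
     \<not> (\<exists>x \<in> carrier A. x \<noteq> \<zero>\<^bsub>A\<^esub> \<and>
          (\<forall>y \<in> carrier A.
             add_pow A (2::nat) (x \<otimes>\<^bsub>A\<^esub> (x \<otimes>\<^bsub>A\<^esub> y)) \<ominus>\<^bsub>A\<^esub> ((x \<otimes>\<^bsub>A\<^esub> x) \<otimes>\<^bsub>A\<^esub> y) = \<zero>\<^bsub>A\<^esub>))"

definition algebra_ideal :: "'f ring \<Rightarrow> ('f, 'a) module \<Rightarrow> 'a set \<Rightarrow> bool" where
  "algebra_ideal F A K \<longleftrightarrow>
     submodule K F A \<and>
     (\<forall>a \<in> K. \<forall>x \<in> carrier A. a \<otimes>\<^bsub>A\<^esub> x \<in> K \<and> x \<otimes>\<^bsub>A\<^esub> a \<in> K)"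

definition algebra_embedding ::
  "'f ring \<Rightarrow> ('f, 'a) module \<Rightarrow> ('f, 'b) module \<Rightarrow> ('a \<Rightarrow> 'b) \<Rightarrow> bool" where
  "algebra_embedding F A A' f \<longleftrightarrow>
     f \<in> carrier A \<rightarrow> carrier A' \<and> inj_on f (carrier A) \<and>
     (\<forall>x \<in> carrier A. \<forall>y \<in> carrier A.
        f (x \<oplus>\<^bsub>A\<^esub> y) = f x \<oplus>\<^bsub>A'\<^esub> f y \<and> f (x \<otimes>\<^bsub>A\<^esub> y) = f x \<otimes>\<^bsub>A'\<^esub> f y) \<and>
     (\<forall>c \<in> carrier F. \<forall>x \<in> carrier A. f (c \<odot>\<^bsub>A\<^esub> x) = c \<odot>\<^bsub>A'\<^esub> f x)"


section \<open>Algebras of \<open>\<MM>\<close>-quotients\<close>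

definition jordan_triple :: "('f, 'a) module \<Rightarrow> 'a \<Rightarrow> 'a \<Rightarrow> 'a \<Rightarrow> 'a" where
  "jordan_triple A x z y =
     (((x \<otimes>\<^bsub>A\<^esub> z) \<otimes>\<^bsub>A\<^esub> y) \<oplus>\<^bsub>A\<^esub> ((y \<otimes>\<^bsub>A\<^esub> z) \<otimes>\<^bsub>A\<^esub> x)) \<ominus>\<^bsub>A\<^esub> ((x \<otimes>\<^bsub>A\<^esub> y) \<otimes>\<^bsub>A\<^esub> z)"

definition jordan_annihilator :: "('f, 'a) module \<Rightarrow> 'a set \<Rightarrow> 'a set" where
  "jordan_annihilator A K =
     {x \<in> carrier A. (\<forall>z \<in> K. x \<otimes>\<^bsub>A\<^esub> z = \<zero>\<^bsub>A\<^esub>) \<and>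
                     (\<forall>z \<in> K. \<forall>y \<in> carrier A. jordan_triple A x z y = \<zero>\<^bsub>A\<^esub>)}"

text \<open>
  Here and below the inclusion of a subalgebra is an explicit embedding \<open>e\<close> of \<open>R\<close> into \<open>Q\<close>,
  so that \<open>R\<close> and \<open>Q\<close> may live on different types.
\<close>

definition M_quotients ::
  "'f ring \<Rightarrow> ('f, 'r) module \<Rightarrow> ('f, 'q) module \<Rightarrow> ('r \<Rightarrow> 'q) \<Rightarrow> bool" where
  "M_quotients F R Q e \<longleftrightarrow>
     jordan_algebra F R \<and> jordan_algebra F Q \<and> algebra_embedding F R Q e \<and>
     (\<forall>q \<in> carrier Q. q \<noteq> \<zero>\<^bsub>Q\<^esub> \<longrightarrow>
        (\<exists>K. algebra_ideal F R K \<and> jordan_annihilator R K = {\<zero>\<^bsub>R\<^esub>} \<and>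
             {e a \<otimes>\<^bsub>Q\<^esub> q | a. a \<in> K} \<noteq> {\<zero>\<^bsub>Q\<^esub>} \<and>
             {e a \<otimes>\<^bsub>Q\<^esub> q | a. a \<in> K} \<subseteq> e ` carrier R))"

text \<open>
  The maximal algebra of \<open>\<MM>\<close>-quotients, for non-degenerate \<open>R\<close>. The competing algebras \<open>Q'\<close> range
  over the type \<open>('r \<times> 'r) set\<close>. This is no restriction: if \<open>R\<close> is non-degenerate, an element \<open>q\<close>
  of an algebra of \<open>\<MM>\<close>-quotients of \<open>R\<close> is determined by the graph of any map \<open>a \<mapsto> aq\<close>, \<open>a \<in> K\<close>,
  into \<open>R\<close>, where \<open>K\<close> is an ideal of \<open>R\<close> with zero annihilator. So every algebra of
  \<open>\<MM>\<close>-quotients of \<open>R\<close> is isomorphic over \<open>R\<close> to one carried by a subset of \<open>('r \<times> 'r) set\<close>.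
\<close>

definition maximal_M_quotients ::
  "'f ring \<Rightarrow> ('f, 'r) module \<Rightarrow> ('f, 'q) module \<Rightarrow> ('r \<Rightarrow> 'q) \<Rightarrow> bool" where
  "maximal_M_quotients F R Q e \<longleftrightarrow>
     M_quotients F R Q e \<and>
     (\<forall>(Q' :: ('f, ('r \<times> 'r) set) module) e'. M_quotients F R Q' e' \<longrightarrow>
        (\<exists>f. algebra_embedding F Q' Q f \<and> (\<forall>x \<in> carrier R. f (e' x) = e x)))"


section \<open>Right modules and injective hulls\<close>

text \<open>
  Right modules over a (noncommutative) ring \<open>S\<close> also use the record type \<^type>\<open>module\<close>:
  \<open>s \<odot>\<^bsub>M\<^esub> x\<close> stands for the right action \<open>x \<cdot> s\<close>. The library's \<^locale>\<open>submodule\<close> makes no use of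
  commutativity or of the side of the action, so it applies to right modules.
\<close>

definition right_module :: "'s ring \<Rightarrow> ('s, 'm) module \<Rightarrow> bool" where
  "right_module S M \<longleftrightarrow>
     ring S \<and> abelian_group M \<and>
     (\<forall>s \<in> carrier S. \<forall>x \<in> carrier M. s \<odot>\<^bsub>M\<^esub> x \<in> carrier M) \<and>
     (\<forall>s \<in> carrier S. \<forall>t \<in> carrier S. \<forall>x \<in> carrier M.
        (s \<oplus>\<^bsub>S\<^esub> t) \<odot>\<^bsub>M\<^esub> x = (s \<odot>\<^bsub>M\<^esub> x) \<oplus>\<^bsub>M\<^esub> (t \<odot>\<^bsub>M\<^esub> x)) \<and>
     (\<forall>s \<in> carrier S. \<forall>x \<in> carrier M. \<forall>y \<in> carrier M.
        s \<odot>\<^bsub>M\<^esub> (x \<oplus>\<^bsub>M\<^esub> y) = (s \<odot>\<^bsub>M\<^esub> x) \<oplus>\<^bsub>M\<^esub> (s \<odot>\<^bsub>M\<^esub> y)) \<and>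
     (\<forall>s \<in> carrier S. \<forall>t \<in> carrier S. \<forall>x \<in> carrier M.
        (s \<otimes>\<^bsub>S\<^esub> t) \<odot>\<^bsub>M\<^esub> x = t \<odot>\<^bsub>M\<^esub> (s \<odot>\<^bsub>M\<^esub> x)) \<and>
     (\<forall>x \<in> carrier M. \<one>\<^bsub>S\<^esub> \<odot>\<^bsub>M\<^esub> x = x)"

definition rmod_hom :: "'s ring \<Rightarrow> ('s, 'm) module \<Rightarrow> ('s, 'n) module \<Rightarrow> ('m \<Rightarrow> 'n) set" where
  "rmod_hom S M N =
     {f \<in> carrier M \<rightarrow> carrier N.
        (\<forall>x \<in> carrier M. \<forall>y \<in> carrier M. f (x \<oplus>\<^bsub>M\<^esub> y) = f x \<oplus>\<^bsub>N\<^esub> f y) \<and>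
        (\<forall>s \<in> carrier S. \<forall>x \<in> carrier M. f (s \<odot>\<^bsub>M\<^esub> x) = s \<odot>\<^bsub>N\<^esub> f x)}"

text \<open>
  The test modules \<open>N\<close> range over the type \<open>'s \<times> 'm\<close>. This is no restriction: the type contains
  a copy of the regular module \<open>S\<close>, and by Baer's criterion extending homomorphisms from right
  ideals of \<open>S\<close> suffices.
\<close>

definition injective_rmod :: "'s ring \<Rightarrow> ('s, 'm) module \<Rightarrow> bool" where
  "injective_rmod S M \<longleftrightarrow>
     right_module S M \<and>
     (\<forall>(N :: ('s, 's \<times> 'm) module) K f.
        right_module S N \<and> submodule K S N \<and> f \<in> rmod_hom S (N\<lparr>carrier := K\<rparr>) M \<longrightarrow>
        (\<exists>g \<in> rmod_hom S N M. \<forall>x \<in> K. g x = f x))"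

text \<open>\<open>M\<close> is an injective hull of the right \<open>S\<close>-module \<open>N\<close>, with \<open>e\<close> the inclusion of \<open>N\<close> in \<open>M\<close>.\<close>

definition injective_hull ::
  "'s ring \<Rightarrow> ('s, 'n) module \<Rightarrow> ('s, 'm) module \<Rightarrow> ('n \<Rightarrow> 'm) \<Rightarrow> bool" where
  "injective_hull S N M e \<longleftrightarrow>
     right_module S N \<and> injective_rmod S M \<and>
     e \<in> rmod_hom S N M \<and> inj_on e (carrier N) \<and>
     (\<forall>K. submodule K S M \<and> K \<noteq> {\<zero>\<^bsub>M\<^esub>} \<longrightarrow> K \<inter> e ` carrier N \<noteq> {\<zero>\<^bsub>M\<^esub>})"

definition endo_ring :: "'s ring \<Rightarrow> ('s, 'm) module \<Rightarrow> ('m \<Rightarrow> 'm) ring" where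
  "endo_ring S M =
     \<lparr>carrier = rmod_hom S M M \<inter> extensional (carrier M),
      mult = compose (carrier M),
      one = (\<lambda>x \<in> carrier M. x),
      zero = (\<lambda>x \<in> carrier M. \<zero>\<^bsub>M\<^esub>),
      add = (\<lambda>f g. \<lambda>x \<in> carrier M. f x \<oplus>\<^bsub>M\<^esub> g x)\<rparr>"


section \<open>The multiplication ring \<open>M(A)'\<close>\<close>

abbreviation left_mult :: "('f, 'a) module \<Rightarrow> 'a \<Rightarrow> 'a \<Rightarrow> 'a" where
  "left_mult A x \<equiv> (\<lambda>y \<in> carrier A. x \<otimes>\<^bsub>A\<^esub> y)"

abbreviation right_mult :: "('f, 'a) module \<Rightarrow> 'a \<Rightarrow> 'a \<Rightarrow> 'a" where
  "right_mult A x \<equiv> (\<lambda>y \<in> carrier A. y \<otimes>\<^bsub>A\<^esub> x)"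

abbreviation scalar_op :: "('f, 'a) module \<Rightarrow> 'f \<Rightarrow> 'a \<Rightarrow> 'a" where
  "scalar_op A c \<equiv> (\<lambda>y \<in> carrier A. c \<odot>\<^bsub>A\<^esub> y)"

inductive_set mult_algebra :: "'f ring \<Rightarrow> ('f, 'a) module \<Rightarrow> ('a \<Rightarrow> 'a) set"
  for F A where
    left: "x \<in> carrier A \<Longrightarrow> left_mult A x \<in> mult_algebra F A"
  | right: "x \<in> carrier A \<Longrightarrow> right_mult A x \<in> mult_algebra F A"
  | add: "\<lbrakk>f \<in> mult_algebra F A; g \<in> mult_algebra F A\<rbrakk>
            \<Longrightarrow> (\<lambda>y \<in> carrier A. f y \<oplus>\<^bsub>A\<^esub> g y) \<in> mult_algebra F A"
  | smult: "\<lbrakk>c \<in> carrier F; f \<in> mult_algebra F A\<rbrakk>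
            \<Longrightarrow> (\<lambda>y \<in> carrier A. c \<odot>\<^bsub>A\<^esub> f y) \<in> mult_algebra F A"
  | comp: "\<lbrakk>f \<in> mult_algebra F A; g \<in> mult_algebra F A\<rbrakk>
            \<Longrightarrow> (\<lambda>y \<in> carrier A. g (f y)) \<in> mult_algebra F A"

text \<open>Operators act on the right, so \<open>f \<otimes> g\<close> is first \<open>f\<close>, then \<open>g\<close>.\<close>

definition mult_ring :: "'f ring \<Rightarrow> ('f, 'a) module \<Rightarrow> ('a \<Rightarrow> 'a) ring" where
  "mult_ring F A =
     \<lparr>carrier = {\<lambda>y \<in> carrier A. (c \<odot>\<^bsub>A\<^esub> y) \<oplus>\<^bsub>A\<^esub> f y | c f. c \<in> carrier F \<and> f \<in> mult_algebra F A},
      mult = (\<lambda>f g. \<lambda>y \<in> carrier A. g (f y)),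
      one = (\<lambda>y \<in> carrier A. y),
      zero = (\<lambda>y \<in> carrier A. \<zero>\<^bsub>A\<^esub>),
      add = (\<lambda>f g. \<lambda>y \<in> carrier A. f y \<oplus>\<^bsub>A\<^esub> g y)\<rparr>"

definition mult_module :: "('f, 'a) module \<Rightarrow> ('a \<Rightarrow> 'a, 'a) module" where
  "mult_module A =
     \<lparr>carrier = carrier A, mult = undefined, one = undefined,
      zero = zero A, add = add A, smult = (\<lambda>f x. f x)\<rparr>"

text \<open>
  A right \<open>M(A)'\<close>-module \<open>M\<close>, viewed as a module over the base ring \<open>F\<close> of \<open>A\<close> by letting
  \<open>c\<close> act as \<open>c Id\<close>.
\<close>

definition scalar_module :: "('f, 'a) module \<Rightarrow> ('a \<Rightarrow> 'a, 'm) module \<Rightarrow> ('f, 'm) module" where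
  "scalar_module A M =
     \<lparr>carrier = carrier M, mult = undefined, one = undefined,
      zero = zero M, add = add M, smult = (\<lambda>c x. scalar_op A c \<odot>\<^bsub>M\<^esub> x)\<rparr>"


section \<open>\<open>P(R)\<close> and \<open>CM(R)\<close>\<close>

text \<open>
  Throughout, \<open>I\<close> is an injective hull of the right \<open>M(R)'\<close>-module \<open>R\<close>, with inclusion \<open>e\<close>.
\<close>

definition P_carrier ::
  "'f ring \<Rightarrow> ('f, 'r) module \<Rightarrow> ('r \<Rightarrow> 'r, 'i) module \<Rightarrow> ('r \<Rightarrow> 'i) \<Rightarrow> 'i set" where
  "P_carrier F R I e =
     generate (add_monoid I) {h (e x) | h x. h \<in> rmod_hom (mult_ring F R) I I \<and> x \<in> carrier R}"

definition CM ::
  "'f ring \<Rightarrow> ('f, 'r) module \<Rightarrow> ('r \<Rightarrow> 'r, 'i) module \<Rightarrow> ('r \<Rightarrow> 'i) \<Rightarrow> ('i \<Rightarrow> 'i) ring" where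
  "CM F R I e = endo_ring (mult_ring F R) (I\<lparr>carrier := P_carrier F R I e\<rparr>)"

definition P_with_product ::
  "'f ring \<Rightarrow> ('f, 'r) module \<Rightarrow> ('r \<Rightarrow> 'r, 'i) module \<Rightarrow> ('r \<Rightarrow> 'i) \<Rightarrow> ('i \<Rightarrow> 'i \<Rightarrow> 'i)
     \<Rightarrow> ('i \<Rightarrow> 'i, 'i) module" where
  "P_with_product F R I e m =
     \<lparr>carrier = P_carrier F R I e, mult = m, one = undefined,
      zero = zero I, add = add I, smult = (\<lambda>\<alpha> x. \<alpha> x)\<rparr>"

text \<open>The unique \<open>CM(R)\<close>-bilinear extension to \<open>P(R) = CM(R)R\<close> of the product of \<open>R\<close>.\<close>

definition P_product ::
  "'f ring \<Rightarrow> ('f, 'r) module \<Rightarrow> ('r \<Rightarrow> 'r, 'i) module \<Rightarrow> ('r \<Rightarrow> 'i) \<Rightarrow> ('i \<Rightarrow> 'i \<Rightarrow> 'i)" where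
  "P_product F R I e =
     (THE m. m \<in> P_carrier F R I e \<rightarrow>\<^sub>E (P_carrier F R I e \<rightarrow>\<^sub>E P_carrier F R I e) \<and>
             nonassoc_algebra (CM F R I e) (P_with_product F R I e m) \<and>
             (\<forall>x \<in> carrier R. \<forall>y \<in> carrier R. m (e x) (e y) = e (x \<otimes>\<^bsub>R\<^esub> y)))"

definition P_algebra ::
  "'f ring \<Rightarrow> ('f, 'r) module \<Rightarrow> ('r \<Rightarrow> 'r, 'i) module \<Rightarrow> ('r \<Rightarrow> 'i) \<Rightarrow> ('i \<Rightarrow> 'i, 'i) module" where
  "P_algebra F R I e = P_with_product F R I e (P_product F R I e)"

text \<open>\<open>P(R)\<close> as an algebra over the original base ring \<open>F\<close>.\<close>

definition P_base_algebra ::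
  "'f ring \<Rightarrow> ('f, 'r) module \<Rightarrow> ('r \<Rightarrow> 'r, 'i) module \<Rightarrow> ('r \<Rightarrow> 'i) \<Rightarrow> ('f, 'i) module" where
  "P_base_algebra F R I e =
     (scalar_module R I)\<lparr>carrier := P_carrier F R I e, mult := P_product F R I e\<rparr>"


section \<open>Idempotents and ultrafilters\<close>

definition idempotents :: "'c ring \<Rightarrow> 'c set" where
  "idempotents C = {\<alpha> \<in> carrier C. \<alpha> \<otimes>\<^bsub>C\<^esub> \<alpha> = \<alpha>}"

definition dense_orthogonal :: "'c ring \<Rightarrow> 'c set \<Rightarrow> bool" where
  "dense_orthogonal C D \<longleftrightarrow>
     D \<subseteq> idempotents C \<and>
     {\<beta> \<in> idempotents C. \<forall>\<xi> \<in> D. \<beta> \<otimes>\<^bsub>C\<^esub> \<xi> = \<zero>\<^bsub>C\<^esub>} = {\<zero>\<^bsub>C\<^esub>} \<and>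
     (\<forall>\<xi> \<in> D. \<forall>\<chi> \<in> D. \<xi> \<noteq> \<chi> \<longrightarrow> \<xi> \<otimes>\<^bsub>C\<^esub> \<chi> = \<zero>\<^bsub>C\<^esub>)"

definition idempotent_ultrafilter :: "'c ring \<Rightarrow> 'c set \<Rightarrow> bool" where
  "idempotent_ultrafilter C B \<longleftrightarrow>
     B \<subseteq> idempotents C - {\<zero>\<^bsub>C\<^esub>} \<and>
     (\<forall>\<alpha> \<in> B. \<forall>\<beta> \<in> B. \<alpha> \<otimes>\<^bsub>C\<^esub> \<beta> \<in> B) \<and>
     (\<forall>\<alpha> \<in> B. \<forall>\<beta> \<in> idempotents C. \<alpha> \<otimes>\<^bsub>C\<^esub> \<beta> = \<alpha> \<longrightarrow> \<beta> \<in> B) \<and>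
     (\<forall>\<alpha> \<in> idempotents C. \<alpha> \<in> B \<or> \<one>\<^bsub>C\<^esub> \<ominus>\<^bsub>C\<^esub> \<alpha> \<in> B)"


section \<open>Orthogonal completions\<close>

text \<open>
  \<open>V\<close> is \<open>I(P(R))\<close> as a \<open>CM(R)\<close>-module. A family \<open>{x\<^sub>a}\<close> is indexed by the orthogonal
  set \<open>D\<close> itself.
\<close>

definition orth_complete :: "'c ring \<Rightarrow> ('c, 'v) module \<Rightarrow> 'v set \<Rightarrow> bool" where
  "orth_complete C V S \<longleftrightarrow>
     S \<subseteq> carrier V \<and>
     (\<forall>D u. dense_orthogonal C D \<and> u \<in> D \<rightarrow> S \<longrightarrow>
        (\<exists>x \<in> S. \<forall>\<xi> \<in> D. \<xi> \<odot>\<^bsub>V\<^esub> x = \<xi> \<odot>\<^bsub>V\<^esub> u \<xi>))"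

definition orth_completion :: "'c ring \<Rightarrow> ('c, 'v) module \<Rightarrow> 'v set \<Rightarrow> 'v set" where
  "orth_completion C V S = \<Inter> {T. orth_complete C V T \<and> S \<subseteq> T}"

text \<open>
  The operation on \<open>O(A)\<close> induced by an operation of an algebra \<open>A\<close> included in \<open>V\<close> by \<open>j\<close>: it sends
  \<open>\<Sum>\<^sup>\<bottom> \<xi>\<^sub>a x\<^sub>a\<close> and \<open>\<Sum>\<^sup>\<bottom> \<chi>\<^sub>b y\<^sub>b\<close> to \<open>\<Sum>\<^sup>\<bottom> \<xi>\<^sub>a \<chi>\<^sub>b (x\<^sub>a \<star> y\<^sub>b)\<close>.
\<close>

definition orth_op ::
  "'c ring \<Rightarrow> ('c, 'v) module \<Rightarrow> 'a set \<Rightarrow> ('a \<Rightarrow> 'v) \<Rightarrow> ('a \<Rightarrow> 'a \<Rightarrow> 'a) \<Rightarrow> 'v \<Rightarrow> 'v \<Rightarrow> 'v" where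
  "orth_op C V S j star x y =
     (THE z. z \<in> orth_completion C V (j ` S) \<and>
        (\<exists>D E u v. dense_orthogonal C D \<and> dense_orthogonal C E \<and> u \<in> D \<rightarrow> S \<and> v \<in> E \<rightarrow> S \<and>
           (\<forall>\<xi> \<in> D. \<xi> \<odot>\<^bsub>V\<^esub> x = \<xi> \<odot>\<^bsub>V\<^esub> j (u \<xi>)) \<and>
           (\<forall>\<chi> \<in> E. \<chi> \<odot>\<^bsub>V\<^esub> y = \<chi> \<odot>\<^bsub>V\<^esub> j (v \<chi>)) \<and>
           (\<forall>\<xi> \<in> D. \<forall>\<chi> \<in> E.
              (\<xi> \<otimes>\<^bsub>C\<^esub> \<chi>) \<odot>\<^bsub>V\<^esub> z = (\<xi> \<otimes>\<^bsub>C\<^esub> \<chi>) \<odot>\<^bsub>V\<^esub> j (star (u \<xi>) (v \<chi>)))))"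

definition O_algebra ::
  "'c ring \<Rightarrow> ('c, 'v) module \<Rightarrow> ('c, 'a) module \<Rightarrow> ('a \<Rightarrow> 'v) \<Rightarrow> ('c, 'v) module" where
  "O_algebra C V A j =
     \<lparr>carrier = orth_completion C V (j ` carrier A),
      mult = orth_op C V (carrier A) j (mult A), one = undefined,
      zero = zero V, add = orth_op C V (carrier A) j (add A), smult = smult V\<rparr>"


section \<open>\<open>Q\<^sub>m(P(R))\<close> inside \<open>I(P(R))\<close>, and the quotients \<open>S\<^sub>B\<close>\<close>

text \<open>
  An algebra \<open>Q\<close> over \<open>C\<close> containing \<open>A\<close> via \<open>j\<close>, and realized as an \<open>M(A)'\<close>-submodule of the
  injective hull \<open>J\<close> of \<open>A\<close>: the multiplication operators \<open>l\<^sub>x\<close>, \<open>r\<^sub>x\<close> with \<open>x \<in> A\<close>, and the scalars,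
  act in \<open>J\<close> on the elements of \<open>Q\<close> as they do in the algebra \<open>Q\<close>. (That \<open>A\<close> is essential in \<open>Q\<close>
  is inherited from \<open>J\<close>.)
\<close>

definition embedded_in_hull ::
  "'c ring \<Rightarrow> ('c, 'a) module \<Rightarrow> ('a \<Rightarrow> 'a, 'v) module \<Rightarrow> ('a \<Rightarrow> 'v) \<Rightarrow> ('c, 'v) module \<Rightarrow> bool" where
  "embedded_in_hull C A J j Q \<longleftrightarrow>
     submodule (carrier Q) (mult_ring C A) J \<and>
     (\<forall>p \<in> carrier Q. \<forall>q \<in> carrier Q. p \<oplus>\<^bsub>Q\<^esub> q = p \<oplus>\<^bsub>J\<^esub> q) \<and>
     (\<forall>c \<in> carrier C. \<forall>q \<in> carrier Q. c \<odot>\<^bsub>Q\<^esub> q = scalar_op A c \<odot>\<^bsub>J\<^esub> q) \<and>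
     (\<forall>x \<in> carrier A. \<forall>q \<in> carrier Q.
        j x \<otimes>\<^bsub>Q\<^esub> q = left_mult A x \<odot>\<^bsub>J\<^esub> q \<and> q \<otimes>\<^bsub>Q\<^esub> j x = right_mult A x \<odot>\<^bsub>J\<^esub> q)"

definition ultra_kernel :: "'c ring \<Rightarrow> 'c set \<Rightarrow> ('c, 'a) module \<Rightarrow> 'a set" where
  "ultra_kernel C B A =
     carrier A \<inter> {\<alpha> \<odot>\<^bsub>A\<^esub> x | \<alpha> x. \<alpha> \<in> idempotents C - B \<and> x \<in> carrier A}"

definition ultra_quotient :: "'c ring \<Rightarrow> 'c set \<Rightarrow> ('c, 'a) module \<Rightarrow> ('c, 'a set) module" where
  "ultra_quotient C B A =
     \<lparr>carrier = a_rcosets\<^bsub>A\<^esub> (ultra_kernel C B A),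
      mult = rcoset_mult A (ultra_kernel C B A), one = undefined,
      zero = ultra_kernel C B A, add = set_add A,
      smult = (\<lambda>c X. \<Union>x \<in> X. ultra_kernel C B A +>\<^bsub>A\<^esub> (c \<odot>\<^bsub>A\<^esub> x))\<rparr>"

text \<open>The canonical map \<open>x + PS \<mapsto> x + PQ\<close> from \<open>S\<^sub>B\<close> to \<open>Q\<^sub>B\<close>, for \<open>S \<subseteq> Q\<close>.\<close>

definition ultra_inclusion :: "'c ring \<Rightarrow> 'c set \<Rightarrow> ('c, 'a) module \<Rightarrow> 'a set \<Rightarrow> 'a set" where
  "ultra_inclusion C B Q X = (\<Union>x \<in> X. ultra_kernel C B Q +>\<^bsub>Q\<^esub> x)"

end

theory Submission
  imports Defs
begin

text \<open>
  Non-degeneracy enters through the fact that an element \<open>t\<close> of an ideal \<open>K\<close> with \<open>tK = 0\<close>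
  vanishes. The linearized Jordan identity shows that \<open>xK = 0\<close> forces
  \<open>((xy)w)z = 0\<close> for \<open>w, z \<in> K\<close>; hence ideals with zero annihilator have no annihilating elements,
  neither in the algebra nor in its algebras of \<open>\<MM>\<close>-quotients, and the property passes from \<open>R\<close>
  to \<open>P(R)\<close>. Injectivity of the hull of \<open>R\<close> yields an idempotent support in \<open>CM(R)\<close> for every subset
  of \<open>P(R)\<close>.

  Orthogonal completeness of \<open>Q\<^sub>m(P(R))\<close> comes from maximality: for a dense orthogonal set \<open>D\<close> the
  product of the \<open>\<xi>Q\<close>, \<open>\<xi> \<in> D\<close>, is again an algebra of \<open>\<MM>\<close>-quotients of \<open>P(R)\<close>, and its embedding
  into \<open>Q\<close> glues families. For the ultraproduct statement one glues denominators of \<open>q\<close> along a maximal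
  orthogonal set to obtain a single multiplier \<open>k\<close> such that \<open>kq\<close> has the same support as \<open>q\<close>.
\<close>

section \<open>Nonassociative and Jordan algebras\<close>

text \<open>Faithfulness of ideals speaks of elements inside an ideal, whereas denominators concern
  arbitrary elements p. The bridge is to pass from p to (py)k, which lies in the ideal and, by the
  Jordan identity, still kills it if p does; this detour recurs in R, in Q and in P(R). The product
  of P(R) is known only through CM(R)-linear extension from R, so identities are carried over in
  multilinear form. This is where division by 2 (linearizing) and by 3 (returning to the cubic
  identity) enters. Elements of CM(R) need not map R into R. They do so on essential ideals, and a
  module endomorphism of P(R) that vanishes on an essential ideal is zero. A nonzero element of Q_B
  may have kq = 0 in Q_B although kq is nonzero in Q: the support of kq may fall outside B while
  that of q belongs to B. Hence the search for a multiplier of full support. It is found by gluing,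
  so the ideal of denominators is a glued one and the base algebra is O(P(R)).\<close>

lemma (in abelian_group) double_zero_cubic:
  assumes closed: "\<And>a b c. \<lbrakk>a \<in> carrier G; b \<in> carrier G; c \<in> carrier G\<rbrakk> \<Longrightarrow> T a b c \<in> carrier G"
    and add1: "\<And>a a' b c. \<lbrakk>a \<in> carrier G; a' \<in> carrier G; b \<in> carrier G; c \<in> carrier G\<rbrakk>
      \<Longrightarrow> T (a \<oplus> a') b c = T a b c \<oplus> T a' b c"
    and add3: "\<And>a c c' b. \<lbrakk>a \<in> carrier G; b \<in> carrier G; c \<in> carrier G; c' \<in> carrier G\<rbrakk>
      \<Longrightarrow> T a b (c \<oplus> c') = T a b c \<oplus> T a b c'"
    and sym: "\<And>a b c. \<lbrakk>a \<in> carrier G; b \<in> carrier G; c \<in> carrier G\<rbrakk> \<Longrightarrow> T a b c = T b a c"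
    and diag: "\<And>a. a \<in> carrier G \<Longrightarrow> T a a a = \<zero>"
    and half: "\<And>g. \<lbrakk>g \<in> carrier G; g \<oplus> g = \<zero>\<rbrakk> \<Longrightarrow> g = \<zero>"
    and abc: "a \<in> carrier G" "b \<in> carrier G" "c \<in> carrier G"
  shows "T a b c \<oplus> T b c a \<oplus> T c a b = \<zero>"
proof -
  note [simp] = closed
  have add2: "T a (b \<oplus> b') c = T a b c \<oplus> T a b' c"
    if "a \<in> carrier G" "b \<in> carrier G" "b' \<in> carrier G" "c \<in> carrier G" for a b b' c
    using that by (simp add: sym[of a] add1)
  \<comment> \<open>\<open>d a b\<close> is the part of \<open>T\<close> at (a + b, a + b, a + b)
    that is quadratic in a and linear in b. Replacing b by -b changes the sign of
    \<open>d a b\<close> but not of \<open>d b a\<close>, so \<open>d_sum\<close> gives twice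
    \<open>d a b\<close> = 0. Polarizing \<open>d a c\<close> in a then produces twice the cyclic
    sum.\<close>
  define d where "d a b = T a a b \<oplus> T a b a \<oplus> T a b a" for a b
  have d_closed [simp]: "d a b \<in> carrier G" if "a \<in> carrier G" "b \<in> carrier G" for a b
    using that by (simp add: d_def)
  have d_sum: "d a b \<oplus> d b a = \<zero>" if "a \<in> carrier G" "b \<in> carrier G" for a b
  proof -
    have "T (a \<oplus> b) (a \<oplus> b) (a \<oplus> b) = T a a a \<oplus> T b b b \<oplus> (d a b \<oplus> d b a)"
      using that by (simp add: d_def add1 add2 add3 a_ac sym[of b a])
    then show ?thesis using that by (simp add: diag)
  qed
  have d_add: "d a (b \<oplus> b') = d a b \<oplus> d a b'"
    if "a \<in> carrier G" "b \<in> carrier G" "b' \<in> carrier G" for a b b'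
    using that by (simp add: d_def add1 add2 add3 a_ac)
  have d_zero: "d a b = \<zero>" if ab: "a \<in> carrier G" "b \<in> carrier G" for a b
  proof -
    have d0: "d a \<zero> = \<zero>" using d_add[of a \<zero> \<zero>] ab by simp
    have neg: "d a (\<ominus> b) = \<ominus> d a b"
      using d_add[of a "\<ominus> b" b] ab d0 by (simp add: l_neg minus_equality)
    have T1: "T (\<ominus> x) y z = \<ominus> T x y z" if "x \<in> carrier G" "y \<in> carrier G" "z \<in> carrier G" for x y z
    proof -
      have "T \<zero> y z = \<zero>" using add1[of \<zero> \<zero> y z] that by simp
      then show ?thesis using add1[of "\<ominus> x" x y z] that by (simp add: l_neg minus_equality)
    qed
    have T3: "T x y (\<ominus> z) = \<ominus> T x y z" if "x \<in> carrier G" "y \<in> carrier G" "z \<in> carrier G" for x y z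
    proof -
      have "T x y \<zero> = \<zero>" using add3[of x y \<zero> \<zero>] that by simp
      then show ?thesis using add3[of x y "\<ominus> z" z] that by (simp add: l_neg minus_equality)
    qed
    have "d (\<ominus> b) a = d b a"
      using ab by (simp add: d_def T1 T3 sym[of b "\<ominus> b"] sym[of a "\<ominus> b"] sym[of "\<ominus> b" a])
    then have "\<ominus> d a b \<oplus> d b a = \<zero>"
      using d_sum[of a "\<ominus> b"] ab neg by simp
    then have "d b a = d a b"
      using ab minus_equality[of "d b a" "\<ominus> d a b"] by (simp add: a_comm)
    then have "d a b \<oplus> d a b = \<zero>" using d_sum[OF ab] by simp
    then show ?thesis by (rule half[OF d_closed[OF ab]])
  qed
  have "d (a \<oplus> b) c = d a c \<oplus> d b c \<oplus> ((T a b c \<oplus> T b c a \<oplus> T c a b) \<oplus> (T a b c \<oplus> T b c a \<oplus> T c a b))"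
    using abc by (simp add: d_def add1 add2 add3 a_ac sym[of b a] sym[of c a])
  then have "(T a b c \<oplus> T b c a \<oplus> T c a b) \<oplus> (T a b c \<oplus> T b c a \<oplus> T c a b) = \<zero>"
    using abc by (simp add: d_zero)
  then show ?thesis by (rule half[rotated]) (use abc in simp)
qed

lemma (in abelian_group) eq_of_sum_diff_zero:
  assumes "x1 \<in> carrier G" "x2 \<in> carrier G" "x3 \<in> carrier G" "y1 \<in> carrier G" "y2 \<in> carrier G" "y3 \<in> carrier G"
    and "(x1 \<ominus> y1) \<oplus> (x2 \<ominus> y2) \<oplus> (x3 \<ominus> y3) = \<zero>"
  shows "x1 \<oplus> x2 \<oplus> x3 = y1 \<oplus> y2 \<oplus> y3"
proof -
  have "(x1 \<oplus> x2 \<oplus> x3) \<oplus> \<ominus> (y1 \<oplus> y2 \<oplus> y3) = \<zero>"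
    using assms by (simp add: minus_eq minus_add a_ac)
  then show ?thesis using assms by (metis add.m_closed add.inv_closed add.inv_inv minus_equality)
qed

lemma (in abelian_group) eq_iff_minus_zero:
  "\<lbrakk>x \<in> carrier G; y \<in> carrier G\<rbrakk> \<Longrightarrow> x \<ominus> y = \<zero> \<longleftrightarrow> x = y"
  using minus_equality[of x "\<ominus> y"] by (auto simp: minus_eq r_neg a_comm)

context nonassoc_algebra
begin

lemma mult_zero_left [simp]: "x \<in> carrier A \<Longrightarrow> \<zero>\<^bsub>A\<^esub> \<otimes>\<^bsub>A\<^esub> x = \<zero>\<^bsub>A\<^esub>"
  by (metis M.add.r_cancel_one' M.l_zero M.zero_closed mult_add_left mult_closed)

lemma mult_zero_right [simp]: "x \<in> carrier A \<Longrightarrow> x \<otimes>\<^bsub>A\<^esub> \<zero>\<^bsub>A\<^esub> = \<zero>\<^bsub>A\<^esub>"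
  by (metis M.add.r_cancel_one' M.l_zero M.zero_closed mult_add_right mult_closed)

lemma mult_minus_left: "\<lbrakk>x \<in> carrier A; y \<in> carrier A\<rbrakk> \<Longrightarrow> (\<ominus>\<^bsub>A\<^esub> x) \<otimes>\<^bsub>A\<^esub> y = \<ominus>\<^bsub>A\<^esub> (x \<otimes>\<^bsub>A\<^esub> y)"
  using mult_add_left[of "\<ominus>\<^bsub>A\<^esub> x" x y]
  by (simp add: M.l_neg mult_closed M.minus_equality)

lemma mult_minus_right: "\<lbrakk>x \<in> carrier A; y \<in> carrier A\<rbrakk> \<Longrightarrow> x \<otimes>\<^bsub>A\<^esub> (\<ominus>\<^bsub>A\<^esub> y) = \<ominus>\<^bsub>A\<^esub> (x \<otimes>\<^bsub>A\<^esub> y)"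
  using mult_add_right[of x "\<ominus>\<^bsub>A\<^esub> y" y]
  by (simp add: M.l_neg mult_closed M.minus_equality)

lemma mult_diff_left: "\<lbrakk>x \<in> carrier A; y \<in> carrier A; z \<in> carrier A\<rbrakk>
    \<Longrightarrow> (x \<ominus>\<^bsub>A\<^esub> y) \<otimes>\<^bsub>A\<^esub> z = (x \<otimes>\<^bsub>A\<^esub> z) \<ominus>\<^bsub>A\<^esub> (y \<otimes>\<^bsub>A\<^esub> z)"
  by (simp add: M.minus_eq mult_add_left mult_minus_left)

lemma mult_diff_right: "\<lbrakk>x \<in> carrier A; y \<in> carrier A; z \<in> carrier A\<rbrakk>
    \<Longrightarrow> z \<otimes>\<^bsub>A\<^esub> (x \<ominus>\<^bsub>A\<^esub> y) = (z \<otimes>\<^bsub>A\<^esub> x) \<ominus>\<^bsub>A\<^esub> (z \<otimes>\<^bsub>A\<^esub> y)"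
  by (simp add: M.minus_eq mult_add_right mult_minus_right)

lemma add_pow_eq_smult: "x \<in> carrier A \<Longrightarrow> add_pow A (n::nat) x = add_pow F n \<one>\<^bsub>F\<^esub> \<odot>\<^bsub>A\<^esub> x"
  by (induction n) (simp_all add: smult_l_distr)

text \<open>The unit 6 enters calculations as absence of torsion: \<open>double_cancel\<close>
  serves the linearization of the Jordan identity, \<open>triple_cancel\<close> the return from the
  linearized identity to the original one.\<close>

lemma six_cancel:
  assumes x: "x \<in> carrier A" and "add_pow A (6::nat) x = \<zero>\<^bsub>A\<^esub>"
  shows "x = \<zero>\<^bsub>A\<^esub>"
proof -
  let ?u = "add_pow F (6::nat) \<one>\<^bsub>F\<^esub>"
  obtain v where v: "v \<in> carrier F" "v \<otimes>\<^bsub>F\<^esub> ?u = \<one>\<^bsub>F\<^esub>"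
    using six_unit unfolding Units_def by auto
  have "v \<odot>\<^bsub>A\<^esub> (?u \<odot>\<^bsub>A\<^esub> x) = \<zero>\<^bsub>A\<^esub>"
    using assms v(1) by (simp add: add_pow_eq_smult)
  then show ?thesis
    using v x by (simp flip: smult_assoc1)
qed

lemma add_pow_six: "x \<in> carrier A \<Longrightarrow> add_pow A (6::nat) x = x \<oplus>\<^bsub>A\<^esub> x \<oplus>\<^bsub>A\<^esub> (x \<oplus>\<^bsub>A\<^esub> x) \<oplus>\<^bsub>A\<^esub> (x \<oplus>\<^bsub>A\<^esub> x)"
  by (simp add: numeral_eq_Suc M.a_ac)

lemma double_cancel: "\<lbrakk>x \<in> carrier A; x \<oplus>\<^bsub>A\<^esub> x = \<zero>\<^bsub>A\<^esub>\<rbrakk> \<Longrightarrow> x = \<zero>\<^bsub>A\<^esub>"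
  by (rule six_cancel) (simp_all add: add_pow_six)

lemma triple_cancel:
  assumes x: "x \<in> carrier A" and x3: "x \<oplus>\<^bsub>A\<^esub> x \<oplus>\<^bsub>A\<^esub> x = \<zero>\<^bsub>A\<^esub>"
  shows "x = \<zero>\<^bsub>A\<^esub>"
proof (rule six_cancel[OF x])
  have "add_pow A (6::nat) x = (x \<oplus>\<^bsub>A\<^esub> x \<oplus>\<^bsub>A\<^esub> x) \<oplus>\<^bsub>A\<^esub> (x \<oplus>\<^bsub>A\<^esub> x \<oplus>\<^bsub>A\<^esub> x)"
    using x by (simp add: add_pow_six M.a_ac)
  then show "add_pow A (6::nat) x = \<zero>\<^bsub>A\<^esub>" by (simp only: x3) simp
qed

lemma minus_eq_smult: "x \<in> carrier A \<Longrightarrow> \<ominus>\<^bsub>A\<^esub> x = (\<ominus>\<^bsub>F\<^esub> \<one>\<^bsub>F\<^esub>) \<odot>\<^bsub>A\<^esub> x"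
  by (simp add: smult_l_minus)

lemma algebra_idealI:
  assumes "K \<subseteq> carrier A" "\<zero>\<^bsub>A\<^esub> \<in> K" "\<And>x y. \<lbrakk>x \<in> K; y \<in> K\<rbrakk> \<Longrightarrow> x \<oplus>\<^bsub>A\<^esub> y \<in> K"
    and sm: "\<And>c x. \<lbrakk>c \<in> carrier F; x \<in> K\<rbrakk> \<Longrightarrow> c \<odot>\<^bsub>A\<^esub> x \<in> K"
    and "\<And>a x. \<lbrakk>a \<in> K; x \<in> carrier A\<rbrakk> \<Longrightarrow> a \<otimes>\<^bsub>A\<^esub> x \<in> K"
    and "\<And>a x. \<lbrakk>a \<in> K; x \<in> carrier A\<rbrakk> \<Longrightarrow> x \<otimes>\<^bsub>A\<^esub> a \<in> K"
  shows "algebra_ideal F A K"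
  unfolding algebra_ideal_def
proof (intro conjI ballI)
  have neg: "\<ominus>\<^bsub>A\<^esub> x \<in> K" if "x \<in> K" for x
    using that assms(1) sm[of "\<ominus>\<^bsub>F\<^esub> \<one>\<^bsub>F\<^esub>" x] by (auto simp: minus_eq_smult)
  show "submodule K F A"
    by (rule submoduleI) (use assms neg in auto)
qed (use assms in auto)

lemma algebra_idealD:
  assumes "algebra_ideal F A K"
  shows "K \<subseteq> carrier A" "\<zero>\<^bsub>A\<^esub> \<in> K" "\<And>x y. \<lbrakk>x \<in> K; y \<in> K\<rbrakk> \<Longrightarrow> x \<oplus>\<^bsub>A\<^esub> y \<in> K"
    and "\<And>x. x \<in> K \<Longrightarrow> \<ominus>\<^bsub>A\<^esub> x \<in> K"
    and "\<And>c x. \<lbrakk>c \<in> carrier F; x \<in> K\<rbrakk> \<Longrightarrow> c \<odot>\<^bsub>A\<^esub> x \<in> K"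
    and "\<And>a x. \<lbrakk>a \<in> K; x \<in> carrier A\<rbrakk> \<Longrightarrow> a \<otimes>\<^bsub>A\<^esub> x \<in> K"
    and "\<And>a x. \<lbrakk>a \<in> K; x \<in> carrier A\<rbrakk> \<Longrightarrow> x \<otimes>\<^bsub>A\<^esub> a \<in> K"
proof -
  have sm: "submodule K F A" using assms by (simp add: algebra_ideal_def)
  note E = submoduleE[OF sm]
  show "K \<subseteq> carrier A" "\<And>x y. \<lbrakk>x \<in> K; y \<in> K\<rbrakk> \<Longrightarrow> x \<oplus>\<^bsub>A\<^esub> y \<in> K"
    "\<And>x. x \<in> K \<Longrightarrow> \<ominus>\<^bsub>A\<^esub> x \<in> K" "\<And>c x. \<lbrakk>c \<in> carrier F; x \<in> K\<rbrakk> \<Longrightarrow> c \<odot>\<^bsub>A\<^esub> x \<in> K"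
    using E by auto
  obtain x where x: "x \<in> K" using E(2) by auto
  then have "x \<oplus>\<^bsub>A\<^esub> \<ominus>\<^bsub>A\<^esub> x \<in> K" using E by blast
  then show "\<zero>\<^bsub>A\<^esub> \<in> K" using x E(1) by (auto simp: M.r_neg)
qed (use assms in \<open>auto simp: algebra_ideal_def\<close>)

lemma algebra_ideal_inter:
  assumes K: "algebra_ideal F A K" and L: "algebra_ideal F A L"
  shows "algebra_ideal F A (K \<inter> L)"
  by (rule algebra_idealI) (use algebra_idealD[OF K] algebra_idealD[OF L] in auto)

lemma algebra_ideal_carrier: "algebra_ideal F A (carrier A)"
  by (rule algebra_idealI) (auto simp: mult_closed)

end

text \<open>A condition between nondegeneracy and semiprimeness: a nonzero ideal of square zero
  would consist of such elements t. It is applied to R over F and to P(R) over CM(R).\<close>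

definition ideals_faithful :: "'f ring \<Rightarrow> ('f, 'a) module \<Rightarrow> bool" where
  "ideals_faithful F A \<longleftrightarrow>
     (\<forall>K t. algebra_ideal F A K \<and> t \<in> K \<and> (\<forall>k \<in> K. t \<otimes>\<^bsub>A\<^esub> k = \<zero>\<^bsub>A\<^esub>) \<longrightarrow> t = \<zero>\<^bsub>A\<^esub>)"

lemma ideals_faithfulD:
  "\<lbrakk>ideals_faithful F A; algebra_ideal F A K; t \<in> K; \<And>k. k \<in> K \<Longrightarrow> t \<otimes>\<^bsub>A\<^esub> k = \<zero>\<^bsub>A\<^esub>\<rbrakk> \<Longrightarrow> t = \<zero>\<^bsub>A\<^esub>"
  unfolding ideals_faithful_def by blast

section \<open>Linearized Jordan identity and annihilators of ideals\<close>

context jordan_algebra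
begin

abbreviation amult (infixl \<open>\<bullet>\<close> 70) where "x \<bullet> y \<equiv> x \<otimes>\<^bsub>A\<^esub> y"

text \<open>For fixed y the associator ((ab)y)c - (ab)(yc) is symmetric in a and b and vanishes for
  a = b = c by the Jordan identity, so its cyclic sum vanishes by
  \<open>double_zero_cubic\<close>.\<close>

lemma linearized_jordan:
  assumes abcy: "a \<in> carrier A" "b \<in> carrier A" "c \<in> carrier A" "y \<in> carrier A"
  shows "((a \<bullet> b) \<bullet> y) \<bullet> c \<oplus>\<^bsub>A\<^esub> ((b \<bullet> c) \<bullet> y) \<bullet> a \<oplus>\<^bsub>A\<^esub> ((c \<bullet> a) \<bullet> y) \<bullet> b =
    (a \<bullet> b) \<bullet> (y \<bullet> c) \<oplus>\<^bsub>A\<^esub> (b \<bullet> c) \<bullet> (y \<bullet> a) \<oplus>\<^bsub>A\<^esub> (c \<bullet> a) \<bullet> (y \<bullet> b)"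
proof (rule M.eq_of_sum_diff_zero)
  let ?T = "\<lambda>a b c. ((a \<bullet> b) \<bullet> y) \<bullet> c \<ominus>\<^bsub>A\<^esub> (a \<bullet> b) \<bullet> (y \<bullet> c)"
  have minus4: "(p \<oplus>\<^bsub>A\<^esub> q) \<ominus>\<^bsub>A\<^esub> (r \<oplus>\<^bsub>A\<^esub> s) = (p \<ominus>\<^bsub>A\<^esub> r) \<oplus>\<^bsub>A\<^esub> (q \<ominus>\<^bsub>A\<^esub> s)"
    if "p \<in> carrier A" "q \<in> carrier A" "r \<in> carrier A" "s \<in> carrier A" for p q r s
    using that by (simp add: M.minus_eq M.minus_add M.a_ac)
  show "?T a b c \<oplus>\<^bsub>A\<^esub> ?T b c a \<oplus>\<^bsub>A\<^esub> ?T c a b = \<zero>\<^bsub>A\<^esub>"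
  proof (rule M.double_zero_cubic[of ?T])
    show "?T a a a = \<zero>\<^bsub>A\<^esub>" if "a \<in> carrier A" for a
      using that abcy by (simp add: jordan_identity mult_closed M.eq_iff_minus_zero)
    show "?T a b c = ?T b a c" if "a \<in> carrier A" "b \<in> carrier A" "c \<in> carrier A" for a b c
      using that by (simp add: mult_comm[of a b])
    show "g = \<zero>\<^bsub>A\<^esub>" if "g \<in> carrier A" "g \<oplus>\<^bsub>A\<^esub> g = \<zero>\<^bsub>A\<^esub>" for g
      by (rule double_cancel[OF that])
  qed (use abcy in \<open>auto simp: mult_closed mult_add_left mult_add_right minus4\<close>)
qed (use abcy in \<open>auto simp: mult_closed\<close>)

text \<open>In the linearized identity for x, y, z with middle factor w, the assumptions erase all
  terms except one on each side.\<close>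

lemma jordan_shift:
  assumes "x \<in> carrier A" "y \<in> carrier A" "w \<in> carrier A" "z \<in> carrier A"
    and "x \<bullet> z = \<zero>\<^bsub>A\<^esub>" "x \<bullet> (y \<bullet> z \<bullet> w) = \<zero>\<^bsub>A\<^esub>" "(x \<bullet> w) \<bullet> (y \<bullet> z) = \<zero>\<^bsub>A\<^esub>"
  shows "((x \<bullet> y) \<bullet> w) \<bullet> z = (x \<bullet> y) \<bullet> (w \<bullet> z)"
proof -
  have "z \<bullet> x = \<zero>\<^bsub>A\<^esub>" "(y \<bullet> z \<bullet> w) \<bullet> x = \<zero>\<^bsub>A\<^esub>" "(y \<bullet> z) \<bullet> (w \<bullet> x) = \<zero>\<^bsub>A\<^esub>"
    using assms by (simp_all add: mult_comm mult_closed)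
  then show ?thesis
    using linearized_jordan[of x y z w] assms by (simp add: mult_closed)
qed

lemma jordan_kills_products:
  assumes "x \<in> carrier A" "y \<in> carrier A" "w \<in> carrier A" "z \<in> carrier A"
    and "x \<bullet> z = \<zero>\<^bsub>A\<^esub>" "x \<bullet> w = \<zero>\<^bsub>A\<^esub>" "x \<bullet> (w \<bullet> z \<bullet> y) = \<zero>\<^bsub>A\<^esub>"
  shows "(x \<bullet> y) \<bullet> (w \<bullet> z) = \<zero>\<^bsub>A\<^esub>"
proof -
  have "z \<bullet> x = \<zero>\<^bsub>A\<^esub>" "(w \<bullet> z \<bullet> y) \<bullet> x = \<zero>\<^bsub>A\<^esub>"
    using assms by (simp_all add: mult_comm mult_closed)
  then have "(w \<bullet> z) \<bullet> (y \<bullet> x) = \<zero>\<^bsub>A\<^esub>"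
    using linearized_jordan[of x w z y] assms by (simp add: mult_closed)
  then show ?thesis using assms by (simp add: mult_comm mult_closed)
qed

text \<open>The form in which the Jordan identity is applied: if x kills an ideal containing w and
  z, all assumptions hold for every y, because a product with a factor in the ideal stays in
  it.\<close>

lemma jordan_kills_twice:
  assumes "x \<in> carrier A" "y \<in> carrier A" "w \<in> carrier A" "z \<in> carrier A"
    and "x \<bullet> z = \<zero>\<^bsub>A\<^esub>" "x \<bullet> w = \<zero>\<^bsub>A\<^esub>" "x \<bullet> (w \<bullet> z \<bullet> y) = \<zero>\<^bsub>A\<^esub>" "x \<bullet> (y \<bullet> z \<bullet> w) = \<zero>\<^bsub>A\<^esub>"
  shows "((x \<bullet> y) \<bullet> w) \<bullet> z = \<zero>\<^bsub>A\<^esub>"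
  using assms jordan_shift[of x y w z] jordan_kills_products[of x y w z]
  by (simp add: mult_closed)

text \<open>If x kills K, then yz lies in K for z in K, so two of the three terms of {x,z,y} vanish
  and the triple condition becomes (xy)z = 0.\<close>

lemma jordan_annihilator_iff:
  assumes K: "algebra_ideal F A K"
  shows "x \<in> jordan_annihilator A K \<longleftrightarrow>
    x \<in> carrier A \<and> (\<forall>z \<in> K. x \<bullet> z = \<zero>\<^bsub>A\<^esub>) \<and> (\<forall>z \<in> K. \<forall>y \<in> carrier A. (x \<bullet> y) \<bullet> z = \<zero>\<^bsub>A\<^esub>)"
proof -
  have "jordan_triple A x z y = \<ominus>\<^bsub>A\<^esub> ((x \<bullet> y) \<bullet> z)"
    if x: "x \<in> carrier A" "\<forall>z \<in> K. x \<bullet> z = \<zero>\<^bsub>A\<^esub>" and zy: "z \<in> K" "y \<in> carrier A" for x z y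
  proof -
    have z: "z \<in> carrier A" "y \<bullet> z \<in> K" "y \<bullet> z \<in> carrier A" using algebra_idealD[OF K] zy by auto
    then have "(y \<bullet> z) \<bullet> x = \<zero>\<^bsub>A\<^esub>" using x by (simp add: mult_comm)
    then show ?thesis using x zy z by (simp add: jordan_triple_def M.minus_eq mult_closed)
  qed
  moreover have "\<ominus>\<^bsub>A\<^esub> u = \<zero>\<^bsub>A\<^esub> \<longleftrightarrow> u = \<zero>\<^bsub>A\<^esub>" if "u \<in> carrier A" for u
    using that by (metis M.add.inv_eq_1_iff)
  ultimately show ?thesis
    unfolding jordan_annihilator_def using algebra_idealD(1)[OF K]
    by (auto simp: mult_closed subset_iff)
qed

text \<open>For closure under multiplication by x, \<open>jordan_shift\<close> rewrites ((ax)w)z as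
  (ax)(wz), and wz again lies in K.\<close>

lemma algebra_ideal_jordan_annihilator:
  assumes K: "algebra_ideal F A K"
  shows "algebra_ideal F A (jordan_annihilator A K)"
proof -
  note KD = algebra_idealD[OF K]
  let ?J = "jordan_annihilator A K"
  note iff = jordan_annihilator_iff[OF K]
  have right: "a \<bullet> x \<in> ?J" if a: "a \<in> ?J" and x: "x \<in> carrier A" for a x
  proof -
    have ac: "a \<in> carrier A" and aK: "\<And>z. z \<in> K \<Longrightarrow> a \<bullet> z = \<zero>\<^bsub>A\<^esub>"
      and axK: "\<And>z y. \<lbrakk>z \<in> K; y \<in> carrier A\<rbrakk> \<Longrightarrow> (a \<bullet> y) \<bullet> z = \<zero>\<^bsub>A\<^esub>"
      using a iff by auto
    have "((a \<bullet> x) \<bullet> w) \<bullet> z = \<zero>\<^bsub>A\<^esub>" if "z \<in> K" "w \<in> carrier A" for z w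
    proof -
      have "z \<in> carrier A" using KD that by auto
      then show ?thesis
        using jordan_shift[of a x w z] that ac x aK axK KD by (simp add: mult_closed)
    qed
    then show ?thesis using iff ac x axK by (auto simp: mult_closed)
  qed
  show ?thesis
  proof (rule algebra_idealI)
    show "x \<oplus>\<^bsub>A\<^esub> y \<in> ?J" if "x \<in> ?J" "y \<in> ?J" for x y
      using that KD(1) unfolding iff by (auto simp: mult_add_left mult_closed subset_iff)
    show "c \<odot>\<^bsub>A\<^esub> x \<in> ?J" if "c \<in> carrier F" "x \<in> ?J" for c x
      using that KD(1) unfolding iff by (auto simp: mult_smult_left mult_closed subset_iff)
    show "\<zero>\<^bsub>A\<^esub> \<in> ?J" using KD(1) unfolding iff by auto
    show "x \<bullet> a \<in> ?J" if "a \<in> ?J" "x \<in> carrier A" for a x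
      using right[OF that] that iff mult_comm[of x a] by auto
  qed (use right in \<open>auto simp: jordan_annihilator_def\<close>)
qed

text \<open>If t kills an ideal containing it, then ty lies in that ideal, so t(ty) and tt both
  vanish: a nonzero t would be one of the elements excluded by nondegeneracy.\<close>

lemma nondegenerate_imp_ideals_faithful:
  assumes "nondegenerate A"
  shows "ideals_faithful F A"
  unfolding ideals_faithful_def
proof (intro allI impI, elim conjE)
  fix K t assume K: "algebra_ideal F A K" and t: "t \<in> K" "\<forall>k \<in> K. t \<bullet> k = \<zero>\<^bsub>A\<^esub>"
  note KD = algebra_idealD[OF K]
  have tc: "t \<in> carrier A" using KD t by auto
  have "add_pow A (2::nat) (t \<bullet> (t \<bullet> y)) \<ominus>\<^bsub>A\<^esub> ((t \<bullet> t) \<bullet> y) = \<zero>\<^bsub>A\<^esub>" if "y \<in> carrier A" for y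
    using that t KD by (simp add: M.minus_eq)
  then show "t = \<zero>\<^bsub>A\<^esub>" using assms tc unfolding nondegenerate_def by blast
qed

text \<open>Faithfulness cannot be applied to p itself, which may lie outside K. It applies to
  (py)k, an element of K that kills K by \<open>jordan_kills_twice\<close>; so (pA)K = 0, and p lies
  in the annihilator.\<close>

lemma faithful_annihilator_free:
  assumes f: "ideals_faithful F A" and K: "algebra_ideal F A K"
    and ann: "jordan_annihilator A K = {\<zero>\<^bsub>A\<^esub>}"
    and p: "p \<in> carrier A" and pK: "\<And>k. k \<in> K \<Longrightarrow> p \<bullet> k = \<zero>\<^bsub>A\<^esub>"
  shows "p = \<zero>\<^bsub>A\<^esub>"
proof -
  note KD = algebra_idealD[OF K]
  have "(p \<bullet> y) \<bullet> k = \<zero>\<^bsub>A\<^esub>" if k: "k \<in> K" and y: "y \<in> carrier A" for k y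
  proof (rule ideals_faithfulD[OF f K])
    have kc: "k \<in> carrier A" using KD k by auto
    show "(p \<bullet> y) \<bullet> k \<in> K" using KD k y p by (simp add: mult_closed)
    show "(p \<bullet> y \<bullet> k) \<bullet> z = \<zero>\<^bsub>A\<^esub>" if z: "z \<in> K" for z
    proof -
      have zc: "z \<in> carrier A" using KD z by auto
      show ?thesis
        by (rule jordan_kills_twice) (use p y kc zc z k pK KD in \<open>auto simp: mult_closed\<close>)
    qed
  qed
  then have "p \<in> jordan_annihilator A K"
    using p pK by (simp add: jordan_annihilator_iff[OF K])
  then show ?thesis using ann by simp
qed

end

section \<open>Algebras of quotients\<close>

text \<open>Serves both for isomorphic copies of an algebra and for quotients, where h sends an
  element to its coset.\<close>

lemma jordan_algebra_image:
  fixes Q :: "('f, 'q) module" and Q' :: "('f, 's) module"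
  assumes Q: "jordan_algebra F Q" and img: "h ` carrier Q = carrier Q'"
    and zero: "h \<zero>\<^bsub>Q\<^esub> = \<zero>\<^bsub>Q'\<^esub>"
    and add: "\<And>x y. \<lbrakk>x \<in> carrier Q; y \<in> carrier Q\<rbrakk> \<Longrightarrow> h x \<oplus>\<^bsub>Q'\<^esub> h y = h (x \<oplus>\<^bsub>Q\<^esub> y)"
    and mult: "\<And>x y. \<lbrakk>x \<in> carrier Q; y \<in> carrier Q\<rbrakk> \<Longrightarrow> h x \<otimes>\<^bsub>Q'\<^esub> h y = h (x \<otimes>\<^bsub>Q\<^esub> y)"
    and smult: "\<And>c x. \<lbrakk>c \<in> carrier F; x \<in> carrier Q\<rbrakk> \<Longrightarrow> c \<odot>\<^bsub>Q'\<^esub> h x = h (c \<odot>\<^bsub>Q\<^esub> x)"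
  shows "jordan_algebra F Q'"
proof -
  interpret Q: jordan_algebra F Q by fact
  \<comment> \<open>Each axiom of \<open>Q'\<close> becomes a statement about images h x, where it
    follows from the axiom of \<open>Q\<close>.\<close>
  have ex: "\<And>P. (\<forall>x \<in> carrier Q'. P x) \<longleftrightarrow> (\<forall>x \<in> carrier Q. P (h x))"
    by (simp flip: img)
  note ops = add mult smult zero[symmetric]
  have neg: "\<forall>x \<in> carrier Q'. \<exists>y \<in> carrier Q'. y \<oplus>\<^bsub>Q'\<^esub> x = \<zero>\<^bsub>Q'\<^esub>"
  proof (unfold ex, intro ballI)
    fix x assume "x \<in> carrier Q"
    then show "\<exists>y \<in> carrier Q'. y \<oplus>\<^bsub>Q'\<^esub> h x = \<zero>\<^bsub>Q'\<^esub>"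
      using img by (intro bexI[of _ "h (\<ominus>\<^bsub>Q\<^esub> x)"]) (auto simp: ops Q.M.l_neg)
  qed
  have F0:
    "\<forall>x \<in> carrier Q'. \<forall>y \<in> carrier Q'. x \<oplus>\<^bsub>Q'\<^esub> y \<in> carrier Q'"
    "\<forall>x \<in> carrier Q'. \<forall>y \<in> carrier Q'. x \<otimes>\<^bsub>Q'\<^esub> y \<in> carrier Q'"
    "\<forall>x \<in> carrier Q'. \<forall>c \<in> carrier F. c \<odot>\<^bsub>Q'\<^esub> x \<in> carrier Q'"
    "\<zero>\<^bsub>Q'\<^esub> \<in> carrier Q'"
    unfolding ex using img by (auto simp: ops Q.mult_closed)
  have F1:
    "\<forall>x \<in> carrier Q'. \<forall>y \<in> carrier Q'. \<forall>z \<in> carrier Q'. (x \<oplus>\<^bsub>Q'\<^esub> y) \<oplus>\<^bsub>Q'\<^esub> z = x \<oplus>\<^bsub>Q'\<^esub> (y \<oplus>\<^bsub>Q'\<^esub> z)"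
    "\<forall>x \<in> carrier Q'. \<forall>y \<in> carrier Q'. \<forall>z \<in> carrier Q'. (x \<oplus>\<^bsub>Q'\<^esub> y) \<otimes>\<^bsub>Q'\<^esub> z = (x \<otimes>\<^bsub>Q'\<^esub> z) \<oplus>\<^bsub>Q'\<^esub> (y \<otimes>\<^bsub>Q'\<^esub> z)"
    "\<forall>x \<in> carrier Q'. \<forall>y \<in> carrier Q'. \<forall>z \<in> carrier Q'. x \<otimes>\<^bsub>Q'\<^esub> (y \<oplus>\<^bsub>Q'\<^esub> z) = (x \<otimes>\<^bsub>Q'\<^esub> y) \<oplus>\<^bsub>Q'\<^esub> (x \<otimes>\<^bsub>Q'\<^esub> z)"
    "\<forall>x \<in> carrier Q'. \<forall>y \<in> carrier Q'. x \<oplus>\<^bsub>Q'\<^esub> y = y \<oplus>\<^bsub>Q'\<^esub> x"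
    "\<forall>x \<in> carrier Q'. \<forall>y \<in> carrier Q'. x \<otimes>\<^bsub>Q'\<^esub> y = y \<otimes>\<^bsub>Q'\<^esub> x"
    "\<forall>x \<in> carrier Q'. \<zero>\<^bsub>Q'\<^esub> \<oplus>\<^bsub>Q'\<^esub> x = x"
    unfolding ex
    by (auto simp: ops Q.mult_closed Q.M.a_ac Q.mult_add_left Q.mult_add_right Q.mult_comm)
  have F2:
    "\<forall>x \<in> carrier Q'. \<forall>y \<in> carrier Q'. ((x \<otimes>\<^bsub>Q'\<^esub> x) \<otimes>\<^bsub>Q'\<^esub> y) \<otimes>\<^bsub>Q'\<^esub> x = (x \<otimes>\<^bsub>Q'\<^esub> x) \<otimes>\<^bsub>Q'\<^esub> (y \<otimes>\<^bsub>Q'\<^esub> x)"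
    "\<forall>x \<in> carrier Q'. \<one>\<^bsub>F\<^esub> \<odot>\<^bsub>Q'\<^esub> x = x"
    "\<forall>x \<in> carrier Q'. \<forall>c \<in> carrier F. \<forall>d \<in> carrier F. (c \<oplus>\<^bsub>F\<^esub> d) \<odot>\<^bsub>Q'\<^esub> x = c \<odot>\<^bsub>Q'\<^esub> x \<oplus>\<^bsub>Q'\<^esub> d \<odot>\<^bsub>Q'\<^esub> x"
    "\<forall>x \<in> carrier Q'. \<forall>c \<in> carrier F. \<forall>d \<in> carrier F. (c \<otimes>\<^bsub>F\<^esub> d) \<odot>\<^bsub>Q'\<^esub> x = c \<odot>\<^bsub>Q'\<^esub> (d \<odot>\<^bsub>Q'\<^esub> x)"
    "\<forall>x \<in> carrier Q'. \<forall>y \<in> carrier Q'. \<forall>c \<in> carrier F. c \<odot>\<^bsub>Q'\<^esub> (x \<oplus>\<^bsub>Q'\<^esub> y) = c \<odot>\<^bsub>Q'\<^esub> x \<oplus>\<^bsub>Q'\<^esub> c \<odot>\<^bsub>Q'\<^esub> y"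
    "\<forall>x \<in> carrier Q'. \<forall>y \<in> carrier Q'. \<forall>c \<in> carrier F. (c \<odot>\<^bsub>Q'\<^esub> x) \<otimes>\<^bsub>Q'\<^esub> y = c \<odot>\<^bsub>Q'\<^esub> (x \<otimes>\<^bsub>Q'\<^esub> y)"
    "\<forall>x \<in> carrier Q'. \<forall>y \<in> carrier Q'. \<forall>c \<in> carrier F. x \<otimes>\<^bsub>Q'\<^esub> (c \<odot>\<^bsub>Q'\<^esub> y) = c \<odot>\<^bsub>Q'\<^esub> (x \<otimes>\<^bsub>Q'\<^esub> y)"
    unfolding ex
    by (auto simp: ops Q.mult_closed Q.jordan_identity Q.smult_l_distr Q.smult_r_distr
        Q.smult_assoc1 Q.mult_smult_left Q.mult_smult_right)
  show ?thesis
    by (intro jordan_algebra.intro nonassoc_algebra.intro moduleI abelian_groupI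
        jordan_algebra_axioms.intro nonassoc_algebra_axioms.intro Q.six_unit Q.is_cring;
        (rule neg[rule_format] F0[rule_format] F1[rule_format] F2[rule_format]; assumption))
qed

text \<open>The transport in the other direction: axioms are equations, so they may be checked after
  an injective map into \<open>Q\<close>. With the inclusion as h this makes O(P(R)) a Jordan
  algebra.\<close>

lemma jordan_algebra_inj:
  fixes Q :: "('f, 'q) module" and A :: "('f, 's) module"
  assumes Q: "jordan_algebra F Q" and h: "h \<in> carrier A \<rightarrow> carrier Q" and inj: "inj_on h (carrier A)"
    and zero: "\<zero>\<^bsub>A\<^esub> \<in> carrier A" "h \<zero>\<^bsub>A\<^esub> = \<zero>\<^bsub>Q\<^esub>"
    and add: "\<And>x y. \<lbrakk>x \<in> carrier A; y \<in> carrier A\<rbrakk> \<Longrightarrow> x \<oplus>\<^bsub>A\<^esub> y \<in> carrier A \<and> h (x \<oplus>\<^bsub>A\<^esub> y) = h x \<oplus>\<^bsub>Q\<^esub> h y"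
    and mult: "\<And>x y. \<lbrakk>x \<in> carrier A; y \<in> carrier A\<rbrakk> \<Longrightarrow> x \<otimes>\<^bsub>A\<^esub> y \<in> carrier A \<and> h (x \<otimes>\<^bsub>A\<^esub> y) = h x \<otimes>\<^bsub>Q\<^esub> h y"
    and smult: "\<And>c x. \<lbrakk>c \<in> carrier F; x \<in> carrier A\<rbrakk> \<Longrightarrow> c \<odot>\<^bsub>A\<^esub> x \<in> carrier A \<and> h (c \<odot>\<^bsub>A\<^esub> x) = c \<odot>\<^bsub>Q\<^esub> h x"
  shows "jordan_algebra F A"
proof -
  interpret Q: jordan_algebra F Q by fact
  note closed = add[THEN conjunct1] mult[THEN conjunct1] smult[THEN conjunct1]
  note hom = add[THEN conjunct2] mult[THEN conjunct2] smult[THEN conjunct2] zero(2)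
  have hc: "x \<in> carrier A \<Longrightarrow> h x \<in> carrier Q" for x using h by auto
  have eqI: "x = y" if "h x = h y" "x \<in> carrier A" "y \<in> carrier A" for x y
    using inj that by (auto dest: inj_onD)
  have neg: "\<exists>y \<in> carrier A. y \<oplus>\<^bsub>A\<^esub> x = \<zero>\<^bsub>A\<^esub>" if x: "x \<in> carrier A" for x
  proof (rule bexI[of _ "(\<ominus>\<^bsub>F\<^esub> \<one>\<^bsub>F\<^esub>) \<odot>\<^bsub>A\<^esub> x"])
    show "((\<ominus>\<^bsub>F\<^esub> \<one>\<^bsub>F\<^esub>) \<odot>\<^bsub>A\<^esub> x) \<oplus>\<^bsub>A\<^esub> x = \<zero>\<^bsub>A\<^esub>"
      by (rule eqI) (use x zero in \<open>auto simp: closed hom hc Q.smult_l_minus Q.M.l_neg\<close>)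
  qed (use x closed in auto)
  show ?thesis
    by (intro jordan_algebra.intro nonassoc_algebra.intro moduleI abelian_groupI
        jordan_algebra_axioms.intro nonassoc_algebra_axioms.intro Q.six_unit Q.is_cring; (intro neg eqI)?)
      ((simp_all add: closed hom hc zero Q.mult_closed Q.M.a_ac Q.mult_add_left Q.mult_add_right
        Q.jordan_identity Q.smult_l_distr Q.smult_r_distr
        Q.smult_assoc1 Q.mult_smult_left Q.mult_smult_right)?, simp_all add: Q.mult_comm hc)
qed

lemma algebra_embedding_zero:
  assumes "algebra_embedding F A Q f" "abelian_group A" "abelian_group Q"
  shows "f \<zero>\<^bsub>A\<^esub> = \<zero>\<^bsub>Q\<^esub>"
proof -
  interpret A: abelian_group A by fact
  interpret Q: abelian_group Q by fact
  have "f \<zero>\<^bsub>A\<^esub> \<in> carrier Q" "f (\<zero>\<^bsub>A\<^esub> \<oplus>\<^bsub>A\<^esub> \<zero>\<^bsub>A\<^esub>) = f \<zero>\<^bsub>A\<^esub> \<oplus>\<^bsub>Q\<^esub> f \<zero>\<^bsub>A\<^esub>"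
    using assms(1) by (auto simp: algebra_embedding_def simp del: A.l_zero A.r_zero)
  then show ?thesis by (metis A.l_zero A.zero_closed Q.add.r_cancel_one')
qed

lemma algebra_embedding_comp:
  "\<lbrakk>algebra_embedding F A B f; algebra_embedding F B D g\<rbrakk> \<Longrightarrow> algebra_embedding F A D (\<lambda>x. g (f x))"
  unfolding algebra_embedding_def inj_on_def Pi_def by auto

lemma M_quotientsI:
  assumes "jordan_algebra F A" "jordan_algebra F Q" "algebra_embedding F A Q e"
    and "\<And>q. \<lbrakk>q \<in> carrier Q; q \<noteq> \<zero>\<^bsub>Q\<^esub>\<rbrakk> \<Longrightarrow>
      \<exists>K. algebra_ideal F A K \<and> jordan_annihilator A K = {\<zero>\<^bsub>A\<^esub>} \<and>
        (\<exists>a \<in> K. e a \<otimes>\<^bsub>Q\<^esub> q \<noteq> \<zero>\<^bsub>Q\<^esub>) \<and> (\<forall>a \<in> K. e a \<otimes>\<^bsub>Q\<^esub> q \<in> e ` carrier A)"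
  shows "M_quotients F A Q e"
  unfolding M_quotients_def using assms(1-3)
proof (intro conjI ballI impI)
  fix q assume "q \<in> carrier Q" "q \<noteq> \<zero>\<^bsub>Q\<^esub>"
  from assms(4)[OF this] obtain K where "algebra_ideal F A K" "jordan_annihilator A K = {\<zero>\<^bsub>A\<^esub>}"
    "\<exists>a \<in> K. e a \<otimes>\<^bsub>Q\<^esub> q \<noteq> \<zero>\<^bsub>Q\<^esub>" "\<forall>a \<in> K. e a \<otimes>\<^bsub>Q\<^esub> q \<in> e ` carrier A" by blast
  then show "\<exists>K. algebra_ideal F A K \<and> jordan_annihilator A K = {\<zero>\<^bsub>A\<^esub>} \<and>
      {e a \<otimes>\<^bsub>Q\<^esub> q | a. a \<in> K} \<noteq> {\<zero>\<^bsub>Q\<^esub>} \<and> {e a \<otimes>\<^bsub>Q\<^esub> q | a. a \<in> K} \<subseteq> e ` carrier A"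
    by (intro exI[of _ K]) blast
qed

locale M_quotient_algebra = A: jordan_algebra F A + Q: jordan_algebra F Q
  for F :: "'f ring" and A :: "('f, 'a) module" and Q :: "('f, 'q) module" (structure) +
  fixes e :: "'a \<Rightarrow> 'q"
  assumes M_quot: "M_quotients F A Q e"

lemma M_quotient_algebraI: "M_quotients F A Q e \<Longrightarrow> M_quotient_algebra F A Q e"
  by (simp add: M_quotient_algebra_def M_quotient_algebra_axioms_def M_quotients_def)

context M_quotient_algebra
begin

lemma embedding: "algebra_embedding F A Q e"
  using M_quot by (simp add: M_quotients_def)

lemma e_closed [simp, intro]: "x \<in> carrier A \<Longrightarrow> e x \<in> carrier Q"
  using embedding by (auto simp: algebra_embedding_def)

lemma e_add: "\<lbrakk>x \<in> carrier A; y \<in> carrier A\<rbrakk> \<Longrightarrow> e (x \<oplus>\<^bsub>A\<^esub> y) = e x \<oplus> e y"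
  and e_mult: "\<lbrakk>x \<in> carrier A; y \<in> carrier A\<rbrakk> \<Longrightarrow> e (x \<otimes>\<^bsub>A\<^esub> y) = e x \<otimes> e y"
  and e_smult: "\<lbrakk>c \<in> carrier F; x \<in> carrier A\<rbrakk> \<Longrightarrow> e (c \<odot>\<^bsub>A\<^esub> x) = c \<odot> e x"
  and e_inj: "inj_on e (carrier A)"
  using embedding by (auto simp: algebra_embedding_def)

lemma e_zero [simp]: "e \<zero>\<^bsub>A\<^esub> = \<zero>"
  by (rule algebra_embedding_zero[OF embedding]) unfold_locales

lemma e_eq_iff: "\<lbrakk>x \<in> carrier A; y \<in> carrier A\<rbrakk> \<Longrightarrow> e x = e y \<longleftrightarrow> x = y"
  using e_inj by (auto dest: inj_onD)

lemma e_eq_zero_iff: "x \<in> carrier A \<Longrightarrow> e x = \<zero> \<longleftrightarrow> x = \<zero>\<^bsub>A\<^esub>"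
  using e_eq_iff[of x "\<zero>\<^bsub>A\<^esub>"] by simp

lemma denominators:
  assumes "q \<in> carrier Q" "q \<noteq> \<zero>"
  obtains K a where "algebra_ideal F A K" "jordan_annihilator A K = {\<zero>\<^bsub>A\<^esub>}"
    "a \<in> K" "e a \<otimes> q \<noteq> \<zero>" "\<And>a. a \<in> K \<Longrightarrow> \<exists>p \<in> carrier A. e a \<otimes> q = e p"
proof -
  obtain K where K: "algebra_ideal F A K" "jordan_annihilator A K = {\<zero>\<^bsub>A\<^esub>}"
    "{e a \<otimes> q | a. a \<in> K} \<noteq> {\<zero>}" "{e a \<otimes> q | a. a \<in> K} \<subseteq> e ` carrier A"
    using M_quot assms unfolding M_quotients_def by blast
  \<comment> \<open>The set of products could differ from {0} by being empty; 0 in K excludes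
    this.\<close>
  have "\<zero>\<^bsub>A\<^esub> \<in> K" by (rule A.algebra_idealD[OF K(1)])
  have "\<exists>a \<in> K. e a \<otimes> q \<noteq> \<zero>"
  proof (rule ccontr)
    assume "\<not> ?thesis"
    then have "{e a \<otimes> q | a. a \<in> K} = {\<zero>}" using \<open>\<zero>\<^bsub>A\<^esub> \<in> K\<close> by force
    then show False using K(3) by contradiction
  qed
  then obtain a where "a \<in> K" "e a \<otimes> q \<noteq> \<zero>" by blast
  then show thesis using that[of K a] K by blast
qed

text \<open>A nonzero q would give a nonzero p = aq in A. For k and z in K one has ((qa)k)z = 0 by
  \<open>jordan_kills_twice\<close> in Q, so pk, which lies in K, vanishes by faithfulness. Then p =
  0 by \<open>faithful_annihilator_free\<close>.\<close>

lemma quotient_annihilator_free: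
  assumes f: "ideals_faithful F A" and K: "algebra_ideal F A K"
    and ann: "jordan_annihilator A K = {\<zero>\<^bsub>A\<^esub>}"
    and q: "q \<in> carrier Q" and qK: "\<And>k. k \<in> K \<Longrightarrow> e k \<otimes> q = \<zero>"
  shows "q = \<zero>"
proof (rule ccontr)
  assume "q \<noteq> \<zero>"
  with q obtain L a where L: "algebra_ideal F A L" and a: "a \<in> L" "e a \<otimes> q \<noteq> \<zero>"
    and La: "\<And>a. a \<in> L \<Longrightarrow> \<exists>p \<in> carrier A. e a \<otimes> q = e p" by (rule denominators) blast
  note KD = A.algebra_idealD[OF K]
  have ac: "a \<in> carrier A" using A.algebra_idealD(1)[OF L] a by auto
  obtain p where p: "p \<in> carrier A" "e a \<otimes> q = e p" using La a by blast
  have qp: "q \<otimes> e a = e p" using p q ac by (simp add: Q.mult_comm)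
  have qK': "q \<otimes> e k = \<zero>" if "k \<in> K" for k
    using qK[OF that] that KD(1) q by (auto simp: Q.mult_comm)
  have "p \<otimes>\<^bsub>A\<^esub> k = \<zero>\<^bsub>A\<^esub>" if k: "k \<in> K" for k
  proof (rule ideals_faithfulD[OF f K])
    have kc: "k \<in> carrier A" using KD k by auto
    show "p \<otimes>\<^bsub>A\<^esub> k \<in> K" using KD k p by simp
    fix z assume z: "z \<in> K"
    then have zc: "z \<in> carrier A" using KD by auto
    have "e ((p \<otimes>\<^bsub>A\<^esub> k) \<otimes>\<^bsub>A\<^esub> z) = ((q \<otimes> e a) \<otimes> e k) \<otimes> e z"
      using p kc zc by (simp add: e_mult qp A.mult_closed)
    also have "\<dots> = \<zero>"
    proof (rule Q.jordan_kills_twice)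
      have "e k \<otimes> e z \<otimes> e a = e (k \<otimes>\<^bsub>A\<^esub> z \<otimes>\<^bsub>A\<^esub> a)" "e a \<otimes> e z \<otimes> e k = e (a \<otimes>\<^bsub>A\<^esub> z \<otimes>\<^bsub>A\<^esub> k)"
        using ac kc zc by (simp_all add: e_mult A.mult_closed)
      then show "q \<otimes> (e k \<otimes> e z \<otimes> e a) = \<zero>" "q \<otimes> (e a \<otimes> e z \<otimes> e k) = \<zero>"
        using qK' KD(6,7) ac kc z by (simp_all add: A.mult_closed)
    qed (use q ac kc zc k z qK' in auto)
    finally show "(p \<otimes>\<^bsub>A\<^esub> k) \<otimes>\<^bsub>A\<^esub> z = \<zero>\<^bsub>A\<^esub>"
      using p kc zc by (simp add: e_eq_zero_iff A.mult_closed)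
  qed
  then have "p = \<zero>\<^bsub>A\<^esub>" by (rule A.faithful_annihilator_free[OF f K ann p(1)])
  then show False using a p by simp
qed

lemma quotient_eqI:
  assumes f: "ideals_faithful F A" and K: "algebra_ideal F A K"
    and ann: "jordan_annihilator A K = {\<zero>\<^bsub>A\<^esub>}"
    and q: "q \<in> carrier Q" "q' \<in> carrier Q"
    and qK: "\<And>k. k \<in> K \<Longrightarrow> e k \<otimes> q = e k \<otimes> q'"
  shows "q = q'"
proof -
  have "q \<ominus> q' = \<zero>"
  proof (rule quotient_annihilator_free[OF f K ann])
    fix k assume "k \<in> K"
    then show "e k \<otimes> (q \<ominus> q') = \<zero>"
      using q qK A.algebra_idealD(1)[OF K]
      by (simp add: Q.mult_diff_right Q.M.eq_iff_minus_zero Q.mult_closed subset_iff)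
  qed (use q in simp)
  then show ?thesis using q by (simp add: Q.M.eq_iff_minus_zero)
qed

text \<open>Used to place Q on the type over which the competitors of a maximal algebra
  range.\<close>

lemma M_quotients_iso:
  fixes Q' :: "('f, 's) module"
  assumes G: "algebra_embedding F Q Q' G" and onto: "G ` carrier Q = carrier Q'"
    and zero: "G \<zero> = \<zero>\<^bsub>Q'\<^esub>"
  shows "M_quotients F A Q' (\<lambda>x. G (e x))"
proof (rule M_quotientsI)
  show "jordan_algebra F Q'"
    by (rule jordan_algebra_image[OF Q.jordan_algebra_axioms onto zero])
      (use G in \<open>auto simp: algebra_embedding_def\<close>)
  show "algebra_embedding F A Q' (\<lambda>x. G (e x))"
    by (rule algebra_embedding_comp[OF embedding G])
  fix q' assume q': "q' \<in> carrier Q'" "q' \<noteq> \<zero>\<^bsub>Q'\<^esub>"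
  then obtain q where q: "q \<in> carrier Q" "q' = G q" "q \<noteq> \<zero>" using onto zero by auto
  obtain K a where K: "algebra_ideal F A K" "jordan_annihilator A K = {\<zero>\<^bsub>A\<^esub>}"
    "a \<in> K" "e a \<otimes> q \<noteq> \<zero>" "\<And>a. a \<in> K \<Longrightarrow> \<exists>p \<in> carrier A. e a \<otimes> q = e p"
    using q by (metis denominators)
  have mult: "G (e a) \<otimes>\<^bsub>Q'\<^esub> q' = G (e a \<otimes> q)" "e a \<otimes> q \<in> carrier Q" if "a \<in> K" for a
    using G q that A.algebra_idealD(1)[OF K(1)] by (auto simp: algebra_embedding_def Q.mult_closed)
  have "G (e a) \<otimes>\<^bsub>Q'\<^esub> q' \<noteq> \<zero>\<^bsub>Q'\<^esub>"
    using mult[OF K(3)] K(4) zero G inj_on_eq_iff[of G "carrier Q" "e a \<otimes> q" "\<zero>"]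
    by (auto simp: algebra_embedding_def)
  moreover have "\<forall>a \<in> K. G (e a) \<otimes>\<^bsub>Q'\<^esub> q' \<in> (\<lambda>x. G (e x)) ` carrier A"
    using K(5) mult(1) by force
  ultimately show "\<exists>K. algebra_ideal F A K \<and> jordan_annihilator A K = {\<zero>\<^bsub>A\<^esub>} \<and>
        (\<exists>a \<in> K. G (e a) \<otimes>\<^bsub>Q'\<^esub> q' \<noteq> \<zero>\<^bsub>Q'\<^esub>) \<and> (\<forall>a \<in> K. G (e a) \<otimes>\<^bsub>Q'\<^esub> q' \<in> (\<lambda>x. G (e x)) ` carrier A)"
    using K by blast
qed (rule A.jordan_algebra_axioms)

text \<open>An element of \<open>Q\<close> is determined by the graph of its multiplication on \<open>A\<close>, so \<open>Q\<close> can be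
  moved to the type over which the competing algebras of a maximal one range.\<close>

lemma embeds_in_maximal:
  fixes Qm :: "('f, 'm) module"
  assumes f: "ideals_faithful F A" and max: "maximal_M_quotients F A Qm em"
  shows "\<exists>f. algebra_embedding F Q Qm f \<and> (\<forall>x \<in> carrier A. f (e x) = em x)"
proof -
  define G where "G q = {(a, b). a \<in> carrier A \<and> b \<in> carrier A \<and> e a \<otimes> q = e b}" for q
  \<comment> \<open>Denominators exist for nonzero elements only. By symmetry it is enough that one
    of two elements with the same graph is nonzero.\<close>
  have nonzero: "q = q'" if qq': "q \<in> carrier Q" "q' \<in> carrier Q" "G q = G q'" and q: "q \<noteq> \<zero>" for q q'
  proof -
    obtain K a where K: "algebra_ideal F A K" "jordan_annihilator A K = {\<zero>\<^bsub>A\<^esub>}"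
      "\<And>a. a \<in> K \<Longrightarrow> \<exists>p \<in> carrier A. e a \<otimes> q = e p"
      using qq'(1) q by (metis denominators)
    show ?thesis
    proof (rule quotient_eqI[OF f K(1,2) qq'(1,2)])
      fix k assume k: "k \<in> K"
      then have kc: "k \<in> carrier A" using A.algebra_idealD(1)[OF K(1)] by auto
      obtain p where p: "p \<in> carrier A" "e k \<otimes> q = e p" using K(3) k by blast
      then have "(k, p) \<in> G q" using kc by (simp add: G_def)
      then have "e k \<otimes> q' = e p" unfolding qq'(3) by (simp add: G_def)
      then show "e k \<otimes> q = e k \<otimes> q'" using p by simp
    qed
  qed
  have inj: "inj_on G (carrier Q)"
    by (rule inj_onI) (metis nonzero)
  define g where "g = the_inv_into (carrier Q) G"
  have g: "g (G q) = q" if "q \<in> carrier Q" for q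
    using inj that by (simp add: g_def the_inv_into_f_f)
  define Q' :: "('f, ('a \<times> 'a) set) module" where
    "Q' = \<lparr>carrier = G ` carrier Q, mult = (\<lambda>X Y. G (g X \<otimes> g Y)), one = undefined,
       zero = G \<zero>, add = (\<lambda>X Y. G (g X \<oplus> g Y)), smult = (\<lambda>c X. G (c \<odot> g X))\<rparr>"
  have emb: "algebra_embedding F Q Q' G"
    unfolding algebra_embedding_def using inj by (auto simp: Q'_def g)
  have "M_quotients F A Q' (\<lambda>x. G (e x))"
    by (rule M_quotients_iso[OF emb]) (simp_all add: Q'_def)
  then obtain h where h: "algebra_embedding F Q' Qm h" "\<forall>x \<in> carrier A. h (G (e x)) = em x"
    using max unfolding maximal_M_quotients_def by blast
  then show ?thesis
    using algebra_embedding_comp[OF emb h(1)] by blast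
qed

text \<open>Both maps agree after multiplication by an ideal of denominators.\<close>

lemma embedding_over_base_id:
  assumes f: "ideals_faithful F A" and h: "algebra_embedding F Q Q h"
    and he: "\<And>x. x \<in> carrier A \<Longrightarrow> h (e x) = e x" and q: "q \<in> carrier Q"
  shows "h q = q"
proof (cases "q = \<zero>")
  case True
  have "h \<zero> = \<zero>" by (rule algebra_embedding_zero[OF h]) unfold_locales
  then show ?thesis using True by simp
next
  case False
  then obtain K a where K: "algebra_ideal F A K" "jordan_annihilator A K = {\<zero>\<^bsub>A\<^esub>}"
    "\<And>a. a \<in> K \<Longrightarrow> \<exists>p \<in> carrier A. e a \<otimes> q = e p"
    using q by (metis denominators)
  have hc: "h q \<in> carrier Q" using h q by (auto simp: algebra_embedding_def)
  show ?thesis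
  proof (rule quotient_eqI[OF f K(1,2) hc q])
    fix k assume k: "k \<in> K"
    then have kc: "k \<in> carrier A" using A.algebra_idealD(1)[OF K(1)] by auto
    obtain p where p: "p \<in> carrier A" "e k \<otimes> q = e p" using K(3) k by blast
    have "h (e k \<otimes> q) = h (e k) \<otimes> h q" using h q kc by (auto simp: algebra_embedding_def)
    then show "e k \<otimes> h q = e k \<otimes> q" using p kc by (simp add: he)
  qed
qed

end

section \<open>The multiplication ring and injective hulls of algebras\<close>

text \<open>The default rule would also unfold multiplication operators that occur as arguments.\<close>

declare restrict_apply [simp del] restrict_apply' [simp]

context nonassoc_algebra
begin

lemma mult_algebra_closed:
  assumes "f \<in> mult_algebra F A"
  shows "f \<in> extensional (carrier A) \<and> f \<in> carrier A \<rightarrow> carrier A"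
  using assms by induction (auto simp: mult_closed Pi_iff)

lemma in_mult_ring_iff:
  "s \<in> carrier (mult_ring F A) \<longleftrightarrow>
    (\<exists>c f. s = (\<lambda>y \<in> carrier A. (c \<odot>\<^bsub>A\<^esub> y) \<oplus>\<^bsub>A\<^esub> f y) \<and> c \<in> carrier F \<and> f \<in> mult_algebra F A)"
  by (auto simp: mult_ring_def)

lemma mult_ring_closed:
  assumes "s \<in> carrier (mult_ring F A)"
  shows "s \<in> extensional (carrier A)" "x \<in> carrier A \<Longrightarrow> s x \<in> carrier A"
  using assms mult_algebra_closed by (fastforce simp: in_mult_ring_iff Pi_def)+

lemma mult_algebra_in_mult_ring:
  assumes "f \<in> mult_algebra F A"
  shows "f \<in> carrier (mult_ring F A)"
proof -
  have "f = (\<lambda>y \<in> carrier A. (\<zero>\<^bsub>F\<^esub> \<odot>\<^bsub>A\<^esub> y) \<oplus>\<^bsub>A\<^esub> f y)"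
    using mult_algebra_closed[OF assms] by (intro ext) (auto simp: extensional_def Pi_def restrict_apply)
  then show ?thesis using assms by (auto simp: in_mult_ring_iff)
qed

lemma left_mult_in_mult_ring: "x \<in> carrier A \<Longrightarrow> left_mult A x \<in> carrier (mult_ring F A)"
  and right_mult_in_mult_ring: "x \<in> carrier A \<Longrightarrow> right_mult A x \<in> carrier (mult_ring F A)"
  by (intro mult_algebra_in_mult_ring mult_algebra.intros; assumption)+

lemma scalar_op_in_mult_ring:
  assumes "c \<in> carrier F"
  shows "scalar_op A c \<in> carrier (mult_ring F A)"
proof -
  have "scalar_op A c = (\<lambda>y \<in> carrier A. (c \<odot>\<^bsub>A\<^esub> y) \<oplus>\<^bsub>A\<^esub> left_mult A \<zero>\<^bsub>A\<^esub> y)"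
    using assms by (intro restrict_ext) simp
  then show ?thesis
    using assms mult_algebra.left[of "\<zero>\<^bsub>A\<^esub>" A F] by (subst in_mult_ring_iff) blast
qed

lemma mult_ring_simps:
  "f \<otimes>\<^bsub>mult_ring F A\<^esub> g = (\<lambda>y \<in> carrier A. g (f y))"
  "f \<oplus>\<^bsub>mult_ring F A\<^esub> g = (\<lambda>y \<in> carrier A. f y \<oplus>\<^bsub>A\<^esub> g y)"
  "\<one>\<^bsub>mult_ring F A\<^esub> = (\<lambda>y \<in> carrier A. y)"
  "\<zero>\<^bsub>mult_ring F A\<^esub> = (\<lambda>y \<in> carrier A. \<zero>\<^bsub>A\<^esub>)"
  by (simp_all add: mult_ring_def)

text \<open>The left, right and scalar operators generate M(A)' under sum and product, since the
  scalar multiples in \<open>mult_algebra\<close> are products with a scalar operator. Statements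
  about the action on a module thus reduce to these generators.\<close>

lemma mult_ring_induct [consumes 1, case_names left right scalar add mult]:
  assumes s: "s \<in> carrier (mult_ring F A)"
    and left: "\<And>x. x \<in> carrier A \<Longrightarrow> P (left_mult A x)"
    and right: "\<And>x. x \<in> carrier A \<Longrightarrow> P (right_mult A x)"
    and scalar: "\<And>c. c \<in> carrier F \<Longrightarrow> P (scalar_op A c)"
    and add: "\<And>s t. \<lbrakk>s \<in> carrier (mult_ring F A); t \<in> carrier (mult_ring F A); P s; P t\<rbrakk>
      \<Longrightarrow> P (s \<oplus>\<^bsub>mult_ring F A\<^esub> t)"
    and mult: "\<And>s t. \<lbrakk>s \<in> carrier (mult_ring F A); t \<in> carrier (mult_ring F A); P s; P t\<rbrakk>
      \<Longrightarrow> P (s \<otimes>\<^bsub>mult_ring F A\<^esub> t)"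
  shows "P s"
proof -
  have Pf: "P f" if "f \<in> mult_algebra F A" for f
    using that
  proof induction
    case (left x) then show ?case by (rule assms(2))
  next
    case (right x) then show ?case by (rule assms(3))
  next
    case (add f g)
    then show ?case using assms(5)[of f g] mult_algebra_in_mult_ring by (simp add: mult_ring_simps)
  next
    case (smult c f)
    have "f \<otimes>\<^bsub>mult_ring F A\<^esub> scalar_op A c = (\<lambda>y \<in> carrier A. c \<odot>\<^bsub>A\<^esub> f y)"
      using mult_algebra_closed[OF smult(2)] by (auto simp: mult_ring_simps Pi_def intro: restrict_ext)
    then show ?case
      using assms(6)[of f "scalar_op A c"] smult scalar mult_algebra_in_mult_ring scalar_op_in_mult_ring by simp
  next
    case (comp f g)
    then show ?case using assms(6)[of f g] mult_algebra_in_mult_ring by (simp add: mult_ring_simps)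
  qed
  obtain c f where cf: "s = (\<lambda>y \<in> carrier A. (c \<odot>\<^bsub>A\<^esub> y) \<oplus>\<^bsub>A\<^esub> f y)" "c \<in> carrier F" "f \<in> mult_algebra F A"
    using s by (auto simp: in_mult_ring_iff)
  have "s = scalar_op A c \<oplus>\<^bsub>mult_ring F A\<^esub> f"
    unfolding cf(1) by (auto simp: mult_ring_simps intro: restrict_ext)
  then show ?thesis
    using add[of "scalar_op A c" f] cf Pf scalar mult_algebra_in_mult_ring scalar_op_in_mult_ring by simp
qed

end

section \<open>Right modules and their homomorphisms\<close>

lemma rmod_homD:
  assumes "f \<in> rmod_hom S M N"
  shows "x \<in> carrier M \<Longrightarrow> f x \<in> carrier N"
    and "\<lbrakk>x \<in> carrier M; y \<in> carrier M\<rbrakk> \<Longrightarrow> f (x \<oplus>\<^bsub>M\<^esub> y) = f x \<oplus>\<^bsub>N\<^esub> f y"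
    and "\<lbrakk>s \<in> carrier S; x \<in> carrier M\<rbrakk> \<Longrightarrow> f (s \<odot>\<^bsub>M\<^esub> x) = s \<odot>\<^bsub>N\<^esub> f x"
  using assms by (auto simp: rmod_hom_def)

lemma rmod_homI:
  assumes "\<And>x. x \<in> carrier M \<Longrightarrow> f x \<in> carrier N"
    and "\<And>x y. \<lbrakk>x \<in> carrier M; y \<in> carrier M\<rbrakk> \<Longrightarrow> f (x \<oplus>\<^bsub>M\<^esub> y) = f x \<oplus>\<^bsub>N\<^esub> f y"
    and "\<And>s x. \<lbrakk>s \<in> carrier S; x \<in> carrier M\<rbrakk> \<Longrightarrow> f (s \<odot>\<^bsub>M\<^esub> x) = s \<odot>\<^bsub>N\<^esub> f x"
  shows "f \<in> rmod_hom S M N"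
  using assms by (auto simp: rmod_hom_def)

locale right_mod = S: ring S + M: abelian_group M
  for S :: "'s ring" and M :: "('s, 'm) module" (structure) +
  assumes right_mod: "right_module S M"

lemma right_modI: "right_module S M \<Longrightarrow> right_mod S M"
  by (simp add: right_mod_def right_mod_axioms_def right_module_def)

context right_mod
begin

lemma act_closed [simp, intro]: "\<lbrakk>s \<in> carrier S; x \<in> carrier M\<rbrakk> \<Longrightarrow> s \<odot> x \<in> carrier M"
  and act_add_ring: "\<lbrakk>s \<in> carrier S; t \<in> carrier S; x \<in> carrier M\<rbrakk>
      \<Longrightarrow> (s \<oplus>\<^bsub>S\<^esub> t) \<odot> x = (s \<odot> x) \<oplus> (t \<odot> x)"
  and act_add: "\<lbrakk>s \<in> carrier S; x \<in> carrier M; y \<in> carrier M\<rbrakk>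
      \<Longrightarrow> s \<odot> (x \<oplus> y) = (s \<odot> x) \<oplus> (s \<odot> y)"
  and act_mult: "\<lbrakk>s \<in> carrier S; t \<in> carrier S; x \<in> carrier M\<rbrakk>
      \<Longrightarrow> (s \<otimes>\<^bsub>S\<^esub> t) \<odot> x = t \<odot> (s \<odot> x)"
  and act_one [simp]: "x \<in> carrier M \<Longrightarrow> \<one>\<^bsub>S\<^esub> \<odot> x = x"
  using right_mod by (auto simp: right_module_def)

lemma act_zero [simp]: "s \<in> carrier S \<Longrightarrow> s \<odot> \<zero> = \<zero>"
  by (metis M.add.r_cancel_one' M.l_zero M.zero_closed act_add act_closed)

lemma act_zero_ring [simp]: "x \<in> carrier M \<Longrightarrow> \<zero>\<^bsub>S\<^esub> \<odot> x = \<zero>"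
  by (metis M.add.r_cancel_one' S.l_zero S.zero_closed act_add_ring act_closed)

lemma act_minus: "\<lbrakk>s \<in> carrier S; x \<in> carrier M\<rbrakk> \<Longrightarrow> s \<odot> (\<ominus> x) = \<ominus> (s \<odot> x)"
  using act_add[of s "\<ominus> x" x] by (simp add: M.l_neg M.minus_equality)

lemma right_submoduleI:
  assumes "N \<subseteq> carrier M" "\<zero> \<in> N"
    and "\<And>x y. \<lbrakk>x \<in> N; y \<in> N\<rbrakk> \<Longrightarrow> x \<oplus> y \<in> N"
    and sm: "\<And>s x. \<lbrakk>s \<in> carrier S; x \<in> N\<rbrakk> \<Longrightarrow> s \<odot> x \<in> N"
  shows "submodule N S M"
proof -
  have neg: "\<ominus> x \<in> N" if "x \<in> N" for x
  proof -
    have x: "x \<in> carrier M" using that assms by auto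
    have "(\<ominus>\<^bsub>S\<^esub> \<one>\<^bsub>S\<^esub>) \<odot> x \<oplus> x = \<zero>"
      using act_add_ring[of "\<ominus>\<^bsub>S\<^esub> \<one>\<^bsub>S\<^esub>" "\<one>\<^bsub>S\<^esub>" x] x by (simp add: S.l_neg)
    then have "\<ominus> x = (\<ominus>\<^bsub>S\<^esub> \<one>\<^bsub>S\<^esub>) \<odot> x" using x by (simp add: M.minus_equality)
    then show ?thesis using sm that by simp
  qed
  show ?thesis
    by (intro submodule.intro subgroup.intro submodule_axioms.intro)
      (use assms neg in \<open>auto simp flip: a_inv_def\<close>)
qed

lemma right_submoduleD:
  assumes "submodule N S M"
  shows "N \<subseteq> carrier M" "\<zero> \<in> N" "\<And>x y. \<lbrakk>x \<in> N; y \<in> N\<rbrakk> \<Longrightarrow> x \<oplus> y \<in> N"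
    "\<And>s x. \<lbrakk>s \<in> carrier S; x \<in> N\<rbrakk> \<Longrightarrow> s \<odot> x \<in> N"
    "\<And>x. x \<in> N \<Longrightarrow> \<ominus> x \<in> N"
proof -
  interpret submodule N S M by fact
  show "N \<subseteq> carrier M" "\<zero> \<in> N" "\<And>x y. \<lbrakk>x \<in> N; y \<in> N\<rbrakk> \<Longrightarrow> x \<oplus> y \<in> N"
    "\<And>s x. \<lbrakk>s \<in> carrier S; x \<in> N\<rbrakk> \<Longrightarrow> s \<odot> x \<in> N"
    using subset one_closed m_closed by auto
  show "\<And>x. x \<in> N \<Longrightarrow> \<ominus> x \<in> N" using m_inv_closed by (simp add: a_inv_def)
qed

lemma rmod_hom_zero: "\<lbrakk>f \<in> rmod_hom S M' M; \<zero>\<^bsub>M'\<^esub> \<in> carrier M'; \<zero>\<^bsub>M'\<^esub> \<oplus>\<^bsub>M'\<^esub> \<zero>\<^bsub>M'\<^esub> = \<zero>\<^bsub>M'\<^esub>\<rbrakk> \<Longrightarrow> f \<zero>\<^bsub>M'\<^esub> = \<zero>"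
  by (metis M.add.r_cancel_one' rmod_homD(1,2))

end

text \<open>Instantiated twice: by R with I(R) over F, and by P(R) with I(P(R)) over CM(R).\<close>

locale mult_hull = nonassoc_algebra F A + M: right_mod "mult_ring F A" M
  for F :: "'f ring" and A :: "('f, 'a) module" and M :: "('a \<Rightarrow> 'a, 'm) module" (structure) +
  fixes e :: "'a \<Rightarrow> 'm"
  assumes hull: "injective_hull (mult_ring F A) (mult_module A) M e"

lemma mult_hullI:
  "\<lbrakk>nonassoc_algebra F A; injective_hull (mult_ring F A) (mult_module A) M e\<rbrakk> \<Longrightarrow> mult_hull F A M e"
  by (simp add: mult_hull_def mult_hull_axioms_def injective_hull_def injective_rmod_def right_modI)

context mult_hull
begin

abbreviation S where "S \<equiv> mult_ring F A"

lemma e_hom: "e \<in> rmod_hom S (mult_module A) M"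
  using hull by (simp add: injective_hull_def)

lemma e_closed [simp, intro]: "x \<in> carrier A \<Longrightarrow> e x \<in> carrier M"
  and e_add: "\<lbrakk>x \<in> carrier A; y \<in> carrier A\<rbrakk> \<Longrightarrow> e (x \<oplus>\<^bsub>A\<^esub> y) = e x \<oplus> e y"
  and e_act: "\<lbrakk>s \<in> carrier S; x \<in> carrier A\<rbrakk> \<Longrightarrow> s \<odot> e x = e (s x)"
  using e_hom by (auto simp: rmod_hom_def mult_module_def)

lemma e_inj: "inj_on e (carrier A)"
  using hull by (simp add: injective_hull_def mult_module_def)

lemma e_eq_iff: "\<lbrakk>x \<in> carrier A; y \<in> carrier A\<rbrakk> \<Longrightarrow> e x = e y \<longleftrightarrow> x = y"
  using e_inj by (auto dest: inj_onD)

lemma e_zero [simp]: "e \<zero>\<^bsub>A\<^esub> = \<zero>"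
  using M.rmod_hom_zero[OF e_hom] by (simp add: mult_module_def)

lemma e_eq_zero_iff: "x \<in> carrier A \<Longrightarrow> e x = \<zero> \<longleftrightarrow> x = \<zero>\<^bsub>A\<^esub>"
  using e_eq_iff[of x "\<zero>\<^bsub>A\<^esub>"] by simp

lemma left_act: "\<lbrakk>x \<in> carrier A; y \<in> carrier A\<rbrakk> \<Longrightarrow> left_mult A x \<odot> e y = e (x \<otimes>\<^bsub>A\<^esub> y)"
  and right_act: "\<lbrakk>x \<in> carrier A; y \<in> carrier A\<rbrakk> \<Longrightarrow> right_mult A x \<odot> e y = e (y \<otimes>\<^bsub>A\<^esub> x)"
  and scalar_act: "\<lbrakk>c \<in> carrier F; y \<in> carrier A\<rbrakk> \<Longrightarrow> scalar_op A c \<odot> e y = e (c \<odot>\<^bsub>A\<^esub> y)"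
  by (simp_all add: e_act left_mult_in_mult_ring right_mult_in_mult_ring scalar_op_in_mult_ring)

section \<open>Ideals of the algebra and submodules of its hull\<close>

lemma mult_submoduleI:
  assumes N: "N \<subseteq> carrier M" "\<zero> \<in> N" "\<And>x y. \<lbrakk>x \<in> N; y \<in> N\<rbrakk> \<Longrightarrow> x \<oplus> y \<in> N"
    and ops: "\<And>x n. \<lbrakk>x \<in> carrier A; n \<in> N\<rbrakk> \<Longrightarrow> left_mult A x \<odot> n \<in> N"
      "\<And>x n. \<lbrakk>x \<in> carrier A; n \<in> N\<rbrakk> \<Longrightarrow> right_mult A x \<odot> n \<in> N"
      "\<And>c n. \<lbrakk>c \<in> carrier F; n \<in> N\<rbrakk> \<Longrightarrow> scalar_op A c \<odot> n \<in> N"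
  shows "submodule N S M"
proof (rule M.right_submoduleI[OF N])
  fix s n assume "s \<in> carrier S" "n \<in> N"
  then have "\<forall>n \<in> N. s \<odot> n \<in> N"
  proof (induction s rule: mult_ring_induct)
    case (add s t)
    then show ?case using N by (auto simp: M.act_add_ring subset_iff)
  next
    case (mult s t)
    then show ?case using N by (auto simp: M.act_mult subset_iff)
  qed (use ops in auto)
  then show "s \<odot> n \<in> N" using \<open>n \<in> N\<close> by blast
qed

text \<open>Together with \<open>ideal_preimage\<close> this makes the ideals of A exactly the
  traces on A of the submodules of the hull.\<close>

lemma submodule_image:
  assumes "algebra_ideal F A L"
  shows "submodule (e ` L) S M"
proof -
  note LD = algebra_idealD[OF assms]
  have sub: "x \<in> L \<Longrightarrow> x \<in> carrier A" for x using LD by auto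
  show ?thesis
  proof (rule mult_submoduleI)
    show "\<zero> \<in> e ` L" using LD(2) e_zero by force
    show "x \<oplus> y \<in> e ` L" if "x \<in> e ` L" "y \<in> e ` L" for x y
    proof -
      from that obtain a b where "a \<in> L" "b \<in> L" "x = e a" "y = e b" by (elim imageE)
      then show ?thesis using LD(3)[of a b] by (simp add: sub flip: e_add)
    qed
  qed (use LD in \<open>auto simp: left_act right_act scalar_act sub\<close>)
qed

lemma ideal_preimage:
  assumes "submodule N S M"
  shows "algebra_ideal F A {x \<in> carrier A. e x \<in> N}"
proof -
  note ND = M.right_submoduleD[OF assms]
  show ?thesis
  proof (rule algebra_idealI)
    show "c \<odot>\<^bsub>A\<^esub> x \<in> {x \<in> carrier A. e x \<in> N}" if "c \<in> carrier F" "x \<in> {x \<in> carrier A. e x \<in> N}" for c x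
      using that ND(4)[of "scalar_op A c" "e x"] by (simp add: scalar_act scalar_op_in_mult_ring)
    show "a \<otimes>\<^bsub>A\<^esub> x \<in> {x \<in> carrier A. e x \<in> N}" if "a \<in> {x \<in> carrier A. e x \<in> N}" "x \<in> carrier A" for a x
      using that ND(4)[of "right_mult A x" "e a"] by (simp add: right_act right_mult_in_mult_ring mult_closed)
    show "x \<otimes>\<^bsub>A\<^esub> a \<in> {x \<in> carrier A. e x \<in> N}" if "a \<in> {x \<in> carrier A. e x \<in> N}" "x \<in> carrier A" for a x
      using that ND(4)[of "left_mult A x" "e a"] by (simp add: left_act left_mult_in_mult_ring mult_closed)
  qed (use ND in \<open>auto simp: e_add\<close>)
qed

lemma submodule_zeroI:
  assumes N: "submodule N S M" and "\<And>x. \<lbrakk>x \<in> carrier A; e x \<in> N\<rbrakk> \<Longrightarrow> x = \<zero>\<^bsub>A\<^esub>"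
  shows "N = {\<zero>}"
proof (rule ccontr)
  assume "N \<noteq> {\<zero>}"
  then have "N \<inter> e ` carrier A \<noteq> {\<zero>}"
    using hull N by (auto simp: injective_hull_def mult_module_def)
  moreover have "\<zero> \<in> N \<inter> e ` carrier A"
    using M.right_submoduleD(2)[OF N] e_zero by force
  ultimately obtain x where "x \<in> carrier A" "e x \<in> N" "e x \<noteq> \<zero>" by blast
  then show False using assms(2)[of x] by simp
qed

text \<open>Bilinearity of the product and commutativity of F make scalar operators commute with the
  generators of M(A)', and an identity between operators passes to every module over M(A)'.\<close>

lemma scalar_act_commute:
  assumes c: "c \<in> carrier F" and "s \<in> carrier S" and u: "u \<in> carrier M"
  shows "scalar_op A c \<odot> (s \<odot> u) = s \<odot> (scalar_op A c \<odot> u)"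
proof -
  note cS = scalar_op_in_mult_ring[OF c]
  have "\<forall>u \<in> carrier M. scalar_op A c \<odot> (s \<odot> u) = s \<odot> (scalar_op A c \<odot> u)"
    using assms(2)
  proof (induction s rule: mult_ring_induct)
    case (left x)
    have "scalar_op A c \<otimes>\<^bsub>S\<^esub> left_mult A x = left_mult A x \<otimes>\<^bsub>S\<^esub> scalar_op A c"
      using c left unfolding mult_ring_simps by (intro restrict_ext) (simp add: mult_closed mult_smult_right)
    then show ?case using cS left left_mult_in_mult_ring by (simp flip: M.act_mult)
  next
    case (right x)
    have "scalar_op A c \<otimes>\<^bsub>S\<^esub> right_mult A x = right_mult A x \<otimes>\<^bsub>S\<^esub> scalar_op A c"
      using c right unfolding mult_ring_simps by (intro restrict_ext) (simp add: mult_closed mult_smult_left)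
    then show ?case using cS right right_mult_in_mult_ring by (simp flip: M.act_mult)
  next
    case (scalar d)
    have "scalar_op A c \<otimes>\<^bsub>S\<^esub> scalar_op A d = scalar_op A d \<otimes>\<^bsub>S\<^esub> scalar_op A c"
      using c scalar unfolding mult_ring_simps by (intro restrict_ext) (simp add: R.m_comm flip: smult_assoc1)
    then show ?case using cS scalar scalar_op_in_mult_ring by (simp flip: M.act_mult)
  next
    case (add s t)
    then show ?case using cS by (simp add: M.act_add_ring M.act_add)
  next
    case (mult s t)
    then show ?case using cS by (simp add: M.act_mult)
  qed
  then show ?thesis using u by blast
qed

text \<open>Injectivity is formulated with test modules on a type of pairs, so the hull is copied
  there by pairing each element with a constant before an extension is asked for.\<close>

lemma hom_extends:
  assumes K: "submodule K S M" and f: "f \<in> rmod_hom S (M\<lparr>carrier := K\<rparr>) M"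
  shows "\<exists>g \<in> rmod_hom S M M. \<forall>x \<in> K. g x = f x"
proof -
  define z :: "'a \<Rightarrow> 'a" where "z = undefined"
  define N :: "('a \<Rightarrow> 'a, ('a \<Rightarrow> 'a) \<times> 'm) module" where
    "N = \<lparr>carrier = Pair z ` carrier M, mult = undefined, one = undefined, zero = (z, \<zero>),
       add = (\<lambda>p q. (z, snd p \<oplus> snd q)), smult = (\<lambda>s p. (z, s \<odot> snd p))\<rparr>"
  have abN: "abelian_group N"
  proof (rule abelian_groupI)
    show "\<exists>y \<in> carrier N. y \<oplus>\<^bsub>N\<^esub> x = \<zero>\<^bsub>N\<^esub>" if "x \<in> carrier N" for x
      using that by (intro bexI[of _ "(z, \<ominus> snd x)"]) (auto simp: N_def M.M.l_neg)
  qed (auto simp: N_def M.M.a_ac)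
  have N: "right_module S N"
    unfolding right_module_def using abN M.S.ring_axioms
    by (auto simp: N_def M.act_add_ring M.act_add M.act_mult)
  note KD = M.right_submoduleD[OF K]
  interpret N: right_mod S N by (rule right_modI[OF N])
  have subN: "submodule (Pair z ` K) S N"
    by (rule N.right_submoduleI) (use KD in \<open>auto simp: N_def\<close>)
  have homN: "(\<lambda>p. f (snd p)) \<in> rmod_hom S (N\<lparr>carrier := Pair z ` K\<rparr>) M"
    by (rule rmod_homI) (use rmod_homD[OF f] in \<open>auto simp: N_def\<close>)
  have "injective_rmod S M" using hull by (simp add: injective_hull_def)
  note this[unfolded injective_rmod_def, THEN conjunct2, rule_format, OF conjI, OF N conjI, OF subN homN]
  then obtain g where g: "g \<in> rmod_hom S N M" "\<forall>x \<in> Pair z ` K. g x = f (snd x)"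
    by blast
  show ?thesis
  proof (intro bexI[of _ "\<lambda>x. g (z, x)"] rmod_homI ballI)
    show "g (z, x \<oplus> y) = g (z, x) \<oplus> g (z, y)" if "x \<in> carrier M" "y \<in> carrier M" for x y
      using rmod_homD(2)[OF g(1), of "(z, x)" "(z, y)"] that by (simp add: N_def)
    show "g (z, s \<odot> x) = s \<odot> g (z, x)" if "s \<in> carrier S" "x \<in> carrier M" for s x
      using rmod_homD(3)[OF g(1), of s "(z, x)"] that by (simp add: N_def)
    show "g (z, x) \<in> carrier M" if "x \<in> carrier M" for x
      using rmod_homD(1)[OF g(1), of "(z, x)"] that by (simp add: N_def)
    show "g (z, x) = f x" if "x \<in> K" for x using g(2) that by auto
  qed
qed

end

section \<open>The centroid \<open>CM(R)\<close>\<close>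

locale jordan_hull = jordan_algebra F R + mult_hull F R I e
  for F :: "'f ring" and R :: "('f, 'r) module"
    and I :: "('r \<Rightarrow> 'r, 'i) module" (structure) and e :: "'r \<Rightarrow> 'i" +
  assumes faithful: "ideals_faithful F R"
begin

abbreviation P where "P \<equiv> P_carrier F R I e"
abbreviation C where "C \<equiv> CM F R I e"
abbreviation HP where "HP \<equiv> rmod_hom S (I\<lparr>carrier := P\<rparr>) (I\<lparr>carrier := P\<rparr>)"
abbreviation lact (infixr \<open>\<triangleright>\<close> 75) where "y \<triangleright> u \<equiv> left_mult R y \<odot> u"

lemma right_mult_eq: "x \<in> carrier R \<Longrightarrow> right_mult R x = left_mult R x"
  by (intro restrict_ext) (simp add: mult_comm)

lemmas lact_closed [simp, intro] = M.act_closed[OF left_mult_in_mult_ring]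

lemma lact_e: "\<lbrakk>x \<in> carrier R; y \<in> carrier R\<rbrakk> \<Longrightarrow> x \<triangleright> e y = e (x \<otimes>\<^bsub>R\<^esub> y)"
  by (rule left_act)

lemma e_minus: "x \<in> carrier R \<Longrightarrow> e (\<ominus>\<^bsub>R\<^esub> x) = \<ominus> e x"
  using e_add[of "\<ominus>\<^bsub>R\<^esub> x" x] by (simp add: M.l_neg M.M.minus_equality)

lemma id_hom: "(\<lambda>x. x) \<in> rmod_hom S I I"
  by (simp add: rmod_hom_def)

lemma hom_in_P: "\<lbrakk>h \<in> rmod_hom S I I; x \<in> carrier R\<rbrakk> \<Longrightarrow> h (e x) \<in> P"
  unfolding P_carrier_def by (rule generate.incl) blast

lemma e_in_P [simp, intro]: "x \<in> carrier R \<Longrightarrow> e x \<in> P"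
  using hom_in_P[OF id_hom] by simp

lemma P_add [simp, intro]: "\<lbrakk>p \<in> P; q \<in> P\<rbrakk> \<Longrightarrow> p \<oplus> q \<in> P"
  unfolding P_carrier_def using generate.eng[of p "add_monoid I" _ q] by simp

text \<open>The inverse case of \<open>generate\<close> is absorbed by the generators: -h(e x) =
  h(e(-x)).\<close>

lemma P_induct_hom [consumes 1, case_names hom add]:
  assumes "p \<in> P" and hom: "\<And>h x. \<lbrakk>h \<in> rmod_hom S I I; x \<in> carrier R\<rbrakk> \<Longrightarrow> Q (h (e x))"
    and add: "\<And>p q. \<lbrakk>p \<in> P; q \<in> P; Q p; Q q\<rbrakk> \<Longrightarrow> Q (p \<oplus> q)"
  shows "Q p"
  using assms(1) unfolding P_carrier_def
proof induction
  case one
  then show ?case using hom[OF id_hom M.zero_closed] by simp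
next
  case (incl p)
  then show ?case using hom by auto
next
  case (inv p)
  then obtain h x where h: "h \<in> rmod_hom S I I" "x \<in> carrier R" "p = h (e x)" by auto
  have "h (e (\<ominus>\<^bsub>R\<^esub> x)) \<oplus> h (e x) = h \<zero>"
    using h rmod_homD(2)[OF h(1), of "e (\<ominus>\<^bsub>R\<^esub> x)" "e x"] by (simp add: e_minus M.M.l_neg)
  also have "h \<zero> = \<zero>" using M.rmod_hom_zero[OF h(1)] by simp
  finally have "\<ominus> h (e x) = h (e (\<ominus>\<^bsub>R\<^esub> x))"
    using h rmod_homD(1)[OF h(1)] by (simp add: M.M.minus_equality)
  then show ?case using hom[OF h(1), of "\<ominus>\<^bsub>R\<^esub> x"] h by (simp add: a_inv_def)
next
  case (eng p q)
  then show ?case using add[of p q] by (simp add: P_carrier_def)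
qed

lemma P_carrier_closed [simp]: "p \<in> P \<Longrightarrow> p \<in> carrier I"
  by (induction p rule: P_induct_hom) (auto simp: rmod_homD(1))

lemma P_zero [simp, intro]: "\<zero> \<in> P"
  using e_in_P[OF M.zero_closed] by simp

text \<open>Homomorphisms commute with the action, so s applied to a generator h(e x) is the
  generator h(e(s x)).\<close>

lemma P_act [simp, intro]: assumes s: "s \<in> carrier S" and "p \<in> P" shows "s \<odot> p \<in> P"
  using assms(2)
proof (induction p rule: P_induct_hom)
  case (hom h x)
  have "s \<odot> h (e x) = h (e (s x))"
    using hom s by (simp add: e_act flip: rmod_homD(3)[OF hom(1)])
  then show ?case using hom hom_in_P s mult_ring_closed(2) by simp
next
  case (add p q)
  then show ?case using s by (simp add: M.act_add)
qed

lemma P_submodule: "submodule P S I"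
  by (rule M.right_submoduleI) auto

lemma P_minus [simp, intro]: "p \<in> P \<Longrightarrow> \<ominus> p \<in> P"
  by (rule M.right_submoduleD(5)[OF P_submodule])

lemma P_lact [simp, intro]: "\<lbrakk>x \<in> carrier R; p \<in> P\<rbrakk> \<Longrightarrow> x \<triangleright> p \<in> P"
  by (simp add: left_mult_in_mult_ring)

lemma HP_iff: "f \<in> HP \<longleftrightarrow> f \<in> P \<rightarrow> P \<and> (\<forall>p \<in> P. \<forall>q \<in> P. f (p \<oplus> q) = f p \<oplus> f q) \<and>
    (\<forall>s \<in> carrier S. \<forall>p \<in> P. f (s \<odot> p) = s \<odot> f p)"
  by (simp add: rmod_hom_def)

lemma HPD:
  assumes "f \<in> HP"
  shows "p \<in> P \<Longrightarrow> f p \<in> P"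
    and "\<lbrakk>p \<in> P; q \<in> P\<rbrakk> \<Longrightarrow> f (p \<oplus> q) = f p \<oplus> f q"
    and "\<lbrakk>s \<in> carrier S; p \<in> P\<rbrakk> \<Longrightarrow> f (s \<odot> p) = s \<odot> f p"
  using assms by (auto simp: HP_iff)

lemma HP_lact: "\<lbrakk>f \<in> HP; x \<in> carrier R; p \<in> P\<rbrakk> \<Longrightarrow> f (x \<triangleright> p) = x \<triangleright> f p"
  by (rule HPD(3)[OF _ left_mult_in_mult_ring])

lemma HP_zero: assumes "f \<in> HP" shows "f \<zero> = \<zero>"
proof -
  have "f \<zero> = f \<zero> \<oplus> f \<zero>" using HPD(2)[OF assms, of "\<zero>" "\<zero>"] by simp
  then show ?thesis using HPD(1)[OF assms P_zero] by (metis M.M.add.r_cancel_one' P_carrier_closed)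
qed

text \<open>P(R) is invariant under all endomorphisms of the hull, because the composite of two of
  them is another. Restricting endomorphisms of the hull is how elements of CM(R) are produced, here
  and in \<open>support_exists\<close>.\<close>

lemma hom_in_HP: assumes h: "h \<in> rmod_hom S I I" shows "h \<in> HP"
proof -
  have "h p \<in> P" if "p \<in> P" for p
    using that
  proof (induction p rule: P_induct_hom)
    case (hom g x)
    have "(\<lambda>u. h (g u)) \<in> rmod_hom S I I"
      using h hom by (auto simp: rmod_hom_def Pi_iff)
    then show ?case using hom_in_P[of "\<lambda>u. h (g u)" x] hom by simp
  next
    case (add p q)
    then show ?case using h by (simp add: rmod_homD(2))
  qed
  then show ?thesis using h by (simp add: HP_iff rmod_homD)
qed

lemma C_carrier: "carrier C = HP \<inter> extensional P"
  by (simp add: CM_def endo_ring_def)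

lemma C_HP: "f \<in> carrier C \<Longrightarrow> f \<in> HP"
  by (simp add: C_carrier)

lemmas CD = HPD[OF C_HP]
lemmas C_lact = HP_lact[OF C_HP]
lemmas C_zero_arg [simp] = HP_zero[OF C_HP]

lemma C_closed [simp, intro]: "\<lbrakk>f \<in> carrier C; p \<in> P\<rbrakk> \<Longrightarrow> f p \<in> P"
  by (rule CD)

lemma restrict_in_C: "f \<in> HP \<Longrightarrow> restrict f P \<in> carrier C"
  by (simp add: C_carrier HP_iff Pi_iff)

lemma C_eqI: "\<lbrakk>f \<in> carrier C; g \<in> carrier C; \<And>p. p \<in> P \<Longrightarrow> f p = g p\<rbrakk> \<Longrightarrow> f = g"
  unfolding C_carrier by (rule extensionalityI[of _ P]) auto

text \<open>The description P(R) = CM(R)R: a generator h(e x) is f(e x) for f the restriction of h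
  to P.\<close>

lemma P_induct [consumes 1, case_names hom add]:
  assumes "p \<in> P" and hom: "\<And>f x. \<lbrakk>f \<in> carrier C; x \<in> carrier R\<rbrakk> \<Longrightarrow> Q (f (e x))"
    and add: "\<And>p q. \<lbrakk>p \<in> P; q \<in> P; Q p; Q q\<rbrakk> \<Longrightarrow> Q (p \<oplus> q)"
  shows "Q p"
  using assms(1)
proof (induction p rule: P_induct_hom)
  case (hom h x)
  then show ?case using assms(2)[OF restrict_in_C[OF hom_in_HP], of h x] by simp
qed (rule add)

lemma HP_image_submodule:
  assumes N: "submodule N S I" "N \<subseteq> P" and d: "d \<in> HP"
  shows "submodule (d ` N) S I"
proof (rule M.right_submoduleI)
  note ND = M.right_submoduleD[OF N(1)]
  show "\<zero> \<in> d ` N" using HP_zero[OF d] ND(2) by force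
  show "d ` N \<subseteq> carrier I" using N(2) HPD(1)[OF d] by auto
  show "x \<oplus> y \<in> d ` N" if xy: "x \<in> d ` N" "y \<in> d ` N" for x y
  proof -
    from xy obtain a b where "a \<in> N" "b \<in> N" "x = d a" "y = d b" by (elim imageE)
    moreover from this have "d (a \<oplus> b) = d a \<oplus> d b" using HPD(2)[OF d] N(2) by blast
    ultimately show ?thesis using ND(3)[of a b] by force
  qed
  show "s \<odot> x \<in> d ` N" if x: "s \<in> carrier S" "x \<in> d ` N" for s x
  proof -
    from x obtain a where "a \<in> N" "x = d a" by (elim imageE)
    moreover from this have "d (s \<odot> a) = s \<odot> d a" using HPD(3)[OF d] N(2) x by blast
    ultimately show ?thesis using ND(4)[of s a] x by force
  qed
qed

lemma HP_preimage_ideal: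
  assumes N: "submodule N S I" and d: "d \<in> HP"
  shows "algebra_ideal F R {x \<in> carrier R. d (e x) \<in> N}"
proof -
  note ND = M.right_submoduleD[OF N]
  have "submodule {p \<in> P. d p \<in> N} S I"
    by (rule M.right_submoduleI) (use ND HPD[OF d] HP_zero[OF d] in auto)
  from ideal_preimage[OF this] show ?thesis by (simp cong: conj_cong)
qed

section \<open>Essential ideals of R\<close>

definition essential_ideal where
  "essential_ideal L \<longleftrightarrow> algebra_ideal F R L \<and>
     (\<forall>N. algebra_ideal F R N \<and> N \<inter> L = {\<zero>\<^bsub>R\<^esub>} \<longrightarrow> N = {\<zero>\<^bsub>R\<^esub>})"

lemma essential_idealD:
  assumes "essential_ideal L"
  shows "algebra_ideal F R L" "\<lbrakk>algebra_ideal F R N; N \<inter> L = {\<zero>\<^bsub>R\<^esub>}\<rbrakk> \<Longrightarrow> N = {\<zero>\<^bsub>R\<^esub>}"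
  using assms by (auto simp: essential_ideal_def)

lemma essential_ideal_subset: "essential_ideal L \<Longrightarrow> L \<subseteq> carrier R"
  by (rule algebra_idealD(1)[OF essential_idealD(1)])

lemma essential_ideal_carrier: "essential_ideal (carrier R)"
proof -
  have "N \<inter> carrier R = N" if "algebra_ideal F R N" for N using algebra_idealD(1)[OF that] by auto
  then show ?thesis by (auto simp: essential_ideal_def algebra_ideal_carrier)
qed

lemma essential_ideal_inter:
  assumes K: "essential_ideal K" and L: "essential_ideal L"
  shows "essential_ideal (K \<inter> L)"
proof -
  note Ki = essential_idealD(1)[OF K] and Li = essential_idealD(1)[OF L]
  have "N = {\<zero>\<^bsub>R\<^esub>}" if N: "algebra_ideal F R N" "N \<inter> (K \<inter> L) = {\<zero>\<^bsub>R\<^esub>}" for N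
    using essential_idealD(2)[OF L algebra_ideal_inter[OF N(1) Ki]] N
    by (intro essential_idealD(2)[OF K N(1)]) (auto simp: Int_assoc)
  then show ?thesis using algebra_ideal_inter[OF Ki Li] by (simp add: essential_ideal_def)
qed

lemma essential_submodule_zeroI:
  assumes L: "essential_ideal L" and N: "submodule N S I"
    and "\<And>l. \<lbrakk>l \<in> L; e l \<in> N\<rbrakk> \<Longrightarrow> l = \<zero>\<^bsub>R\<^esub>"
  shows "N = {\<zero>}"
proof -
  have "e \<zero>\<^bsub>R\<^esub> \<in> N" using M.right_submoduleD(2)[OF N] by simp
  then have "{x \<in> carrier R. e x \<in> N} \<inter> L = {\<zero>\<^bsub>R\<^esub>}"
    using assms(3) algebra_idealD(1,2)[OF essential_idealD(1)[OF L]] by blast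
  then have "{x \<in> carrier R. e x \<in> N} = {\<zero>\<^bsub>R\<^esub>}"
    by (rule essential_idealD(2)[OF L ideal_preimage[OF N]])
  then show ?thesis by (intro submodule_zeroI[OF N]) blast
qed

text \<open>If an ideal N meets the pullback in zero, then f(e(N \<inter> L)) meets e(L) in zero and
  so is zero by essentiality of L. But then N \<inter> L itself lies in the pullback, hence is zero,
  and so is N.\<close>

lemma essential_ideal_pullback:
  assumes L: "essential_ideal L" and f: "f \<in> HP"
  shows "essential_ideal {x \<in> L. f (e x) \<in> e ` L}"
proof -
  note Li = essential_idealD(1)[OF L]
  note LD = algebra_idealD[OF Li]
  note eL = submodule_image[OF Li]
  have "L \<inter> {x \<in> carrier R. f (e x) \<in> e ` L} = {x \<in> L. f (e x) \<in> e ` L}" using LD(1) by auto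
  then have K: "algebra_ideal F R {x \<in> L. f (e x) \<in> e ` L}"
    using algebra_ideal_inter[OF Li HP_preimage_ideal[OF eL f]] by simp
  have "N = {\<zero>\<^bsub>R\<^esub>}" if N: "algebra_ideal F R N" and NK: "N \<inter> {x \<in> L. f (e x) \<in> e ` L} = {\<zero>\<^bsub>R\<^esub>}" for N
  proof (rule essential_idealD(2)[OF L N])
    note NL = algebra_ideal_inter[OF N Li]
    have "e ` (N \<inter> L) \<subseteq> P" using LD(1) by auto
    then have sub: "submodule (f ` e ` (N \<inter> L)) S I"
      by (intro HP_image_submodule submodule_image NL f)
    have "f ` e ` (N \<inter> L) = {\<zero>}"
    proof (rule essential_submodule_zeroI[OF L sub])
      fix l assume l: "l \<in> L" "e l \<in> f ` e ` (N \<inter> L)"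
      then obtain n where "n \<in> N" "n \<in> L" "e l = f (e n)" by blast
      then have "n \<in> N \<inter> {x \<in> L. f (e x) \<in> e ` L}" using l by (metis (mono_tags, lifting) IntI image_eqI mem_Collect_eq)
      then have "n = \<zero>\<^bsub>R\<^esub>" using NK by blast
      then have "e l = \<zero>" by (simp add: \<open>e l = f (e n)\<close> HP_zero[OF f])
      then show "l = \<zero>\<^bsub>R\<^esub>" using l(1) LD(1) by (auto simp: e_eq_zero_iff)
    qed
    moreover have "\<zero> \<in> e ` L" using LD(2) e_zero by force
    ultimately have "f (e x) \<in> e ` L" if "x \<in> N \<inter> L" for x using that by (metis imageI singletonD)
    then have "N \<inter> L \<subseteq> {x \<in> L. f (e x) \<in> e ` L}" by blast
    then have "N \<inter> L \<subseteq> {\<zero>\<^bsub>R\<^esub>}" using NK by blast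
    then show "N \<inter> L = {\<zero>\<^bsub>R\<^esub>}" using LD(2) algebra_idealD(2)[OF N] by blast
  qed
  then show ?thesis using K unfolding essential_ideal_def by blast
qed

text \<open>An element t of L with e t in N kills the ideal of all such elements, so t = 0 by
  faithfulness; essentiality of L does the rest.\<close>

lemma annihilated_submodule_zero:
  assumes L: "essential_ideal L" and N: "submodule N S I"
    and ann: "\<And>l n. \<lbrakk>l \<in> L; n \<in> N\<rbrakk> \<Longrightarrow> l \<triangleright> n = \<zero>"
  shows "N = {\<zero>}"
proof (rule essential_submodule_zeroI[OF L N])
  fix t assume t: "t \<in> L" "e t \<in> N"
  note LD = algebra_idealD[OF essential_idealD(1)[OF L]]
  have tc: "t \<in> carrier R" using LD t by auto
  show "t = \<zero>\<^bsub>R\<^esub>"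
  proof (rule ideals_faithfulD[OF faithful])
    show "algebra_ideal F R (L \<inter> {x \<in> carrier R. e x \<in> N})"
      by (intro algebra_ideal_inter essential_idealD(1)[OF L] ideal_preimage[OF N])
    show "t \<in> L \<inter> {x \<in> carrier R. e x \<in> N}" using t tc by auto
    fix k assume k: "k \<in> L \<inter> {x \<in> carrier R. e x \<in> N}"
    then have "e (k \<otimes>\<^bsub>R\<^esub> t) = \<zero>" using ann[of k "e t"] t tc by (simp add: lact_e)
    then show "t \<otimes>\<^bsub>R\<^esub> k = \<zero>\<^bsub>R\<^esub>" using k tc by (simp add: e_eq_zero_iff mult_closed mult_comm)
  qed
qed

text \<open>Commutativity exchanges arguments: for l in the pullback of L under f, l acts on d(f(e
  y)) with the same result as y on d(f(e l)), and f(e l) lies in e(L), where d is zero. So the image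
  of R under d after f is killed by an essential ideal.\<close>

lemma HP_vanishes:
  assumes d: "d \<in> HP" and L: "essential_ideal L" and dL: "\<And>l. l \<in> L \<Longrightarrow> d (e l) = \<zero>"
    and p: "p \<in> P"
  shows "d p = \<zero>"
  using p
proof (induction p rule: P_induct)
  case (hom f x)
  note fH = C_HP[OF hom(1)]
  let ?K = "{l \<in> L. f (e l) \<in> e ` L}"
  have LR: "l \<in> carrier R" if "l \<in> L" for l using that essential_ideal_subset[OF L] by auto
  have eR: "submodule (e ` carrier R) S I" by (rule submodule_image[OF algebra_ideal_carrier])
  have sub1: "submodule (f ` e ` carrier R) S I" by (rule HP_image_submodule[OF eR _ fH]) auto
  have "submodule (d ` f ` e ` carrier R) S I"
    by (rule HP_image_submodule[OF sub1 _ d]) (use hom in auto)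
  then have "d ` f ` e ` carrier R = {\<zero>}"
  proof (rule annihilated_submodule_zero[OF essential_ideal_pullback[OF L fH]])
    fix l n assume l: "l \<in> ?K" and "n \<in> d ` f ` e ` carrier R"
    then obtain y where y: "y \<in> carrier R" "n = d (f (e y))" by blast
    obtain l' where l': "l' \<in> L" "f (e l) = e l'" using l by blast
    have lc: "l \<in> carrier R" using l LR by auto
    have "l \<triangleright> n = d (f (l \<triangleright> e y))"
      using y lc hom by (simp add: HP_lact[OF d] C_lact)
    also have "\<dots> = d (f (y \<triangleright> e l))" using y lc by (simp add: lact_e mult_comm)
    also have "\<dots> = y \<triangleright> d (f (e l))"
      using y lc hom by (simp add: HP_lact[OF d] C_lact)
    also have "\<dots> = \<zero>" using l' dL y by (simp add: left_mult_in_mult_ring)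
    finally show "l \<triangleright> n = \<zero>" .
  qed
  then show ?case using hom by blast
next
  case (add p q)
  then show ?case by (simp add: HPD(2)[OF d])
qed

text \<open>The action of l in K takes d(e x) to d(e(lx)) = 0, so d(e K) is a submodule killed by
  the essential ideal K.\<close>

lemma HP_vanishes_on_products:
  assumes d: "d \<in> HP" and K: "essential_ideal K"
    and dK: "\<And>x y. \<lbrakk>x \<in> K; y \<in> K\<rbrakk> \<Longrightarrow> d (e (x \<otimes>\<^bsub>R\<^esub> y)) = \<zero>" and p: "p \<in> P"
  shows "d p = \<zero>"
proof (rule HP_vanishes[OF d K _ p])
  note Ki = essential_idealD(1)[OF K]
  have KR: "l \<in> carrier R" if "l \<in> K" for l using that essential_ideal_subset[OF K] by auto
  have "submodule (d ` e ` K) S I"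
    by (rule HP_image_submodule[OF submodule_image[OF Ki] _ d]) (use KR in auto)
  then have "d ` e ` K = {\<zero>}"
  proof (rule annihilated_submodule_zero[OF K])
    fix l n assume l: "l \<in> K" and "n \<in> d ` e ` K"
    then obtain x where x: "x \<in> K" "n = d (e x)" by blast
    then have "l \<triangleright> n = d (e (l \<otimes>\<^bsub>R\<^esub> x))"
      using l KR by (simp add: lact_e flip: HP_lact[OF d])
    then show "l \<triangleright> n = \<zero>" using dK l x by simp
  qed
  then show "d (e l) = \<zero>" if "l \<in> K" for l using that by blast
qed

text \<open>On an essential ideal both maps take values in R. There they can act on different
  factors of a product: f(g(xy)) = (f x)(g y) = g(f(xy)). The commutator therefore vanishes on
  products.\<close>

lemma C_commute:
  assumes f: "f \<in> carrier C" and g: "g \<in> carrier C" and p: "p \<in> P"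
  shows "f (g p) = g (f p)"
proof -
  let ?Kf = "{x \<in> carrier R. f (e x) \<in> e ` carrier R}" and ?Kg = "{x \<in> carrier R. g (e x) \<in> e ` carrier R}"
  let ?d = "\<lambda>p. f (g p) \<ominus> g (f p)"
  have d: "?d \<in> HP"
    unfolding HP_iff
    using f g by (auto simp: CD M.M.minus_eq M.M.minus_add M.M.a_ac M.act_add M.act_minus)
  have K: "essential_ideal (?Kf \<inter> ?Kg)"
    by (intro essential_ideal_inter essential_ideal_pullback essential_ideal_carrier C_HP f g)
  have "?d p = \<zero>"
  proof (rule HP_vanishes_on_products[OF d K _ p])
    fix x y assume x: "x \<in> ?Kf \<inter> ?Kg" and y: "y \<in> ?Kf \<inter> ?Kg"
    obtain x' where x': "x' \<in> carrier R" "f (e x) = e x'" using x by blast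
    obtain y' where y': "y' \<in> carrier R" "g (e y) = e y'" using y by blast
    have "g (e (x \<otimes>\<^bsub>R\<^esub> y)) = e (y' \<otimes>\<^bsub>R\<^esub> x)"
      using x y y' C_lact[OF g, of x "e y"] by (simp add: lact_e mult_comm)
    moreover have "f (e (y' \<otimes>\<^bsub>R\<^esub> x)) = e (y' \<otimes>\<^bsub>R\<^esub> x')"
      using x y' x' C_lact[OF f, of y' "e x"] by (simp add: lact_e)
    moreover have "f (e (x \<otimes>\<^bsub>R\<^esub> y)) = e (x' \<otimes>\<^bsub>R\<^esub> y)"
      using x y x' C_lact[OF f, of y "e x"] by (simp add: lact_e mult_comm)
    moreover have "g (e (x' \<otimes>\<^bsub>R\<^esub> y)) = e (y' \<otimes>\<^bsub>R\<^esub> x')"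
      using y y' x' C_lact[OF g, of x' "e y"] by (simp add: lact_e mult_comm)
    ultimately show "?d (e (x \<otimes>\<^bsub>R\<^esub> y)) = \<zero>"
      using x' y' by (simp add: M.M.eq_iff_minus_zero mult_closed)
  qed
  then show ?thesis using f g p by (simp add: M.M.eq_iff_minus_zero)
qed

section \<open>The commutative ring CM(R)\<close>

lemma C_simps:
  "\<lbrakk>f \<in> carrier C; g \<in> carrier C; p \<in> P\<rbrakk> \<Longrightarrow> (f \<otimes>\<^bsub>C\<^esub> g) p = f (g p)"
  "\<lbrakk>f \<in> carrier C; g \<in> carrier C; p \<in> P\<rbrakk> \<Longrightarrow> (f \<oplus>\<^bsub>C\<^esub> g) p = f p \<oplus> g p"
  "p \<in> P \<Longrightarrow> \<one>\<^bsub>C\<^esub> p = p" "p \<in> P \<Longrightarrow> \<zero>\<^bsub>C\<^esub> p = \<zero>"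
  by (simp_all add: CM_def endo_ring_def compose_def)

lemma C_closed_ops:
  "\<lbrakk>f \<in> carrier C; g \<in> carrier C\<rbrakk> \<Longrightarrow> f \<otimes>\<^bsub>C\<^esub> g \<in> carrier C"
  "\<lbrakk>f \<in> carrier C; g \<in> carrier C\<rbrakk> \<Longrightarrow> f \<oplus>\<^bsub>C\<^esub> g \<in> carrier C"
  "\<one>\<^bsub>C\<^esub> \<in> carrier C" "\<zero>\<^bsub>C\<^esub> \<in> carrier C"
proof -
  show "f \<otimes>\<^bsub>C\<^esub> g \<in> carrier C" if "f \<in> carrier C" "g \<in> carrier C"
    using restrict_in_C[of "\<lambda>p. f (g p)"] that by (simp add: CM_def endo_ring_def compose_def HP_iff Pi_iff)
  show "f \<oplus>\<^bsub>C\<^esub> g \<in> carrier C" if "f \<in> carrier C" "g \<in> carrier C"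
  proof -
    have "(\<lambda>p. f p \<oplus> g p) \<in> HP"
      unfolding HP_iff using that by (auto simp: CD M.M.a_ac M.act_add)
    from restrict_in_C[OF this] show ?thesis by (simp add: CM_def endo_ring_def)
  qed
  show "\<one>\<^bsub>C\<^esub> \<in> carrier C"
    using restrict_in_C[of "\<lambda>p. p"] by (simp add: CM_def endo_ring_def HP_iff)
  show "\<zero>\<^bsub>C\<^esub> \<in> carrier C"
    using restrict_in_C[of "\<lambda>p. \<zero>"] by (simp add: CM_def endo_ring_def HP_iff)
qed

lemma C_cring: "cring C"
proof (rule cringI)
  show "abelian_group C"
  proof (rule abelian_groupI)
    fix f assume f: "f \<in> carrier C"
    have "(\<lambda>p. \<ominus> f p) \<in> HP"
      unfolding HP_iff using f by (auto simp: CD M.M.minus_add M.M.a_ac M.act_minus)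
    then have "restrict (\<lambda>p. \<ominus> f p) P \<in> carrier C" by (rule restrict_in_C)
    moreover from this have "restrict (\<lambda>p. \<ominus> f p) P \<oplus>\<^bsub>C\<^esub> f = \<zero>\<^bsub>C\<^esub>"
      by (intro C_eqI C_closed_ops f) (use f in \<open>auto simp: C_simps M.M.l_neg\<close>)
    ultimately show "\<exists>g \<in> carrier C. g \<oplus>\<^bsub>C\<^esub> f = \<zero>\<^bsub>C\<^esub>" by blast
  qed (auto intro!: C_eqI simp: C_closed_ops C_simps M.M.a_ac)
  show "comm_monoid C"
    by (rule comm_monoidI) (auto intro!: C_eqI simp: C_closed_ops C_simps C_commute)
qed (auto intro!: C_eqI simp: C_closed_ops C_simps)

end

sublocale jordan_hull \<subseteq> CC: cring "CM F R I e"
  by (rule C_cring)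

section \<open>The product of \<open>P(R)\<close>\<close>

context jordan_hull
begin

text \<open>Linearity over CM(R), as opposed to linearity over M(R)' in \<open>HP\<close>: left
  multiplications are linear over CM(R), but in general not over M(R)'.\<close>

definition C_linear where
  "C_linear \<phi> \<longleftrightarrow> \<phi> \<in> P \<rightarrow> P \<and> (\<forall>p \<in> P. \<forall>q \<in> P. \<phi> (p \<oplus> q) = \<phi> p \<oplus> \<phi> q) \<and>
     (\<forall>\<alpha> \<in> carrier C. \<forall>p \<in> P. \<phi> (\<alpha> p) = \<alpha> (\<phi> p))"

lemma C_linearI:
  assumes "\<And>p. p \<in> P \<Longrightarrow> \<phi> p \<in> P"
    and "\<And>p q. \<lbrakk>p \<in> P; q \<in> P\<rbrakk> \<Longrightarrow> \<phi> (p \<oplus> q) = \<phi> p \<oplus> \<phi> q"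
    and "\<And>\<alpha> p. \<lbrakk>\<alpha> \<in> carrier C; p \<in> P\<rbrakk> \<Longrightarrow> \<phi> (\<alpha> p) = \<alpha> (\<phi> p)"
  shows "C_linear \<phi>"
  using assms by (auto simp: C_linear_def)

lemma C_linearD:
  assumes "C_linear \<phi>"
  shows "p \<in> P \<Longrightarrow> \<phi> p \<in> P"
    and "\<lbrakk>p \<in> P; q \<in> P\<rbrakk> \<Longrightarrow> \<phi> (p \<oplus> q) = \<phi> p \<oplus> \<phi> q"
    and "\<lbrakk>\<alpha> \<in> carrier C; p \<in> P\<rbrakk> \<Longrightarrow> \<phi> (\<alpha> p) = \<alpha> (\<phi> p)"
  using assms by (auto simp: C_linear_def)

text \<open>Since P(R) = CM(R)R, a linear operator is determined by its values on R.\<close>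

lemma C_linear_eqI:
  assumes "C_linear \<phi>" "C_linear \<psi>" and "\<And>x. x \<in> carrier R \<Longrightarrow> \<phi> (e x) = \<psi> (e x)" and "p \<in> P"
  shows "\<phi> p = \<psi> p"
  using assms(4)
proof (induction p rule: P_induct)
  case (hom f x)
  then show ?case using assms(3) C_linearD(3)[OF assms(1)] C_linearD(3)[OF assms(2)] by simp
next
  case (add p q)
  then show ?case using C_linearD(2)[OF assms(1)] C_linearD(2)[OF assms(2)] by simp
qed

lemma C_linear_C: "\<alpha> \<in> carrier C \<Longrightarrow> C_linear \<alpha>"
  by (rule C_linearI) (auto simp: CD C_commute)

lemma C_linear_lact: "x \<in> carrier R \<Longrightarrow> C_linear (\<lambda>p. x \<triangleright> p)"
  by (rule C_linearI) (auto simp: M.act_add left_mult_in_mult_ring C_lact)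

lemma C_linear_comp: "\<lbrakk>C_linear \<phi>; C_linear \<psi>\<rbrakk> \<Longrightarrow> C_linear (\<lambda>p. \<phi> (\<psi> p))"
  by (rule C_linearI) (auto simp: C_linearD)

lemma C_linear_add: "\<lbrakk>C_linear \<phi>; C_linear \<psi>\<rbrakk> \<Longrightarrow> C_linear (\<lambda>p. \<phi> p \<oplus> \<psi> p)"
  by (rule C_linearI) (auto simp: C_linearD M.M.a_ac CD)

text \<open>This is the well-definedness of the extended product: the prescribed values y
  \<triangleright> p involve p alone and no representation of p as a sum. For p = f(e x) they are
  taken by f after left multiplication by x.\<close>

lemma C_linear_mult_exists:
  assumes "p \<in> P"
  shows "\<exists>\<phi>. C_linear \<phi> \<and> (\<forall>y \<in> carrier R. \<phi> (e y) = y \<triangleright> p)"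
  using assms
proof (induction p rule: P_induct)
  case (hom f x)
  then have "C_linear (\<lambda>q. f (x \<triangleright> q))"
    by (intro C_linear_comp[OF C_linear_C C_linear_lact])
  moreover have "f (x \<triangleright> e y) = y \<triangleright> f (e x)" if "y \<in> carrier R" for y
    using hom that by (simp add: lact_e mult_comm flip: C_lact)
  ultimately show ?case by blast
next
  case (add p q)
  then obtain \<phi> \<psi> where "C_linear \<phi>" "\<forall>y \<in> carrier R. \<phi> (e y) = y \<triangleright> p"
    "C_linear \<psi>" "\<forall>y \<in> carrier R. \<psi> (e y) = y \<triangleright> q" by blast
  then show ?case using add(1,2)
    by (intro exI[of _ "\<lambda>u. \<phi> u \<oplus> \<psi> u"]) (auto simp: C_linear_add M.act_add left_mult_in_mult_ring)
qed

text \<open>By \<open>C_linear_eqI\<close> the chosen operator is unique on \<open>P\<close>, so the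
  laws of the product follow by comparing linear operators on R.\<close>

definition pmult (infixl \<open>\<star>\<close> 72) where
  "p \<star> q = (SOME \<phi>. C_linear \<phi> \<and> (\<forall>y \<in> carrier R. \<phi> (e y) = y \<triangleright> p)) q"

lemma pmult:
  assumes "p \<in> P"
  shows pmult_linear: "C_linear (\<lambda>q. p \<star> q)" and pmult_e: "y \<in> carrier R \<Longrightarrow> p \<star> e y = y \<triangleright> p"
proof -
  have "C_linear (pmult p) \<and> (\<forall>y \<in> carrier R. p \<star> e y = y \<triangleright> p)"
    using someI_ex[OF C_linear_mult_exists[OF assms]] unfolding pmult_def by simp
  then show "C_linear (\<lambda>q. p \<star> q)" "y \<in> carrier R \<Longrightarrow> p \<star> e y = y \<triangleright> p" by auto
qed

lemma pmult_closed [simp, intro]: "\<lbrakk>p \<in> P; q \<in> P\<rbrakk> \<Longrightarrow> p \<star> q \<in> P"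
  and pmult_add_right: "\<lbrakk>p \<in> P; q \<in> P; q' \<in> P\<rbrakk> \<Longrightarrow> p \<star> (q \<oplus> q') = p \<star> q \<oplus> p \<star> q'"
  and pmult_C_right: "\<lbrakk>p \<in> P; q \<in> P; \<alpha> \<in> carrier C\<rbrakk> \<Longrightarrow> p \<star> \<alpha> q = \<alpha> (p \<star> q)"
  using C_linearD[OF pmult_linear] by auto

lemma pmult_add_left:
  assumes "p \<in> P" "p' \<in> P" "q \<in> P"
  shows "(p \<oplus> p') \<star> q = p \<star> q \<oplus> p' \<star> q"
  by (rule C_linear_eqI[OF pmult_linear C_linear_add[OF pmult_linear pmult_linear]])
    (use assms in \<open>auto simp: pmult_e M.act_add left_mult_in_mult_ring\<close>)

lemma pmult_C_left:
  assumes "p \<in> P" "q \<in> P" "\<alpha> \<in> carrier C"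
  shows "\<alpha> p \<star> q = \<alpha> (p \<star> q)"
  by (rule C_linear_eqI[OF pmult_linear C_linear_comp[OF C_linear_C pmult_linear]])
    (use assms in \<open>auto simp: pmult_e C_lact\<close>)

lemma pmult_linear_left: "q \<in> P \<Longrightarrow> C_linear (\<lambda>p. p \<star> q)"
  by (rule C_linearI) (auto simp: pmult_add_left pmult_C_left)

lemma e_pmult: "\<lbrakk>x \<in> carrier R; q \<in> P\<rbrakk> \<Longrightarrow> e x \<star> q = x \<triangleright> q"
  by (rule C_linear_eqI[OF pmult_linear C_linear_lact]) (auto simp: pmult_e lact_e mult_comm)

lemma pmult_comm: "\<lbrakk>p \<in> P; q \<in> P\<rbrakk> \<Longrightarrow> p \<star> q = q \<star> p"
  by (rule C_linear_eqI[OF pmult_linear_left pmult_linear]) (auto simp: pmult_e e_pmult)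

lemma pmult_e_e: "\<lbrakk>x \<in> carrier R; y \<in> carrier R\<rbrakk> \<Longrightarrow> e x \<star> e y = e (x \<otimes>\<^bsub>R\<^esub> y)"
  by (simp add: e_pmult lact_e)

section \<open>The Jordan identity in P(R)\<close>

abbreviation J_lhs where
  "J_lhs a b c y \<equiv> ((a \<star> b) \<star> y) \<star> c \<oplus> ((b \<star> c) \<star> y) \<star> a \<oplus> ((c \<star> a) \<star> y) \<star> b"

abbreviation J_rhs where
  "J_rhs a b c y \<equiv> (a \<star> b) \<star> (y \<star> c) \<oplus> (b \<star> c) \<star> (y \<star> a) \<oplus> (c \<star> a) \<star> (y \<star> b)"

lemma C_linear_id: "C_linear (\<lambda>p. p)"
  by (rule C_linearI) auto

lemma C_linear_pmult_left: "\<lbrakk>C_linear \<phi>; q \<in> P\<rbrakk> \<Longrightarrow> C_linear (\<lambda>p. \<phi> p \<star> q)"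
  and C_linear_pmult_right: "\<lbrakk>C_linear \<phi>; q \<in> P\<rbrakk> \<Longrightarrow> C_linear (\<lambda>p. q \<star> \<phi> p)"
  by (rule C_linear_comp[OF pmult_linear_left] C_linear_comp[OF pmult_linear]; assumption)+

lemmas C_linear_intros = C_linear_add C_linear_pmult_left C_linear_pmult_right C_linear_id

text \<open>Both sides are CM(R)-linear in each variable, so the identity passes from R to P(R) one
  variable at a time. The cubic Jordan identity is not open to this argument.\<close>

lemma pmult_linearized_jordan:
  assumes "a \<in> P" "b \<in> P" "c \<in> P" "y \<in> P"
  shows "J_lhs a b c y = J_rhs a b c y"
proof -
  have 1: "J_lhs (e a) (e b) (e c) (e y) = J_rhs (e a) (e b) (e c) (e y)"
    if "a \<in> carrier R" "b \<in> carrier R" "c \<in> carrier R" "y \<in> carrier R" for a b c y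
    using linearized_jordan[OF that] that by (simp add: pmult_e_e mult_closed flip: e_add)
  have 2: "J_lhs a (e b) (e c) (e y) = J_rhs a (e b) (e c) (e y)" if "a \<in> P" "b \<in> carrier R" "c \<in> carrier R" "y \<in> carrier R" for a b c y
  proof (rule C_linear_eqI[where \<phi>="\<lambda>a. J_lhs a (e b) (e c) (e y)" and \<psi>="\<lambda>a. J_rhs a (e b) (e c) (e y)"])
    show "C_linear (\<lambda>a. J_lhs a (e b) (e c) (e y))" "C_linear (\<lambda>a. J_rhs a (e b) (e c) (e y))"
      by (intro C_linear_intros pmult_closed e_in_P that)+
  qed (use that 1 in auto)
  have 3: "J_lhs a b (e c) (e y) = J_rhs a b (e c) (e y)" if "a \<in> P" "b \<in> P" "c \<in> carrier R" "y \<in> carrier R" for a b c y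
  proof (rule C_linear_eqI[where \<phi>="\<lambda>b. J_lhs a b (e c) (e y)" and \<psi>="\<lambda>b. J_rhs a b (e c) (e y)"])
    show "C_linear (\<lambda>b. J_lhs a b (e c) (e y))" "C_linear (\<lambda>b. J_rhs a b (e c) (e y))"
      by (intro C_linear_intros pmult_closed e_in_P that)+
  qed (use that 2 in auto)
  have 4: "J_lhs a b c (e y) = J_rhs a b c (e y)" if "a \<in> P" "b \<in> P" "c \<in> P" "y \<in> carrier R" for a b c y
  proof (rule C_linear_eqI[where \<phi>="\<lambda>c. J_lhs a b c (e y)" and \<psi>="\<lambda>c. J_rhs a b c (e y)"])
    show "C_linear (\<lambda>c. J_lhs a b c (e y))" "C_linear (\<lambda>c. J_rhs a b c (e y))"
      by (intro C_linear_intros pmult_closed e_in_P that)+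
  qed (use that 3 in auto)
  have 5: "J_lhs a b c y = J_rhs a b c y" if "a \<in> P" "b \<in> P" "c \<in> P" "y \<in> P"  for a b c y
  proof (rule C_linear_eqI[where \<phi>="\<lambda>y. J_lhs a b c y" and \<psi>="\<lambda>y. J_rhs a b c y"])
    show "C_linear (\<lambda>y. J_lhs a b c y)" "C_linear (\<lambda>y. J_rhs a b c y)"
      by (intro C_linear_intros pmult_closed e_in_P that)+
  qed (use that 4 in auto)
  show ?thesis by (rule 5) (use assms in auto)
qed

lemma scalar_in_C: "c \<in> carrier F \<Longrightarrow> restrict (\<lambda>p. scalar_op R c \<odot> p) P \<in> carrier C"
  by (rule restrict_in_C) (simp add: HP_iff Pi_iff scalar_op_in_mult_ring M.act_add scalar_act_commute)

lemma add_pow_C_one: "add_pow C (n::nat) \<one>\<^bsub>C\<^esub> \<in> carrier C"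
  by (simp add: CC.add.nat_pow_closed)

lemma add_pow_C_one_apply: "p \<in> P \<Longrightarrow> add_pow C (n::nat) \<one>\<^bsub>C\<^esub> p = add_pow I n p"
  by (induction n) (simp_all add: C_simps C_closed_ops)

lemma add_pow_F_one_act: "p \<in> P \<Longrightarrow> scalar_op R (add_pow F (n::nat) \<one>\<^bsub>F\<^esub>) \<odot> p = add_pow I n p"
proof (induction n)
  case 0
  have "scalar_op R \<zero>\<^bsub>F\<^esub> = \<zero>\<^bsub>S\<^esub>" unfolding mult_ring_simps by (intro restrict_ext) simp
  then show ?case using 0 by simp
next
  case (Suc n)
  have "scalar_op R (add_pow F (Suc n) \<one>\<^bsub>F\<^esub>) = scalar_op R (add_pow F n \<one>\<^bsub>F\<^esub>) \<oplus>\<^bsub>S\<^esub> \<one>\<^bsub>S\<^esub>"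
    unfolding mult_ring_simps by (intro restrict_ext) (simp add: smult_l_distr)
  then show ?case
    using Suc by (simp add: M.act_add_ring scalar_op_in_mult_ring)
qed

text \<open>The scalar 1/6 of F acts on P(R) as an element of CM(R), which inverts 6 there.\<close>

lemma C_six_unit: "add_pow C (6::nat) \<one>\<^bsub>C\<^esub> \<in> Units C"
proof -
  let ?u = "add_pow F (6::nat) \<one>\<^bsub>F\<^esub>"
  obtain v where v: "v \<in> carrier F" "v \<otimes>\<^bsub>F\<^esub> ?u = \<one>\<^bsub>F\<^esub>"
    using six_unit unfolding Units_def by auto
  let ?w = "restrict (\<lambda>p. scalar_op R v \<odot> p) P"
  note w = scalar_in_C[OF v(1)]
  have uP: "scalar_op R ?u \<odot> p \<in> P" if "p \<in> P" for p
    using that by (intro P_act scalar_op_in_mult_ring R.add.nat_pow_closed R.one_closed)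
  have "scalar_op R ?u \<otimes>\<^bsub>S\<^esub> scalar_op R v = \<one>\<^bsub>S\<^esub>"
    unfolding mult_ring_simps using v by (intro restrict_ext) (simp flip: smult_assoc1)
  then have "scalar_op R v \<odot> (scalar_op R ?u \<odot> p) = p" if "p \<in> P" for p
    using that v by (simp add: scalar_op_in_mult_ring flip: M.act_mult)
  then have "?w \<otimes>\<^bsub>C\<^esub> add_pow C (6::nat) \<one>\<^bsub>C\<^esub> = \<one>\<^bsub>C\<^esub>"
    using w add_pow_C_one[of 6]
    by (intro C_eqI) (simp_all add: uP C_closed_ops C_simps add_pow_C_one_apply flip: add_pow_F_one_act)
  then show ?thesis
    using w add_pow_C_one[of 6] unfolding Units_def by (auto simp: CC.m_comm intro!: bexI[of _ ?w])
qed

lemma P_abelian_group: "abelian_group (P_with_product F R I e m)"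
proof (rule abelian_groupI)
  show "\<exists>y \<in> carrier (P_with_product F R I e m). y \<oplus>\<^bsub>P_with_product F R I e m\<^esub> x = \<zero>\<^bsub>P_with_product F R I e m\<^esub>"
    if "x \<in> carrier (P_with_product F R I e m)" for x
    using that by (intro bexI[of _ "\<ominus> x"]) (auto simp: P_with_product_def M.M.l_neg)
qed (auto simp: P_with_product_def M.M.a_ac)

lemma P_module: "module C (P_with_product F R I e m)"
  by (rule moduleI[OF C_cring P_abelian_group]) (auto simp: P_with_product_def C_simps CD)

abbreviation pm where "pm \<equiv> (\<lambda>p \<in> P. \<lambda>q \<in> P. p \<star> q)"

lemma P_nonassoc_algebra: "nonassoc_algebra C (P_with_product F R I e pm)"
  by (intro nonassoc_algebra.intro P_module nonassoc_algebra_axioms.intro C_six_unit)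
    (auto simp: P_with_product_def pmult_add_left pmult_add_right pmult_C_left pmult_C_right)

text \<open>A competing bilinear product agrees with \<star> for left factors in R, by linearity in
  the right factor, and then everywhere by linearity in the left one. Extensionality fixes its
  values outside P.\<close>

lemma P_product_eq: "P_product F R I e = pm"
  unfolding P_product_def
proof (rule the_equality)
  show "pm \<in> P \<rightarrow>\<^sub>E (P \<rightarrow>\<^sub>E P) \<and> nonassoc_algebra C (P_with_product F R I e pm) \<and>
      (\<forall>x \<in> carrier R. \<forall>y \<in> carrier R. pm (e x) (e y) = e (x \<otimes>\<^bsub>R\<^esub> y))"
    using P_nonassoc_algebra by (auto simp: pmult_e_e)
next
  fix m assume m: "m \<in> P \<rightarrow>\<^sub>E (P \<rightarrow>\<^sub>E P) \<and> nonassoc_algebra C (P_with_product F R I e m) \<and>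
      (\<forall>x \<in> carrier R. \<forall>y \<in> carrier R. m (e x) (e y) = e (x \<otimes>\<^bsub>R\<^esub> y))"
  then interpret m: nonassoc_algebra C "P_with_product F R I e m" by simp
  have mc: "m p q \<in> P" if "p \<in> P" "q \<in> P" for p q using m that by (auto simp: PiE_iff)
  have lin1: "C_linear (\<lambda>p. m p q)" if "q \<in> P" for q
    using that mc m.mult_add_left[of _ _ q] m.mult_smult_left[of _ _ q]
    by (intro C_linearI) (auto simp: P_with_product_def)
  have lin2: "C_linear (\<lambda>q. m p q)" if "p \<in> P" for p
    using that mc m.mult_add_right[of p] m.mult_smult_right[of _ p]
    by (intro C_linearI) (auto simp: P_with_product_def)
  have base: "m (e x) q = e x \<star> q" if "x \<in> carrier R" "q \<in> P" for x q
    by (rule C_linear_eqI[OF lin2 pmult_linear]) (use that m in \<open>auto simp: pmult_e_e\<close>)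
  have eq: "m p q = pm p q" if p: "p \<in> P" and q: "q \<in> P" for p q
    using C_linear_eqI[OF lin1[OF q] pmult_linear_left[OF q] base[OF _ q] p] p q by simp
  show "m = pm"
  proof (rule extensionalityI[of _ P])
    show "m p = pm p" if p: "p \<in> P" for p
      by (rule extensionalityI[of _ P]) (use m p eq in \<open>auto simp: PiE_iff\<close>)
  qed (use m in \<open>auto simp: PiE_iff\<close>)
qed

abbreviation PA where "PA \<equiv> P_algebra F R I e"

lemma PA_eq: "PA = P_with_product F R I e pm"
  by (simp add: P_algebra_def P_product_eq)

lemma PA_simps [simp]: "carrier PA = P" "\<zero>\<^bsub>PA\<^esub> = \<zero>" "add PA = add I" "smult PA \<alpha> p = \<alpha> p"
  by (simp_all add: PA_eq P_with_product_def)

lemma PA_mult: "\<lbrakk>p \<in> P; q \<in> P\<rbrakk> \<Longrightarrow> p \<otimes>\<^bsub>PA\<^esub> q = p \<star> q"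
  by (simp add: PA_eq P_with_product_def)

lemma PA_jordan_algebra: "jordan_algebra C PA"
proof (intro jordan_algebra.intro jordan_algebra_axioms.intro)
  show PA: "nonassoc_algebra C PA" using P_nonassoc_algebra by (simp add: PA_eq)
  interpret PA: nonassoc_algebra C PA by fact
  show "x \<otimes>\<^bsub>PA\<^esub> y = y \<otimes>\<^bsub>PA\<^esub> x" if "x \<in> carrier PA" "y \<in> carrier PA" for x y
    using that by (simp add: PA_mult pmult_comm)
  fix x y assume xy: "x \<in> carrier PA" "y \<in> carrier PA"
  let ?l = "((x \<star> x) \<star> y) \<star> x" and ?r = "(x \<star> x) \<star> (y \<star> x)"
  \<comment> \<open>With all three variables equal to x the linearized identity is three times the
    Jordan identity, and 3 can be cancelled.\<close>
  have "?l \<oplus> ?l \<oplus> ?l = ?r \<oplus> ?r \<oplus> ?r"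
    using pmult_linearized_jordan[of x x x y] xy by simp
  moreover have "(l \<ominus> r) \<oplus> (l \<ominus> r) \<oplus> (l \<ominus> r) = (l \<oplus> l \<oplus> l) \<ominus> (r \<oplus> r \<oplus> r)"
    if "l \<in> carrier I" "r \<in> carrier I" for l r
    using that by (simp add: M.M.minus_eq M.M.minus_add M.M.a_ac)
  ultimately have "(?l \<ominus> ?r) \<oplus> (?l \<ominus> ?r) \<oplus> (?l \<ominus> ?r) = \<zero>"
    using xy by (simp add: M.M.eq_iff_minus_zero)
  then have "?l \<ominus> ?r = \<zero>"
    using xy PA.triple_cancel[of "?l \<ominus> ?r"] by (simp add: M.M.minus_eq)
  then have "?l = ?r" using xy by (simp add: M.M.eq_iff_minus_zero)
  then show "((x \<otimes>\<^bsub>PA\<^esub> x) \<otimes>\<^bsub>PA\<^esub> y) \<otimes>\<^bsub>PA\<^esub> x = (x \<otimes>\<^bsub>PA\<^esub> x) \<otimes>\<^bsub>PA\<^esub> (y \<otimes>\<^bsub>PA\<^esub> x)"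
    using xy by (simp add: PA_mult)
qed

end

sublocale jordan_hull \<subseteq> PA: jordan_algebra "CM F R I e" "P_algebra F R I e"
  by (rule PA_jordan_algebra)

section \<open>\<open>P(R)\<close> as an algebra of quotients, and supports\<close>

context mult_hull
begin

lemma scalar_act_add:
  assumes "c \<in> carrier F" "d \<in> carrier F" "u \<in> carrier M"
  shows "scalar_op A (c \<oplus>\<^bsub>F\<^esub> d) \<odot> u = scalar_op A c \<odot> u \<oplus> scalar_op A d \<odot> u"
proof -
  have "scalar_op A (c \<oplus>\<^bsub>F\<^esub> d) = scalar_op A c \<oplus>\<^bsub>S\<^esub> scalar_op A d"
    unfolding mult_ring_simps by (intro restrict_ext) (use assms in \<open>simp add: smult_l_distr\<close>)
  then show ?thesis using assms by (simp add: M.act_add_ring scalar_op_in_mult_ring)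
qed

lemma scalar_act_mult:
  assumes "c \<in> carrier F" "d \<in> carrier F" "u \<in> carrier M"
  shows "scalar_op A (c \<otimes>\<^bsub>F\<^esub> d) \<odot> u = scalar_op A c \<odot> (scalar_op A d \<odot> u)"
proof -
  have "scalar_op A (c \<otimes>\<^bsub>F\<^esub> d) = scalar_op A d \<otimes>\<^bsub>S\<^esub> scalar_op A c"
    unfolding mult_ring_simps by (intro restrict_ext) (use assms in \<open>simp add: smult_assoc1\<close>)
  then show ?thesis using assms by (simp add: M.act_mult scalar_op_in_mult_ring)
qed

lemma scalar_act_one: "u \<in> carrier M \<Longrightarrow> scalar_op A \<one>\<^bsub>F\<^esub> \<odot> u = u"
proof -
  have "scalar_op A \<one>\<^bsub>F\<^esub> = \<one>\<^bsub>S\<^esub>"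
    unfolding mult_ring_simps by (intro restrict_ext) simp
  then show "u \<in> carrier M \<Longrightarrow> scalar_op A \<one>\<^bsub>F\<^esub> \<odot> u = u" by simp
qed

end

section \<open>P(R) over the base ring F\<close>

context jordan_hull
begin

abbreviation PB where "PB \<equiv> P_base_algebra F R I e"

lemma PB_simps [simp]: "carrier PB = P" "\<zero>\<^bsub>PB\<^esub> = \<zero>" "add PB = add I"
  "smult PB c p = scalar_op R c \<odot> p"
  by (simp_all add: P_base_algebra_def scalar_module_def)

lemma PB_mult [simp]: "\<lbrakk>p \<in> P; q \<in> P\<rbrakk> \<Longrightarrow> p \<otimes>\<^bsub>PB\<^esub> q = p \<star> q"
  by (simp add: P_base_algebra_def P_product_eq)

text \<open>Scalars of F act on P(R) as elements of CM(R), over which the product is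
  bilinear.\<close>

lemma pmult_scalar:
  assumes "c \<in> carrier F" "p \<in> P" "q \<in> P"
  shows "(scalar_op R c \<odot> p) \<star> q = scalar_op R c \<odot> (p \<star> q)"
    and "p \<star> (scalar_op R c \<odot> q) = scalar_op R c \<odot> (p \<star> q)"
  using pmult_C_left[OF assms(2,3) scalar_in_C[OF assms(1)]]
    pmult_C_right[OF assms(2,3) scalar_in_C[OF assms(1)]] assms by simp_all

lemma PB_jordan_algebra: "jordan_algebra F PB"
proof -
  have ab: "abelian_group PB"
  proof (rule abelian_groupI)
    show "\<exists>y \<in> carrier PB. y \<oplus>\<^bsub>PB\<^esub> x = \<zero>\<^bsub>PB\<^esub>" if "x \<in> carrier PB" for x
      using that by (intro bexI[of _ "\<ominus> x"]) (auto simp: M.M.l_neg)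
  qed (auto simp: M.M.a_ac)
  have mod: "module F PB"
    by (rule moduleI[OF is_cring ab])
      (auto simp: scalar_op_in_mult_ring scalar_act_add scalar_act_mult scalar_act_one M.act_add)
  have jid: "((x \<star> x) \<star> y) \<star> x = (x \<star> x) \<star> (y \<star> x)" if "x \<in> P" "y \<in> P" for x y
    using PA.jordan_identity[of x y] that by (simp add: PA_mult)
  show ?thesis
  proof (intro jordan_algebra.intro nonassoc_algebra.intro jordan_algebra_axioms.intro
      nonassoc_algebra_axioms.intro mod six_unit)
    show "x \<otimes>\<^bsub>PB\<^esub> y = y \<otimes>\<^bsub>PB\<^esub> x" if "x \<in> carrier PB" "y \<in> carrier PB" for x y
      using that by (simp add: pmult_comm)
  qed (auto simp: pmult_add_left pmult_add_right pmult_scalar scalar_op_in_mult_ring jid)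
qed

lemma PB_embedding: "algebra_embedding F R PB e"
  unfolding algebra_embedding_def using e_inj by (auto simp: e_add pmult_e_e scalar_act)

text \<open>For q = f(e x) the pullback along f serves, because k acts on f(e x) with the same
  result as x on f(e k), which lies in R. The condition on multiples of q is what
  \<open>P_annihilator_free\<close> uses to bring (qy)k into R.\<close>

lemma multipliers:
  assumes "q \<in> P"
  shows "\<exists>K. essential_ideal K \<and> (\<forall>k \<in> K. k \<triangleright> q \<in> e ` carrier R \<and> (\<forall>y \<in> carrier R. k \<triangleright> y \<triangleright> q \<in> e ` carrier R))"
  using assms
proof (induction q rule: P_induct)
  case (hom f x)
  let ?K = "{k \<in> carrier R. f (e k) \<in> e ` carrier R}"
  have fx: "k \<triangleright> f (e x) \<in> e ` carrier R" if k: "k \<in> ?K" and x: "x \<in> carrier R" for k x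
  proof -
    obtain k' where "k' \<in> carrier R" "f (e k) = e k'" using k by blast
    moreover have "k \<triangleright> f (e x) = x \<triangleright> f (e k)"
      using k x hom by (simp add: lact_e mult_comm flip: C_lact)
    ultimately show ?thesis using x by (auto simp: lact_e mult_closed)
  qed
  have "k \<triangleright> y \<triangleright> f (e x) \<in> e ` carrier R" if "k \<in> ?K" "y \<in> carrier R" for k y
    using fx[of k "y \<otimes>\<^bsub>R\<^esub> x"] that hom by (simp add: lact_e mult_closed flip: C_lact)
  then show ?case
    using essential_ideal_pullback[OF essential_ideal_carrier C_HP[OF hom(1)]] fx hom(2) by blast
next
  case (add p q)
  then obtain K L where K: "essential_ideal K" "\<And>k y. k \<in> K \<Longrightarrow> k \<triangleright> p \<in> e ` carrier R"
      "\<And>k y. \<lbrakk>k \<in> K; y \<in> carrier R\<rbrakk> \<Longrightarrow> k \<triangleright> y \<triangleright> p \<in> e ` carrier R"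
    and L: "essential_ideal L" "\<And>k y. k \<in> L \<Longrightarrow> k \<triangleright> q \<in> e ` carrier R"
      "\<And>k y. \<lbrakk>k \<in> L; y \<in> carrier R\<rbrakk> \<Longrightarrow> k \<triangleright> y \<triangleright> q \<in> e ` carrier R" by metis
  have eR: "u \<oplus> v \<in> e ` carrier R" if "u \<in> e ` carrier R" "v \<in> e ` carrier R" for u v
    using M.right_submoduleD(3)[OF submodule_image[OF algebra_ideal_carrier]] that by blast
  have KR: "k \<in> carrier R" if "k \<in> K" for k using essential_ideal_subset[OF K(1)] that by auto
  show ?case
    using add(1,2) K L eR KR
    by (intro exI[of _ "K \<inter> L"]) (auto simp: essential_ideal_inter M.act_add left_mult_in_mult_ring)
qed

text \<open>The annihilator is an ideal, and its elements in K kill K, so it meets K in zero by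
  faithfulness.\<close>

lemma essential_ideal_annihilator:
  assumes K: "essential_ideal K"
  shows "jordan_annihilator R K = {\<zero>\<^bsub>R\<^esub>}"
proof (rule essential_idealD(2)[OF K])
  note Ki = essential_idealD(1)[OF K]
  note J = algebra_ideal_jordan_annihilator[OF Ki]
  show "algebra_ideal F R (jordan_annihilator R K)" by (rule J)
  have "t = \<zero>\<^bsub>R\<^esub>" if t: "t \<in> jordan_annihilator R K \<inter> K" for t
    by (rule ideals_faithfulD[OF faithful Ki]) (use t jordan_annihilator_iff[OF Ki] in auto)
  then show "jordan_annihilator R K \<inter> K = {\<zero>\<^bsub>R\<^esub>}"
    using algebra_idealD(2)[OF J] algebra_idealD(2)[OF Ki] by blast
qed

lemmas PA_jordan_kills_twice = PA.jordan_kills_twice[unfolded PA_simps]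
lemmas PA_jordan_shift = PA.jordan_shift[unfolded PA_simps]

text \<open>Multipliers bring the elements (qy)k into R, where they kill an essential ideal and
  therefore vanish. So q lies in \<open>Z\<close>, the annihilator of that ideal formed in P(R);
  \<open>jordan_shift\<close> makes \<open>Z\<close> a submodule, and it is killed by an essential
  ideal, hence zero.\<close>

lemma P_annihilator_free:
  assumes K: "essential_ideal K" and q: "q \<in> P" and qK: "\<And>k. k \<in> K \<Longrightarrow> q \<star> e k = \<zero>"
  shows "q = \<zero>"
proof -
  obtain L where L: "essential_ideal L"
    "\<And>k y. \<lbrakk>k \<in> L; y \<in> carrier R\<rbrakk> \<Longrightarrow> k \<triangleright> y \<triangleright> q \<in> e ` carrier R"
    using multipliers[OF q] by blast
  define N where "N = K \<inter> L"
  have N: "essential_ideal N" unfolding N_def by (rule essential_ideal_inter[OF K L(1)])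
  note Ni = essential_idealD(1)[OF N]
  note ND = algebra_idealD[OF Ni]
  have Nc: "k \<in> carrier R" if "k \<in> N" for k using ND(1) that by auto
  have qN: "q \<star> e k = \<zero>" if "k \<in> N" for k using qK that by (simp add: N_def)
  have qyN: "(q \<star> e y) \<star> e k = \<zero>" if y: "y \<in> carrier R" and k: "k \<in> N" for y k
  proof -
    have "(q \<star> e y) \<star> e k = k \<triangleright> y \<triangleright> q" using q y Nc[OF k] by (simp add: pmult_e)
    then obtain t where t: "t \<in> carrier R" "(q \<star> e y) \<star> e k = e t"
      using L(2)[of k y] y k by (auto simp: N_def)
    have "t = \<zero>\<^bsub>R\<^esub>"
    proof (rule faithful_annihilator_free[OF faithful Ni essential_ideal_annihilator[OF N] t(1)])
      fix z assume z: "z \<in> N"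
      have "e (t \<otimes>\<^bsub>R\<^esub> z) = ((q \<star> e y) \<star> e k) \<star> e z" using t Nc[OF z] by (simp add: pmult_e_e)
      also have "\<dots> = \<zero>"
        using PA_jordan_kills_twice[of q "e y" "e k" "e z"] q y Nc[OF z] Nc[OF k] qN z k ND
        by (simp add: PA_mult pmult_e_e mult_closed)
      finally show "t \<otimes>\<^bsub>R\<^esub> z = \<zero>\<^bsub>R\<^esub>" using t Nc[OF z] by (simp add: e_eq_zero_iff mult_closed)
    qed
    then show ?thesis using t by simp
  qed
  define Z where "Z = {p \<in> P. \<forall>k \<in> N. p \<star> e k = \<zero> \<and> (\<forall>y \<in> carrier R. (p \<star> e y) \<star> e k = \<zero>)}"
  have Zl: "x \<triangleright> p \<in> Z" if x: "x \<in> carrier R" and p: "p \<in> Z" for x p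
  proof -
    have pP: "p \<in> P" using p by (simp add: Z_def)
    have "((p \<star> e x) \<star> e y) \<star> e k = \<zero>" if "k \<in> N" "y \<in> carrier R" for k y
      using PA_jordan_shift[of p "e x" "e y" "e k"] p pP x that Nc ND
      by (simp add: PA_mult Z_def pmult_e_e mult_closed)
    then show ?thesis using p x pP by (simp add: Z_def flip: pmult_e[OF pP])
  qed
  have "submodule Z S I"
  proof (rule mult_submoduleI)
    show "left_mult R x \<odot> p \<in> Z" "right_mult R x \<odot> p \<in> Z" if "x \<in> carrier R" "p \<in> Z" for x p
      using Zl that by (simp_all add: right_mult_eq)
    show "scalar_op R c \<odot> p \<in> Z" if "c \<in> carrier F" "p \<in> Z" for c p
      using that Nc by (auto simp: Z_def scalar_op_in_mult_ring pmult_scalar)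
    show "x \<oplus> y \<in> Z" if "x \<in> Z" "y \<in> Z" for x y
      using that Nc by (auto simp: Z_def pmult_add_left)
  qed (auto simp: Z_def Nc pmult_e left_mult_in_mult_ring)
  then have "Z = {\<zero>}"
  proof (rule annihilated_submodule_zero[OF N])
    fix l n assume "l \<in> N" "n \<in> Z"
    then show "l \<triangleright> n = \<zero>" using Nc[of l] by (auto simp: Z_def simp flip: pmult_e)
  qed
  moreover have "q \<in> Z" using q qN qyN by (simp add: Z_def)
  ultimately show ?thesis by blast
qed

theorem PB_M_quotients: "M_quotients F R PB e"
proof (rule M_quotientsI[OF jordan_algebra_axioms PB_jordan_algebra PB_embedding])
  fix q assume q: "q \<in> carrier PB" "q \<noteq> \<zero>\<^bsub>PB\<^esub>"
  then obtain K where K: "essential_ideal K" "\<And>k. k \<in> K \<Longrightarrow> k \<triangleright> q \<in> e ` carrier R"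
    using multipliers[of q] by auto
  have Kc: "k \<in> carrier R" if "k \<in> K" for k using essential_ideal_subset[OF K(1)] that by auto
  have eq: "e k \<otimes>\<^bsub>PB\<^esub> q = k \<triangleright> q" "q \<star> e k = k \<triangleright> q" if "k \<in> K" for k
    using q Kc[OF that] by (simp_all add: e_pmult pmult_e)
  have "\<exists>k \<in> K. q \<star> e k \<noteq> \<zero>" using P_annihilator_free[OF K(1)] q by auto
  then show "\<exists>K. algebra_ideal F R K \<and> jordan_annihilator R K = {\<zero>\<^bsub>R\<^esub>} \<and>
      (\<exists>a \<in> K. e a \<otimes>\<^bsub>PB\<^esub> q \<noteq> \<zero>\<^bsub>PB\<^esub>) \<and> (\<forall>a \<in> K. e a \<otimes>\<^bsub>PB\<^esub> q \<in> e ` carrier R)"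
    using K essential_ideal_annihilator[OF K(1)] essential_idealD(1)[OF K(1)] eq
    by (intro exI[of _ K]) auto
qed

theorem PB_embeds_in_maximal:
  assumes "maximal_M_quotients F R Q k"
  shows "\<exists>f. algebra_embedding F PB Q f \<and> (\<forall>x \<in> carrier R. f (e x) = k x)"
  by (rule M_quotient_algebra.embeds_in_maximal[OF M_quotient_algebraI[OF PB_M_quotients] faithful assms])

text \<open>The trace L of K on R is an ideal. Multipliers m of t bring tm into L, and for z in L
  the element (tm)z of L kills L by \<open>jordan_kills_twice\<close>. Faithfulness in R, applied
  twice, gives tm = 0, and \<open>P_annihilator_free\<close> gives t = 0.\<close>

lemma PA_faithful: "ideals_faithful C PA"
  unfolding ideals_faithful_def
proof (intro allI impI, elim conjE)
  fix K t assume K: "algebra_ideal C PA K" and t: "t \<in> K" and "\<forall>k \<in> K. t \<otimes>\<^bsub>PA\<^esub> k = \<zero>\<^bsub>PA\<^esub>"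
  note KD = PA.algebra_idealD[OF K, unfolded PA_simps]
  have KP: "k \<in> P" if "k \<in> K" for k using KD(1) that by auto
  have tK: "t \<star> k = \<zero>" if "k \<in> K" for k
    using \<open>\<forall>k \<in> K. _\<close> that KP t by (simp add: PA_mult)
  have Kmult: "k \<star> p \<in> K" "p \<star> k \<in> K" if "k \<in> K" "p \<in> P" for k p
    using KD(6,7)[OF that] KP[OF that(1)] that(2) by (simp_all add: PA_mult)
  define L where "L = {x \<in> carrier R. e x \<in> K}"
  have L: "algebra_ideal F R L"
  proof (rule algebra_idealI)
    show "c \<odot>\<^bsub>R\<^esub> x \<in> L" if "c \<in> carrier F" "x \<in> L" for c x
    proof -
      have "restrict (\<lambda>p. scalar_op R c \<odot> p) P (e x) \<in> K"
        using KD(5)[OF scalar_in_C[OF that(1)], of "e x"] that by (simp add: L_def)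
      then show ?thesis using that by (simp add: L_def scalar_act)
    qed
    show "a \<otimes>\<^bsub>R\<^esub> x \<in> L" "x \<otimes>\<^bsub>R\<^esub> a \<in> L" if "a \<in> L" "x \<in> carrier R" for a x
      using Kmult[of "e a" "e x"] that by (auto simp: L_def pmult_e_e mult_closed)
  qed (use KD in \<open>auto simp: L_def e_add\<close>)
  obtain M where M: "essential_ideal M" "\<And>k. k \<in> M \<Longrightarrow> k \<triangleright> t \<in> e ` carrier R"
    using multipliers[OF KP[OF t]] by blast
  show "t = \<zero>\<^bsub>PA\<^esub>" unfolding PA_simps
  proof (rule P_annihilator_free[OF M(1) KP[OF t]])
    fix m assume m: "m \<in> M"
    then have mc: "m \<in> carrier R" using essential_ideal_subset[OF M(1)] by auto
    obtain s where s: "s \<in> carrier R" "t \<star> e m = e s"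
      using M(2)[OF m] KP[OF t] mc by (auto simp: pmult_e)
    have sL: "s \<in> L" using s Kmult(1)[OF t, of "e m"] mc by (simp add: L_def)
    have "s = \<zero>\<^bsub>R\<^esub>"
    proof (rule ideals_faithfulD[OF faithful L sL])
      fix z assume z: "z \<in> L"
      then have zc: "z \<in> carrier R" "e z \<in> K" by (auto simp: L_def)
      show "s \<otimes>\<^bsub>R\<^esub> z = \<zero>\<^bsub>R\<^esub>"
      proof (rule ideals_faithfulD[OF faithful L])
        show "s \<otimes>\<^bsub>R\<^esub> z \<in> L" by (rule algebra_idealD(6)[OF L sL zc(1)])
        fix z' assume z': "z' \<in> L"
        then have zc': "z' \<in> carrier R" "e z' \<in> K" by (auto simp: L_def)
        have "e ((s \<otimes>\<^bsub>R\<^esub> z) \<otimes>\<^bsub>R\<^esub> z') = ((t \<star> e m) \<star> e z) \<star> e z'"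
          using s zc zc' by (simp add: pmult_e_e mult_closed)
        also have "\<dots> = \<zero>"
          using PA_jordan_kills_twice[of t "e m" "e z" "e z'"] KP[OF t] mc zc zc' tK Kmult
          by (simp add: PA_mult)
        finally show "(s \<otimes>\<^bsub>R\<^esub> z) \<otimes>\<^bsub>R\<^esub> z' = \<zero>\<^bsub>R\<^esub>"
          using s zc zc' by (simp add: e_eq_zero_iff mult_closed)
      qed
    qed
    then show "t \<star> e m = \<zero>" using s by simp
  qed
qed

text \<open>The trace of such a submodule on R is an ideal of square zero, so faithfulness makes it
  zero.\<close>

lemma square_zero_submodule:
  assumes N: "submodule N S I" "N \<subseteq> P" and sq: "\<And>p q. \<lbrakk>p \<in> N; q \<in> N\<rbrakk> \<Longrightarrow> p \<star> q = \<zero>"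
  shows "N = {\<zero>}"
proof (rule submodule_zeroI[OF N(1)])
  fix x assume x: "x \<in> carrier R" "e x \<in> N"
  show "x = \<zero>\<^bsub>R\<^esub>"
  proof (rule ideals_faithfulD[OF faithful ideal_preimage[OF N(1)]])
    show "x \<otimes>\<^bsub>R\<^esub> k = \<zero>\<^bsub>R\<^esub>" if "k \<in> {x \<in> carrier R. e x \<in> N}" for k
      using sq[of "e x" "e k"] x that by (simp add: pmult_e_e mult_closed e_eq_zero_iff)
  qed (use x in simp)
qed

text \<open>Products of elements of dP have the form d(d(pq)), so dP is a submodule of square
  zero.\<close>

lemma C_reduced:
  assumes d: "d \<in> carrier C" and dd: "\<And>p. p \<in> P \<Longrightarrow> d (d p) = \<zero>"
  shows "d = \<zero>\<^bsub>C\<^esub>"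
proof -
  have "d ` P = {\<zero>}"
  proof (rule square_zero_submodule)
    show "submodule (d ` P) S I" by (rule HP_image_submodule[OF P_submodule subset_refl C_HP[OF d]])
  qed (use d dd in \<open>auto simp: pmult_C_left pmult_C_right\<close>)
  then show ?thesis by (intro C_eqI d) (auto simp: C_simps)
qed

text \<open>The annihilator \<open>Z\<close> of \<open>X\<close> in \<open>C\<close> splits off: the elements killed
  by \<open>Z\<close> meet \<open>ZP\<close> in a square-zero submodule, and the projection of their sum onto the first
  summand extends to \<open>I\<close> by injectivity.\<close>

lemma support_exists:
  assumes X: "X \<subseteq> P"
  shows "\<exists>\<epsilon> \<in> idempotents C. (\<forall>x \<in> X. \<epsilon> x = x) \<and>
    (\<forall>\<alpha> \<in> carrier C. (\<forall>x \<in> X. \<alpha> x = \<zero>) \<longrightarrow> \<alpha> \<otimes>\<^bsub>C\<^esub> \<epsilon> = \<zero>\<^bsub>C\<^esub>)"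
proof -
  define Z where "Z = {\<alpha> \<in> carrier C. \<forall>x \<in> X. \<alpha> x = \<zero>}"
  define N where "N = {p \<in> P. \<forall>\<alpha> \<in> Z. \<alpha> p = \<zero>}"
  define G where "G = {\<alpha> p | \<alpha> p. \<alpha> \<in> Z \<and> p \<in> P}"
  define U where "U = generate (add_monoid I) G"
  have ZC: "\<alpha> \<in> carrier C" if "\<alpha> \<in> Z" for \<alpha> using that by (simp add: Z_def)
  have NP: "n \<in> P" if "n \<in> N" for n using that by (simp add: N_def)
  have N: "submodule N S I"
    by (rule M.right_submoduleI) (auto simp: N_def ZC CD)
  have Uind: "Q u" if "u \<in> U" and G: "\<And>\<alpha> p. \<lbrakk>\<alpha> \<in> Z; p \<in> P\<rbrakk> \<Longrightarrow> Q (\<alpha> p)"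
    and add: "\<And>u v. \<lbrakk>u \<in> U; v \<in> U; Q u; Q v\<rbrakk> \<Longrightarrow> Q (u \<oplus> v)" for Q u
    using that(1) unfolding U_def
  proof induction
    case one
    have "\<zero>\<^bsub>C\<^esub> \<in> Z" using X by (auto simp: Z_def C_closed_ops C_simps)
    from G[OF this P_zero] show ?case by (simp add: C_simps)
  next
    case (incl h)
    then show ?case using G by (auto simp: G_def)
  next
    case (inv h)
    then obtain \<alpha> p where h: "\<alpha> \<in> Z" "p \<in> P" "h = \<alpha> p" by (auto simp: G_def)
    have "\<alpha> (\<ominus> p) \<oplus> \<alpha> p = \<zero>"
      using CD(2)[OF ZC[OF h(1)], of "\<ominus> p" p] h ZC by (simp add: M.M.l_neg)
    then have "\<ominus> \<alpha> p = \<alpha> (\<ominus> p)" using h ZC by (simp add: M.M.minus_equality)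
    then show ?case using G[OF h(1) P_minus[OF h(2)]] h by (simp add: a_inv_def)
  next
    case (eng u v)
    then show ?case using add[of u v] by (simp add: U_def)
  qed
  have UP: "u \<in> P" if "u \<in> U" for u using that by (rule Uind) (auto simp: ZC)
  have GU: "\<alpha> p \<in> U" if "\<alpha> \<in> Z" "p \<in> P" for \<alpha> p
    unfolding U_def by (rule generate.incl) (use that in \<open>auto simp: G_def\<close>)
  have Uadd: "u \<oplus> v \<in> U" if "u \<in> U" "v \<in> U" for u v
    using that unfolding U_def using generate.eng[of u "add_monoid I" _ v] by simp
  have U: "submodule U S I"
  proof (rule M.right_submoduleI)
    show "\<zero> \<in> U" unfolding U_def using generate.one[of "add_monoid I"] by simp
    show "s \<odot> u \<in> U" if s: "s \<in> carrier S" and "u \<in> U" for s u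
      using that(2)
    proof (rule Uind)
      show "s \<odot> \<alpha> p \<in> U" if "\<alpha> \<in> Z" "p \<in> P" for \<alpha> p
        using GU[OF that(1), of "s \<odot> p"] that s by (simp add: CD ZC)
      show "s \<odot> (u \<oplus> v) \<in> U" if "u \<in> U" "v \<in> U" "s \<odot> u \<in> U" "s \<odot> v \<in> U" for u v
        using that s UP by (simp add: M.act_add Uadd)
    qed
  qed (use UP Uadd in auto)
  have UN: "u \<star> n = \<zero>" if "u \<in> U" "n \<in> N" for u n
    using that(1)
  proof (rule Uind)
    show "\<alpha> p \<star> n = \<zero>" if "\<alpha> \<in> Z" "p \<in> P" for \<alpha> p
    proof -
      \<comment> \<open>Elements of CM(R) pass from one factor to the other, and those of
        \<open>Z\<close> kill \<open>N\<close>.\<close>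
      have "\<alpha> p \<star> n = p \<star> \<alpha> n"
        using that ZC NP \<open>n \<in> N\<close> by (simp add: pmult_C_left pmult_C_right)
      moreover have "\<alpha> n = \<zero>" using \<open>n \<in> N\<close> that by (simp add: N_def)
      moreover have "p \<star> \<zero> = \<zero>" using PA.mult_zero_right[of p] that by (simp add: PA_mult)
      ultimately show ?thesis by simp
    qed
  qed (use that NP UP in \<open>auto simp: pmult_add_left\<close>)
  note ND = M.right_submoduleD[OF N] and UD = M.right_submoduleD[OF U]
  have "N \<inter> U = {\<zero>}"
  proof (rule square_zero_submodule)
    show "submodule (N \<inter> U) S I" by (rule M.right_submoduleI) (use ND UD in auto)
  qed (use UN NP in auto)
  then have disj: "n = \<zero>" if "n \<in> N" "n \<in> U" for n using that by blast
  have uniq: "n = n'" if "n \<in> N" "n' \<in> N" "u \<in> U" "u' \<in> U" "n \<oplus> u = n' \<oplus> u'" for n n' u u'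
  proof -
    have c: "n \<in> carrier I" "n' \<in> carrier I" "u \<in> carrier I" "u' \<in> carrier I" using that NP UP by auto
    have "n \<ominus> n' = ((n \<oplus> u) \<ominus> u) \<ominus> n'" using c by (simp add: M.M.minus_eq M.M.a_assoc M.M.r_neg)
    also have "\<dots> = (n' \<oplus> \<ominus> n') \<oplus> (u' \<ominus> u)"
      unfolding that(5) using c by (simp add: M.M.minus_eq M.M.a_ac)
    also have "\<dots> = u' \<ominus> u" using c by (simp add: M.M.r_neg)
    finally have "n \<ominus> n' \<in> U" using that UD by (simp add: M.M.minus_eq)
    moreover have "n \<ominus> n' \<in> N" using that ND by (simp add: M.M.minus_eq)
    ultimately show ?thesis using disj c by (simp flip: M.M.eq_iff_minus_zero)
  qed
  define K where "K = {n \<oplus> u | n u. n \<in> N \<and> u \<in> U}"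
  define f where "f v = (THE n. n \<in> N \<and> (\<exists>u \<in> U. v = n \<oplus> u))" for v
  have f: "f (n \<oplus> u) = n" if "n \<in> N" "u \<in> U" for n u
    unfolding f_def by (rule the_equality) (use that uniq in blast)+
  have Kadd: "(n \<oplus> u) \<oplus> (n' \<oplus> u') = (n \<oplus> n') \<oplus> (u \<oplus> u')"
    if "n \<in> N" "n' \<in> N" "u \<in> U" "u' \<in> U" for n n' u u'
    using that NP UP by (simp add: M.M.a_ac)
  have Kact: "s \<odot> (n \<oplus> u) = s \<odot> n \<oplus> s \<odot> u" if "n \<in> N" "u \<in> U" "s \<in> carrier S" for s n u
    using that NP UP by (simp add: M.act_add)
  have K: "submodule K S I"
  proof (rule M.right_submoduleI)
    show "\<zero> \<in> K" unfolding K_def using ND(2) UD(2) by force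
    show "x \<oplus> y \<in> K" if "x \<in> K" "y \<in> K" for x y
      using that Kadd ND(3) UD(3) unfolding K_def by fastforce
    show "s \<odot> x \<in> K" if "s \<in> carrier S" "x \<in> K" for s x
      using that Kact ND(4) UD(4) unfolding K_def by fastforce
  qed (use NP UP in \<open>auto simp: K_def\<close>)
  have "f \<in> rmod_hom S (I\<lparr>carrier := K\<rparr>) I"
    by (rule rmod_homI) (use ND UD NP in \<open>auto simp: K_def f Kadd Kact\<close>)
  then obtain h where h: "h \<in> rmod_hom S I I" "\<And>x. x \<in> K \<Longrightarrow> h x = f x"
    using hom_extends[OF K] by blast
  define \<epsilon> where "\<epsilon> = restrict h P"
  have \<epsilon>: "\<epsilon> \<in> carrier C" unfolding \<epsilon>_def by (rule restrict_in_C[OF hom_in_HP[OF h(1)]])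
  have \<epsilon>N: "\<epsilon> n = n" if n: "n \<in> N" for n
  proof -
    have "n = n \<oplus> \<zero>" using NP[OF n] by simp
    then have "n \<in> K" unfolding K_def using n UD(2) by blast
    then show ?thesis using h(2) f[OF n UD(2)] NP[OF n] by (simp add: \<epsilon>_def)
  qed
  have \<epsilon>U: "\<epsilon> u = \<zero>" if u: "u \<in> U" for u
  proof -
    have "u = \<zero> \<oplus> u" using UP[OF u] by simp
    then have "u \<in> K" unfolding K_def using u ND(2) by blast
    then show ?thesis using h(2) f[OF ND(2) u] UP[OF u] by (simp add: \<epsilon>_def)
  qed
  have XN: "X \<subseteq> N" using X by (auto simp: N_def Z_def)
  have \<epsilon>Z: "\<alpha> \<otimes>\<^bsub>C\<^esub> \<epsilon> = \<zero>\<^bsub>C\<^esub>" if "\<alpha> \<in> Z" for \<alpha>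
    by (rule C_eqI) (use that ZC \<epsilon> GU \<epsilon>U in \<open>auto simp: C_closed_ops C_simps C_commute[of \<alpha>]\<close>)
  \<comment> \<open>The extension of the projection is idempotent on \<open>K\<close>, but not
    evidently on P. Its defect \<open>?d\<close> kills X, hence belongs to \<open>Z\<close> and has
    product zero with \<epsilon>. Since \<open>?d\<close> + \<epsilon> is the square of \<epsilon>,
    multiplying by \<open>?d\<close> shows that \<open>?d\<close> has square zero, and CM(R) is
    reduced.\<close>
  let ?d = "(\<epsilon> \<otimes>\<^bsub>C\<^esub> \<epsilon>) \<ominus>\<^bsub>C\<^esub> \<epsilon>"
  have d: "?d \<in> carrier C" using \<epsilon> by simp
  have plus: "?d \<oplus>\<^bsub>C\<^esub> \<epsilon> = \<epsilon> \<otimes>\<^bsub>C\<^esub> \<epsilon>" using \<epsilon> by (simp add: CC.minus_eq CC.a_assoc CC.l_neg)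
  have d_app: "?d p \<oplus> \<epsilon> p = \<epsilon> (\<epsilon> p)" if "p \<in> P" for p
    using C_simps(2)[OF d \<epsilon> that] that \<epsilon> by (simp add: plus C_simps)
  have dX: "?d x = \<zero>" if "x \<in> X" for x
  proof -
    have "x \<in> P" "x \<in> N" using that X XN by blast+
    then have "?d x \<oplus> x = x" using d_app[of x] \<epsilon>N[of x] by simp
    moreover have "?d x \<in> carrier I" "x \<in> carrier I" using d \<open>x \<in> P\<close> by auto
    ultimately show ?thesis using M.M.add.r_cancel_one'[of x "?d x"] by simp
  qed
  then have d\<epsilon>: "?d \<otimes>\<^bsub>C\<^esub> \<epsilon> = \<zero>\<^bsub>C\<^esub>" using d by (intro \<epsilon>Z) (simp add: Z_def)
  have "?d \<otimes>\<^bsub>C\<^esub> ?d \<oplus>\<^bsub>C\<^esub> ?d \<otimes>\<^bsub>C\<^esub> \<epsilon> = (?d \<otimes>\<^bsub>C\<^esub> \<epsilon>) \<otimes>\<^bsub>C\<^esub> \<epsilon>"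
    unfolding CC.m_assoc[OF d \<epsilon> \<epsilon>] by (simp only: CC.r_distr[OF d \<epsilon> d, symmetric] plus)
  then have "?d \<otimes>\<^bsub>C\<^esub> ?d = \<zero>\<^bsub>C\<^esub>" unfolding d\<epsilon> using CC.m_closed[OF d d] \<epsilon> by simp
  then have "?d (?d p) = \<zero>" if "p \<in> P" for p
    using C_simps(1)[OF d d that] C_simps(4)[OF that] by simp
  then have "?d = \<zero>\<^bsub>C\<^esub>" by (rule C_reduced[OF d])
  then have "\<epsilon> \<in> idempotents C" using \<epsilon> plus by (simp add: idempotents_def)
  then show ?thesis
    using \<epsilon>N XN \<epsilon>Z by (intro bexI[of _ \<epsilon>]) (auto simp: Z_def)
qed

end

section \<open>Gluing in a maximal algebra of quotients\<close>

locale scalar_cring = cring R for R :: "'c ring" (structure)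
begin

lemma idempotents_closed: "\<xi> \<in> idempotents R \<Longrightarrow> \<xi> \<in> carrier R"
  and idempotents_square: "\<xi> \<in> idempotents R \<Longrightarrow> \<xi> \<otimes> \<xi> = \<xi>"
  by (auto simp: idempotents_def)

lemma idempotents_mult:
  assumes "\<xi> \<in> idempotents R" "\<chi> \<in> idempotents R"
  shows "\<xi> \<otimes> \<chi> \<in> idempotents R"
proof -
  have c: "\<xi> \<in> carrier R" "\<chi> \<in> carrier R" using assms by (auto simp: idempotents_def)
  then have "(\<xi> \<otimes> \<chi>) \<otimes> (\<xi> \<otimes> \<chi>) = (\<xi> \<otimes> \<xi>) \<otimes> (\<chi> \<otimes> \<chi>)" by (simp add: m_ac)
  then show ?thesis using assms c by (simp add: idempotents_def)
qed

lemma idempotents_one: "\<one> \<in> idempotents R" and idempotents_zero: "\<zero> \<in> idempotents R"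
  by (simp_all add: idempotents_def)

lemma dense_orthogonalD:
  assumes "dense_orthogonal R D"
  shows "\<xi> \<in> D \<Longrightarrow> \<xi> \<in> idempotents R" "\<xi> \<in> D \<Longrightarrow> \<xi> \<in> carrier R" "\<xi> \<in> D \<Longrightarrow> \<xi> \<otimes> \<xi> = \<xi>"
    and "\<lbrakk>\<xi> \<in> D; \<chi> \<in> D; \<xi> \<noteq> \<chi>\<rbrakk> \<Longrightarrow> \<xi> \<otimes> \<chi> = \<zero>"
    and "\<lbrakk>\<beta> \<in> idempotents R; \<And>\<xi>. \<xi> \<in> D \<Longrightarrow> \<beta> \<otimes> \<xi> = \<zero>\<rbrakk> \<Longrightarrow> \<beta> = \<zero>"
  using assms unfolding dense_orthogonal_def idempotents_def by auto

lemma dense_orthogonalI: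
  assumes "D \<subseteq> idempotents R"
    and "\<And>\<xi> \<chi>. \<lbrakk>\<xi> \<in> D; \<chi> \<in> D; \<xi> \<noteq> \<chi>\<rbrakk> \<Longrightarrow> \<xi> \<otimes> \<chi> = \<zero>"
    and "\<And>\<beta>. \<lbrakk>\<beta> \<in> idempotents R; \<And>\<xi>. \<xi> \<in> D \<Longrightarrow> \<beta> \<otimes> \<xi> = \<zero>\<rbrakk> \<Longrightarrow> \<beta> = \<zero>"
  shows "dense_orthogonal R D"
proof -
  have "\<zero> \<otimes> \<xi> = \<zero>" if "\<xi> \<in> D" for \<xi> using assms(1) that by (auto simp: idempotents_def)
  then have "{\<beta> \<in> idempotents R. \<forall>\<xi> \<in> D. \<beta> \<otimes> \<xi> = \<zero>} = {\<zero>}"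
    using assms(3) idempotents_zero by blast
  then show ?thesis using assms(1,2) unfolding dense_orthogonal_def by blast
qed

lemma dense_orthogonal_one: "dense_orthogonal R {\<one>}"
  by (rule dense_orthogonalI) (auto simp: idempotents_one idempotents_closed)

text \<open>The second set may vary with \<xi>, as required when the members of a family to be glued
  are themselves glued. For density, \<beta>\<xi> is orthogonal to \<open>E \<xi>\<close> and so
  zero, for every \<xi>.\<close>

lemma dense_orthogonal_refine:
  assumes D: "dense_orthogonal R D" and E: "\<And>\<xi>. \<xi> \<in> D \<Longrightarrow> dense_orthogonal R (E \<xi>)"
  shows "dense_orthogonal R {\<xi> \<otimes> \<eta> | \<xi> \<eta>. \<xi> \<in> D \<and> \<eta> \<in> E \<xi>}"
proof (rule dense_orthogonalI)
  show "{\<xi> \<otimes> \<eta> | \<xi> \<eta>. \<xi> \<in> D \<and> \<eta> \<in> E \<xi>} \<subseteq> idempotents R"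
    using dense_orthogonalD(1)[OF D] dense_orthogonalD(1)[OF E] idempotents_mult by blast
next
  fix \<zeta> \<zeta>' assume "\<zeta> \<in> {\<xi> \<otimes> \<eta> | \<xi> \<eta>. \<xi> \<in> D \<and> \<eta> \<in> E \<xi>}" "\<zeta>' \<in> {\<xi> \<otimes> \<eta> | \<xi> \<eta>. \<xi> \<in> D \<and> \<eta> \<in> E \<xi>}" "\<zeta> \<noteq> \<zeta>'"
  then obtain \<xi> \<eta> \<xi>' \<eta>' where *: "\<xi> \<in> D" "\<eta> \<in> E \<xi>" "\<zeta> = \<xi> \<otimes> \<eta>" "\<xi>' \<in> D" "\<eta>' \<in> E \<xi>'" "\<zeta>' = \<xi>' \<otimes> \<eta>'" by blast
  have c: "\<xi> \<in> carrier R" "\<eta> \<in> carrier R" "\<xi>' \<in> carrier R" "\<eta>' \<in> carrier R"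
    using * dense_orthogonalD(2)[OF D] dense_orthogonalD(2)[OF E] by blast+
  have "\<zeta> \<otimes> \<zeta>' = (\<xi> \<otimes> \<xi>') \<otimes> (\<eta> \<otimes> \<eta>')" using * c by (simp add: m_ac)
  moreover have "\<xi> \<otimes> \<xi>' = \<zero> \<or> \<eta> \<otimes> \<eta>' = \<zero>"
  proof (cases "\<xi> = \<xi>'")
    case True
    then have "\<eta> \<noteq> \<eta>'" using * \<open>\<zeta> \<noteq> \<zeta>'\<close> by auto
    then show ?thesis using dense_orthogonalD(4)[OF E[OF *(1)] *(2), of \<eta>'] * True by simp
  qed (use dense_orthogonalD(4)[OF D] * in blast)
  ultimately show "\<zeta> \<otimes> \<zeta>' = \<zero>" using c by auto
next
  fix \<beta> assume \<beta>: "\<beta> \<in> idempotents R" "\<And>\<zeta>. \<zeta> \<in> {\<xi> \<otimes> \<eta> | \<xi> \<eta>. \<xi> \<in> D \<and> \<eta> \<in> E \<xi>} \<Longrightarrow> \<beta> \<otimes> \<zeta> = \<zero>"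
  note \<beta>c = idempotents_closed[OF \<beta>(1)]
  have "\<beta> \<otimes> \<xi> = \<zero>" if \<xi>: "\<xi> \<in> D" for \<xi>
  proof (rule dense_orthogonalD(5)[OF E[OF \<xi>]])
    show "\<beta> \<otimes> \<xi> \<in> idempotents R" using \<beta>(1) dense_orthogonalD(1)[OF D \<xi>] by (rule idempotents_mult)
    show "(\<beta> \<otimes> \<xi>) \<otimes> \<eta> = \<zero>" if \<eta>: "\<eta> \<in> E \<xi>" for \<eta>
      using \<beta>(2)[of "\<xi> \<otimes> \<eta>"] \<xi> \<eta> \<beta>c dense_orthogonalD(2)[OF D \<xi>] dense_orthogonalD(2)[OF E[OF \<xi>] \<eta>]
      by (auto simp: m_assoc)
  qed
  then show "\<beta> = \<zero>" by (rule dense_orthogonalD(5)[OF D \<beta>(1)])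
qed

end

lemma (in abelian_group) generate_add_induct [consumes 1, case_names zero incl add]:
  assumes "u \<in> generate (add_monoid G) X" and X: "X \<subseteq> carrier G" "\<And>x. x \<in> X \<Longrightarrow> \<ominus> x \<in> X"
    and "Q \<zero>" and incl: "\<And>x. x \<in> X \<Longrightarrow> Q x"
    and add: "\<And>u v. \<lbrakk>u \<in> generate (add_monoid G) X; v \<in> generate (add_monoid G) X; Q u; Q v\<rbrakk> \<Longrightarrow> Q (u \<oplus> v)"
  shows "Q u"
  using assms(1)
proof induction
  case (inv h)
  then show ?case using X incl by (simp add: a_inv_def)
qed (use assms in auto)

text \<open>For a dense orthogonal \<open>D\<close> this is again an algebra of quotients, so its families are glued in a
  maximal \<open>Q\<close>.\<close>

definition family_algebra :: "('c, 'q) module \<Rightarrow> 'c set \<Rightarrow> ('c, 'c \<Rightarrow> 'q) module" where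
  "family_algebra Q D =
     \<lparr>carrier = {w \<in> D \<rightarrow>\<^sub>E carrier Q. \<forall>\<xi> \<in> D. \<xi> \<odot>\<^bsub>Q\<^esub> w \<xi> = w \<xi>},
      mult = (\<lambda>v w. \<lambda>\<xi> \<in> D. v \<xi> \<otimes>\<^bsub>Q\<^esub> w \<xi>), one = undefined,
      zero = (\<lambda>\<xi> \<in> D. \<zero>\<^bsub>Q\<^esub>), add = (\<lambda>v w. \<lambda>\<xi> \<in> D. v \<xi> \<oplus>\<^bsub>Q\<^esub> w \<xi>),
      smult = (\<lambda>c w. \<lambda>\<xi> \<in> D. c \<odot>\<^bsub>Q\<^esub> w \<xi>)\<rparr>"

lemma family_algebra_eqI:
  assumes "v \<in> carrier (family_algebra Q D)" "w \<in> carrier (family_algebra Q D)"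
    and "\<And>\<xi>. \<xi> \<in> D \<Longrightarrow> v \<xi> = w \<xi>"
  shows "v = w"
  using assms by (intro PiE_ext[of v D "\<lambda>_. carrier Q" w]) (auto simp: family_algebra_def)

lemma family_algebra_simps:
  "v \<otimes>\<^bsub>family_algebra Q D\<^esub> w = (\<lambda>\<xi> \<in> D. v \<xi> \<otimes>\<^bsub>Q\<^esub> w \<xi>)"
  "\<zero>\<^bsub>family_algebra Q D\<^esub> = (\<lambda>\<xi> \<in> D. \<zero>\<^bsub>Q\<^esub>)"
  "v \<oplus>\<^bsub>family_algebra Q D\<^esub> w = (\<lambda>\<xi> \<in> D. v \<xi> \<oplus>\<^bsub>Q\<^esub> w \<xi>)"
  "c \<odot>\<^bsub>family_algebra Q D\<^esub> w = (\<lambda>\<xi> \<in> D. c \<odot>\<^bsub>Q\<^esub> w \<xi>)"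
  by (simp_all add: family_algebra_def)

lemma in_family_algebra:
  "restrict w D \<in> carrier (family_algebra Q D) \<longleftrightarrow> (\<forall>\<xi> \<in> D. w \<xi> \<in> carrier Q \<and> \<xi> \<odot>\<^bsub>Q\<^esub> w \<xi> = w \<xi>)"
  by (auto simp: family_algebra_def)

lemma family_algebraD:
  assumes "w \<in> carrier (family_algebra Q D)" "\<xi> \<in> D"
  shows "w \<xi> \<in> carrier Q" "\<xi> \<odot>\<^bsub>Q\<^esub> w \<xi> = w \<xi>"
  using assms by (auto simp: family_algebra_def)

lemma (in jordan_algebra) family_algebra_jordan:
  assumes D: "D \<subseteq> idempotents F"
  shows "jordan_algebra F (family_algebra A D)"
proof -
  let ?W = "family_algebra A D"
  have Dc: "\<xi> \<in> carrier F" if "\<xi> \<in> D" for \<xi> using D that by (auto simp: idempotents_def)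
  note WD = family_algebraD[of _ A D]
  have sw: "\<xi> \<odot>\<^bsub>A\<^esub> (c \<odot>\<^bsub>A\<^esub> w \<xi>) = c \<odot>\<^bsub>A\<^esub> w \<xi>" if "w \<in> carrier ?W" "\<xi> \<in> D" "c \<in> carrier F" for c \<xi> w
  proof -
    have "\<xi> \<odot>\<^bsub>A\<^esub> (c \<odot>\<^bsub>A\<^esub> w \<xi>) = c \<odot>\<^bsub>A\<^esub> (\<xi> \<odot>\<^bsub>A\<^esub> w \<xi>)"
      using smult_assoc1[of \<xi> c "w \<xi>"] smult_assoc1[of c \<xi> "w \<xi>"] R.m_comm[of \<xi> c]
        that(3) Dc[OF that(2)] WD(1)[OF that(1,2)] by simp
    then show ?thesis using that WD by simp
  qed
  have closed: "v \<otimes>\<^bsub>?W\<^esub> w \<in> carrier ?W" "v \<oplus>\<^bsub>?W\<^esub> w \<in> carrier ?W"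
    if "v \<in> carrier ?W" "w \<in> carrier ?W" for v w
    using that WD Dc
    by (auto simp: family_algebra_simps in_family_algebra mult_closed smult_r_distr simp flip: mult_smult_left)
  have closed': "c \<odot>\<^bsub>?W\<^esub> w \<in> carrier ?W" if "c \<in> carrier F" "w \<in> carrier ?W" for c w
    using that WD Dc sw by (auto simp: family_algebra_simps in_family_algebra)
  have zero: "\<zero>\<^bsub>?W\<^esub> \<in> carrier ?W" using Dc by (auto simp: family_algebra_simps in_family_algebra)
  have neg: "\<exists>y \<in> carrier ?W. y \<oplus>\<^bsub>?W\<^esub> x = \<zero>\<^bsub>?W\<^esub>" if x: "x \<in> carrier ?W" for x
  proof (rule bexI[of _ "(\<ominus>\<^bsub>F\<^esub> \<one>\<^bsub>F\<^esub>) \<odot>\<^bsub>?W\<^esub> x"])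
    show "((\<ominus>\<^bsub>F\<^esub> \<one>\<^bsub>F\<^esub>) \<odot>\<^bsub>?W\<^esub> x) \<oplus>\<^bsub>?W\<^esub> x = \<zero>\<^bsub>?W\<^esub>"
      unfolding family_algebra_simps
      by (intro restrict_ext) (use x WD in \<open>simp add: M.l_neg flip: minus_eq_smult\<close>)
  qed (use x closed' in auto)
  have ab: "abelian_group ?W"
  proof (rule abelian_groupI)
    show "\<zero>\<^bsub>?W\<^esub> \<oplus>\<^bsub>?W\<^esub> x = x" if "x \<in> carrier ?W" for x
      by (rule family_algebra_eqI[OF closed(2)[OF zero that] that])
        (use that WD in \<open>simp add: family_algebra_simps\<close>)
    show "x \<oplus>\<^bsub>?W\<^esub> y \<oplus>\<^bsub>?W\<^esub> z = x \<oplus>\<^bsub>?W\<^esub> (y \<oplus>\<^bsub>?W\<^esub> z)"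
      if "x \<in> carrier ?W" "y \<in> carrier ?W" "z \<in> carrier ?W" for x y z
      using that unfolding family_algebra_simps
      by (auto intro!: restrict_ext simp: WD M.a_ac)
    show "x \<oplus>\<^bsub>?W\<^esub> y = y \<oplus>\<^bsub>?W\<^esub> x" if "x \<in> carrier ?W" "y \<in> carrier ?W" for x y
      using that unfolding family_algebra_simps
      by (auto intro!: restrict_ext simp: WD M.a_ac)
  qed (use closed zero neg in auto)
  have mod: "module F ?W"
  proof (rule moduleI[OF is_cring ab])
    show "c \<odot>\<^bsub>?W\<^esub> x \<in> carrier ?W" if "c \<in> carrier F" "x \<in> carrier ?W" for c x
      using that by (rule closed')
    show "\<one>\<^bsub>F\<^esub> \<odot>\<^bsub>?W\<^esub> x = x" if "x \<in> carrier ?W" for x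
      by (rule family_algebra_eqI[OF closed'[OF R.one_closed that] that])
        (use that WD in \<open>simp add: family_algebra_simps\<close>)
  qed (auto intro!: restrict_ext simp: family_algebra_simps WD smult_l_distr smult_r_distr smult_assoc1)
  show ?thesis
    by (intro jordan_algebra.intro nonassoc_algebra.intro jordan_algebra_axioms.intro
        nonassoc_algebra_axioms.intro mod six_unit closed)
      (auto intro!: restrict_ext simp: family_algebra_simps WD mult_closed mult_add_left mult_add_right
        mult_smult_left mult_smult_right jordan_identity mult_comm[of "_ \<xi>" "_ \<xi>" for \<xi>])
qed

text \<open>From here on R no longer occurs. Faithfulness of ideals and the existence of supports
  are kept of P(R) and CM(R); \<open>support\<close> carries what the injectivity of I(R) provided,
  and \<open>embedded\<close> ties the scalars of Q to those of J, where orthogonal completions are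
  formed.\<close>

locale supported_quotient = M_quotient_algebra C A Q j + H: mult_hull C A J j
  for C :: "'c ring" and A :: "('c, 'a) module" and Q :: "('c, 'v) module" (structure)
    and J :: "('a \<Rightarrow> 'a, 'v) module" and j :: "'a \<Rightarrow> 'v" +
  assumes faithful: "ideals_faithful C A"
    and maximal: "maximal_M_quotients C A Q j"
    and embedded: "embedded_in_hull C A J j Q"
    and support: "X \<subseteq> carrier A \<Longrightarrow> \<exists>\<epsilon> \<in> idempotents C. (\<forall>x \<in> X. \<epsilon> \<odot>\<^bsub>A\<^esub> x = x) \<and>
      (\<forall>\<alpha> \<in> carrier C. (\<forall>x \<in> X. \<alpha> \<odot>\<^bsub>A\<^esub> x = \<zero>\<^bsub>A\<^esub>) \<longrightarrow> \<alpha> \<otimes>\<^bsub>C\<^esub> \<epsilon> = \<zero>\<^bsub>C\<^esub>)"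
begin

abbreviation V where "V \<equiv> scalar_module A J"

sublocale B: scalar_cring C
  by (rule scalar_cring.intro[OF A.R.is_cring])

lemmas idem = B.dense_orthogonalD
lemmas idem_closed = B.idempotents_closed

lemma smult_commute:
  "\<lbrakk>\<xi> \<in> carrier C; \<chi> \<in> carrier C; q \<in> carrier Q\<rbrakk> \<Longrightarrow> \<xi> \<odot> (\<chi> \<odot> q) = \<chi> \<odot> (\<xi> \<odot> q)"
  by (simp add: A.R.m_comm flip: Q.smult_assoc1)

lemma Q_sub: "q \<in> carrier Q \<Longrightarrow> q \<in> carrier J"
  using embedded H.M.right_submoduleD(1) by (auto simp: embedded_in_hull_def)

lemma Q_smult: "\<lbrakk>c \<in> carrier C; q \<in> carrier Q\<rbrakk> \<Longrightarrow> scalar_op A c \<odot>\<^bsub>J\<^esub> q = c \<odot> q"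
  using embedded by (auto simp: embedded_in_hull_def)

lemma Q_zero: "\<zero>\<^bsub>J\<^esub> = \<zero>"
  using H.e_zero e_zero by simp

lemma V_simps [simp]: "carrier V = carrier J" "\<zero>\<^bsub>V\<^esub> = \<zero>\<^bsub>J\<^esub>"
  and V_smult [simp]: "\<lbrakk>c \<in> carrier C; q \<in> carrier Q\<rbrakk> \<Longrightarrow> c \<odot>\<^bsub>V\<^esub> q = c \<odot> q"
  by (simp_all add: scalar_module_def Q_smult)

text \<open>The support of p is orthogonal to D, hence zero by density.\<close>

lemma separates_A:
  assumes D: "dense_orthogonal C D" and p: "p \<in> carrier A" and Dp: "\<And>\<xi>. \<xi> \<in> D \<Longrightarrow> \<xi> \<odot>\<^bsub>A\<^esub> p = \<zero>\<^bsub>A\<^esub>"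
  shows "p = \<zero>\<^bsub>A\<^esub>"
proof -
  obtain \<epsilon> where \<epsilon>: "\<epsilon> \<in> idempotents C" "\<epsilon> \<odot>\<^bsub>A\<^esub> p = p"
    "\<And>\<alpha>. \<lbrakk>\<alpha> \<in> carrier C; \<alpha> \<odot>\<^bsub>A\<^esub> p = \<zero>\<^bsub>A\<^esub>\<rbrakk> \<Longrightarrow> \<alpha> \<otimes>\<^bsub>C\<^esub> \<epsilon> = \<zero>\<^bsub>C\<^esub>"
    using support[of "{p}"] p by auto
  have "\<epsilon> = \<zero>\<^bsub>C\<^esub>"
  proof (rule idem(5)[OF D \<epsilon>(1)])
    show "\<epsilon> \<otimes>\<^bsub>C\<^esub> \<xi> = \<zero>\<^bsub>C\<^esub>" if "\<xi> \<in> D" for \<xi>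
      using \<epsilon>(3)[OF idem(2)[OF D that] Dp[OF that]] idem(2)[OF D that] idem_closed[OF \<epsilon>(1)]
      by (simp add: A.R.m_comm)
  qed
  then show ?thesis using \<epsilon>(2) p by simp
qed

text \<open>The elements killed by D form a submodule, as scalars commute with M(A)'. Its trace on A
  is zero by \<open>separates_A\<close>, so it is zero by essentiality. This is the uniqueness of
  orthogonal sums in all of J.\<close>

lemma separates_J:
  assumes D: "dense_orthogonal C D" and x: "x \<in> carrier J"
    and Dx: "\<And>\<xi>. \<xi> \<in> D \<Longrightarrow> scalar_op A \<xi> \<odot>\<^bsub>J\<^esub> x = \<zero>\<^bsub>J\<^esub>"
  shows "x = \<zero>\<^bsub>J\<^esub>"
proof -
  define N where "N = {x \<in> carrier J. \<forall>\<xi> \<in> D. scalar_op A \<xi> \<odot>\<^bsub>J\<^esub> x = \<zero>\<^bsub>J\<^esub>}"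
  note Dop = A.scalar_op_in_mult_ring[OF idem(2)[OF D]]
  have N: "submodule N H.S J"
    by (rule H.M.right_submoduleI)
      (auto simp: N_def Dop H.M.act_add H.scalar_act_commute[OF idem(2)[OF D]])
  have "N = {\<zero>\<^bsub>J\<^esub>}"
  proof (rule H.submodule_zeroI[OF N])
    fix p assume p: "p \<in> carrier A" "j p \<in> N"
    show "p = \<zero>\<^bsub>A\<^esub>"
    proof (rule separates_A[OF D p(1)])
      fix \<xi> assume \<xi>: "\<xi> \<in> D"
      have "j (\<xi> \<odot>\<^bsub>A\<^esub> p) = \<zero>\<^bsub>J\<^esub>"
        using p \<xi> H.scalar_act[OF idem(2)[OF D \<xi>] p(1)] by (simp add: N_def)
      then show "\<xi> \<odot>\<^bsub>A\<^esub> p = \<zero>\<^bsub>A\<^esub>" using H.e_eq_zero_iff p idem(2)[OF D \<xi>] by simp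
    qed
  qed
  then show ?thesis using x Dx by (auto simp: N_def)
qed

lemma separates:
  assumes D: "dense_orthogonal C D" and q: "q \<in> carrier Q" and Dq: "\<And>\<xi>. \<xi> \<in> D \<Longrightarrow> \<xi> \<odot> q = \<zero>"
  shows "q = \<zero>"
  using separates_J[OF D Q_sub[OF q]] Dq q idem(2)[OF D] by (simp add: Q_smult Q_zero)

lemma separates_eq:
  assumes D: "dense_orthogonal C D" and q: "q \<in> carrier Q" "q' \<in> carrier Q"
    and Dq: "\<And>\<xi>. \<xi> \<in> D \<Longrightarrow> \<xi> \<odot> q = \<xi> \<odot> q'"
  shows "q = q'"
proof -
  have "q \<ominus> q' = \<zero>"
    by (rule separates[OF D])
      (use q Dq idem(2)[OF D] in \<open>auto simp: Q.M.minus_eq Q.smult_r_distr Q.smult_r_minus Q.M.r_neg\<close>)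
  then show ?thesis using q by (simp add: Q.M.eq_iff_minus_zero)
qed

text \<open>Denominators of a family w are the finite sums of elements \<xi>k with k a denominator
  of w(\<xi>): multiplication by such an element isolates the component at \<xi> and lands in A. An
  x killing all of them satisfies (\<xi>x)k = 0 for all denominators k of w(\<xi>), so \<xi>x = 0
  for each \<xi>, and D separates.\<close>

lemma family_M_quotients:
  assumes D: "dense_orthogonal C D"
  shows "M_quotients C A (family_algebra Q D) (\<lambda>a. \<lambda>\<xi> \<in> D. \<xi> \<odot> j a)"
    and "algebra_embedding C Q (family_algebra Q D) (\<lambda>q. \<lambda>\<xi> \<in> D. \<xi> \<odot> q)"
proof -
  let ?W = "family_algebra Q D" and ?i = "\<lambda>q. \<lambda>\<xi> \<in> D. \<xi> \<odot> q"
  note Dc = idem(2)[OF D]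
  have sq: "\<xi> \<odot> (\<xi> \<odot> q) = \<xi> \<odot> q" if "\<xi> \<in> D" "q \<in> carrier Q" for \<xi> q
    using that Dc idem(3)[OF D] by (simp flip: Q.smult_assoc1)
  interpret W: jordan_algebra C ?W
    by (rule Q.family_algebra_jordan) (use idem(1)[OF D] in auto)
  have iW: "?i q \<in> carrier ?W" if "q \<in> carrier Q" for q
    using that Dc sq by (simp add: in_family_algebra)
  show i: "algebra_embedding C Q ?W ?i"
    unfolding algebra_embedding_def
  proof (intro conjI ballI inj_onI funcsetI iW)
    fix x y assume xy: "x \<in> carrier Q" "y \<in> carrier Q"
    show "?i (x \<oplus> y) = ?i x \<oplus>\<^bsub>?W\<^esub> ?i y" unfolding family_algebra_simps
      by (intro restrict_ext) (use xy Dc in \<open>simp add: Q.smult_r_distr\<close>)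
    show "?i (x \<otimes> y) = ?i x \<otimes>\<^bsub>?W\<^esub> ?i y" unfolding family_algebra_simps
      by (intro restrict_ext) (use xy Dc sq in \<open>simp add: Q.mult_smult_left Q.mult_smult_right Q.mult_closed\<close>)
    show "x = y" if "?i x = ?i y"
    proof (rule separates_eq[OF D xy])
      show "\<xi> \<odot> x = \<xi> \<odot> y" if "\<xi> \<in> D" for \<xi>
        using fun_cong[OF \<open>?i x = ?i y\<close>, of \<xi>] that by simp
    qed
  next
    fix c x assume "c \<in> carrier C" "x \<in> carrier Q"
    then show "?i (c \<odot> x) = c \<odot>\<^bsub>?W\<^esub> ?i x" unfolding family_algebra_simps
      by (intro restrict_ext) (use Dc in \<open>simp add: smult_commute\<close>)
  qed
  have i_add: "?i (x \<oplus> y) = ?i x \<oplus>\<^bsub>?W\<^esub> ?i y" if "x \<in> carrier Q" "y \<in> carrier Q" for x y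
    using i that unfolding algebra_embedding_def by blast
  show "M_quotients C A ?W (\<lambda>a. ?i (j a))"
  proof (rule M_quotientsI[OF A.jordan_algebra_axioms W.jordan_algebra_axioms])
    show "algebra_embedding C A ?W (\<lambda>a. ?i (j a))" by (rule algebra_embedding_comp[OF embedding i])
    fix w assume w: "w \<in> carrier ?W" "w \<noteq> \<zero>\<^bsub>?W\<^esub>"
    note wD = family_algebraD[OF w(1)]
    define denom where "denom \<xi> K \<longleftrightarrow> algebra_ideal C A K \<and> jordan_annihilator A K = {\<zero>\<^bsub>A\<^esub>} \<and>
        (\<forall>k \<in> K. \<exists>p \<in> carrier A. j k \<otimes> w \<xi> = j p) \<and>
        (w \<xi> \<noteq> \<zero> \<longrightarrow> (\<exists>k \<in> K. j k \<otimes> w \<xi> \<noteq> \<zero>))" for \<xi> K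
    have "\<exists>K. denom \<xi> K" if \<xi>: "\<xi> \<in> D" for \<xi>
    proof (cases "w \<xi> = \<zero>")
      \<comment> \<open>A vanishing component takes the whole algebra as denominators, so that the
        sum over all \<xi> keeps zero annihilator.\<close>
      case True
      have "x = \<zero>\<^bsub>A\<^esub>" if "x \<in> jordan_annihilator A (carrier A)" for x
        by (rule ideals_faithfulD[OF faithful A.algebra_ideal_carrier])
          (use that in \<open>auto simp: jordan_annihilator_def\<close>)
      then have "jordan_annihilator A (carrier A) = {\<zero>\<^bsub>A\<^esub>}"
        using A.algebra_idealD(2)[OF A.algebra_ideal_jordan_annihilator[OF A.algebra_ideal_carrier]] by blast
      moreover have "\<exists>p \<in> carrier A. j k \<otimes> w \<xi> = j p" if "k \<in> carrier A" for k
        using True that by (intro bexI[of _ "\<zero>\<^bsub>A\<^esub>"]) simp_all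
      ultimately have "denom \<xi> (carrier A)" using A.algebra_ideal_carrier True by (simp add: denom_def)
      then show ?thesis by (rule exI)
    next
      case False
      obtain K a where "algebra_ideal C A K" "jordan_annihilator A K = {\<zero>\<^bsub>A\<^esub>}"
        "a \<in> K" "j a \<otimes> w \<xi> \<noteq> \<zero>" "\<And>a. a \<in> K \<Longrightarrow> \<exists>p \<in> carrier A. j a \<otimes> w \<xi> = j p"
        by (rule denominators[OF wD(1)[OF \<xi>] False]) blast
      then have "denom \<xi> K" unfolding denom_def by blast
      then show ?thesis by (rule exI)
    qed
    then obtain K where "\<And>\<xi>. \<xi> \<in> D \<Longrightarrow> denom \<xi> (K \<xi>)" by metis
    then have K: "\<And>\<xi>. \<xi> \<in> D \<Longrightarrow> algebra_ideal C A (K \<xi>)"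
      "\<And>\<xi>. \<xi> \<in> D \<Longrightarrow> jordan_annihilator A (K \<xi>) = {\<zero>\<^bsub>A\<^esub>}"
      "\<And>\<xi> k. \<lbrakk>\<xi> \<in> D; k \<in> K \<xi>\<rbrakk> \<Longrightarrow> \<exists>p \<in> carrier A. j k \<otimes> w \<xi> = j p"
      "\<And>\<xi>. \<lbrakk>\<xi> \<in> D; w \<xi> \<noteq> \<zero>\<rbrakk> \<Longrightarrow> \<exists>k \<in> K \<xi>. j k \<otimes> w \<xi> \<noteq> \<zero>"
      unfolding denom_def by blast+
    note KD = A.algebra_idealD[OF K(1)]
    have Kc: "k \<in> carrier A" if "\<xi> \<in> D" "k \<in> K \<xi>" for \<xi> k using KD(1) that by blast
    define G where "G = {\<xi> \<odot>\<^bsub>A\<^esub> k | \<xi> k. \<xi> \<in> D \<and> k \<in> K \<xi>}"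
    define L where "L = generate (add_monoid A) G"
    have Gc: "G \<subseteq> carrier A" using Kc Dc by (auto simp: G_def)
    have Gneg: "\<ominus>\<^bsub>A\<^esub> x \<in> G" if x: "x \<in> G" for x
    proof -
      obtain \<xi> k where "\<xi> \<in> D" "k \<in> K \<xi>" "x = \<xi> \<odot>\<^bsub>A\<^esub> k" using x by (auto simp: G_def)
      moreover from this have "\<ominus>\<^bsub>A\<^esub> x = \<xi> \<odot>\<^bsub>A\<^esub> (\<ominus>\<^bsub>A\<^esub> k)" using Dc Kc by (simp add: A.smult_r_minus)
      ultimately show ?thesis using KD(4) by (auto simp: G_def)
    qed
    have GL: "x \<in> L" if "x \<in> G" for x using that unfolding L_def by (rule generate.incl)
    have L0: "\<zero>\<^bsub>A\<^esub> \<in> L" using generate.one[of "add_monoid A" G] by (simp add: L_def)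
    have Ladd: "x \<oplus>\<^bsub>A\<^esub> y \<in> L" if "x \<in> L" "y \<in> L" for x y
      using generate.eng[of x "add_monoid A" G y] that by (simp add: L_def)
    have Lind: "Pr u" if "u \<in> L" "Pr \<zero>\<^bsub>A\<^esub>" "\<And>\<xi> k. \<lbrakk>\<xi> \<in> D; k \<in> K \<xi>\<rbrakk> \<Longrightarrow> Pr (\<xi> \<odot>\<^bsub>A\<^esub> k)"
      "\<And>u v. \<lbrakk>u \<in> L; v \<in> L; Pr u; Pr v\<rbrakk> \<Longrightarrow> Pr (u \<oplus>\<^bsub>A\<^esub> v)" for u Pr
      using that(1) unfolding L_def
      by (rule A.M.generate_add_induct[OF _ Gc Gneg]) (use that in \<open>auto simp: G_def L_def\<close>)
    have Lc: "u \<in> carrier A" if "u \<in> L" for u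
      using that by (rule Lind) (auto simp: Dc Kc)
    have Lsm: "c \<odot>\<^bsub>A\<^esub> u \<in> L" if c: "c \<in> carrier C" and "u \<in> L" for c u
      using that(2)
    proof (rule Lind)
      fix \<xi> k assume *: "\<xi> \<in> D" "k \<in> K \<xi>"
      have "c \<odot>\<^bsub>A\<^esub> (\<xi> \<odot>\<^bsub>A\<^esub> k) = \<xi> \<odot>\<^bsub>A\<^esub> (c \<odot>\<^bsub>A\<^esub> k)"
        using c * Dc Kc by (simp add: A.R.m_comm flip: A.smult_assoc1)
      then show "c \<odot>\<^bsub>A\<^esub> (\<xi> \<odot>\<^bsub>A\<^esub> k) \<in> L" using GL KD(5)[OF *(1) c *(2)] * by (auto simp: G_def)
    qed (use c L0 Ladd Lc in \<open>auto simp: A.smult_r_distr\<close>)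
    have Lmult: "u \<otimes>\<^bsub>A\<^esub> x \<in> L" if x: "x \<in> carrier A" and "u \<in> L" for x u
      using that(2)
    proof (rule Lind)
      fix \<xi> k assume *: "\<xi> \<in> D" "k \<in> K \<xi>"
      then show "(\<xi> \<odot>\<^bsub>A\<^esub> k) \<otimes>\<^bsub>A\<^esub> x \<in> L"
        using GL KD(6)[OF *(1,2) x] x by (auto simp: G_def A.mult_smult_left Dc Kc)
    qed (use x L0 Ladd Lc in \<open>auto simp: A.mult_add_left\<close>)
    have L: "algebra_ideal C A L"
    proof (rule A.algebra_idealI)
      show "x \<otimes>\<^bsub>A\<^esub> a \<in> L" if "a \<in> L" "x \<in> carrier A" for a x
        using Lmult[OF that(2,1)] Lc that by (simp add: A.mult_comm)
    qed (use Lc L0 Ladd Lsm Lmult in auto)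
    have comp: "?i (j (\<xi> \<odot>\<^bsub>A\<^esub> k)) \<otimes>\<^bsub>?W\<^esub> w = (\<lambda>\<chi> \<in> D. \<chi> \<odot> (\<xi> \<odot> (j k \<otimes> w \<xi>)))"
      if *: "\<xi> \<in> D" "k \<in> K \<xi>" for \<xi> k
      unfolding family_algebra_simps
    proof (intro restrict_ext)
      fix \<chi> assume \<chi>: "\<chi> \<in> D"
      show "?i (j (\<xi> \<odot>\<^bsub>A\<^esub> k)) \<chi> \<otimes> w \<chi> = \<chi> \<odot> (\<xi> \<odot> (j k \<otimes> w \<xi>))"
      proof (cases "\<chi> = \<xi>")
        case True
        then show ?thesis using * Dc Kc wD(1) by (simp add: e_smult Q.mult_smult_left Q.mult_closed)
      next
        case False
        then have "(\<chi> \<otimes>\<^bsub>C\<^esub> \<xi>) \<odot> x = \<zero>" if "x \<in> carrier Q" for x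
          using idem(4)[OF D \<chi> *(1)] that by simp
        then have "\<chi> \<odot> (\<xi> \<odot> x) = \<zero>" if "x \<in> carrier Q" for x
          using that * \<chi> Dc by (simp add: Q.smult_assoc1)
        then show ?thesis using * \<chi> Dc Kc wD(1) by (simp add: e_smult Q.mult_closed)
      qed
    qed
    have "jordan_annihilator A L \<subseteq> {\<zero>\<^bsub>A\<^esub>}"
    proof
      fix x assume "x \<in> jordan_annihilator A L"
      then have x: "x \<in> carrier A" "\<And>u. u \<in> L \<Longrightarrow> x \<otimes>\<^bsub>A\<^esub> u = \<zero>\<^bsub>A\<^esub>" by (auto simp: jordan_annihilator_def)
      have "\<xi> \<odot>\<^bsub>A\<^esub> x = \<zero>\<^bsub>A\<^esub>" if \<xi>: "\<xi> \<in> D" for \<xi>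
      proof (rule A.faithful_annihilator_free[OF faithful K(1,2)[OF \<xi>]])
        fix k assume k: "k \<in> K \<xi>"
        then have "\<xi> \<odot>\<^bsub>A\<^esub> k \<in> L" using \<xi> by (intro GL) (auto simp: G_def)
        from x(2)[OF this] show "(\<xi> \<odot>\<^bsub>A\<^esub> x) \<otimes>\<^bsub>A\<^esub> k = \<zero>\<^bsub>A\<^esub>"
          using x(1) \<xi> k Dc Kc by (simp add: A.mult_smult_left A.mult_smult_right)
      qed (use x Dc \<xi> in auto)
      from separates_A[OF D x(1) this] show "x \<in> {\<zero>\<^bsub>A\<^esub>}" by simp
    qed
    then have ann: "jordan_annihilator A L = {\<zero>\<^bsub>A\<^esub>}"
      using A.algebra_idealD(2)[OF A.algebra_ideal_jordan_annihilator[OF L]] by blast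
    have img: "\<exists>p \<in> carrier A. ?i (j u) \<otimes>\<^bsub>?W\<^esub> w = ?i (j p)" if "u \<in> L" for u
      using that
    proof (rule Lind)
      have "?i \<zero> = \<zero>\<^bsub>?W\<^esub>" unfolding family_algebra_simps by (intro restrict_ext) (simp add: Dc)
      then have "?i (j \<zero>\<^bsub>A\<^esub>) \<otimes>\<^bsub>?W\<^esub> w = ?i (j \<zero>\<^bsub>A\<^esub>)" using W.mult_zero_left[OF w(1)] by simp
      then show "\<exists>p \<in> carrier A. ?i (j \<zero>\<^bsub>A\<^esub>) \<otimes>\<^bsub>?W\<^esub> w = ?i (j p)" by blast
    next
      fix \<xi> k assume *: "\<xi> \<in> D" "k \<in> K \<xi>"
      obtain p where p: "p \<in> carrier A" "j k \<otimes> w \<xi> = j p" using K(3)[OF *] by blast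
      then show "\<exists>p \<in> carrier A. ?i (j (\<xi> \<odot>\<^bsub>A\<^esub> k)) \<otimes>\<^bsub>?W\<^esub> w = ?i (j p)"
        using comp[OF *] Dc[OF *(1)] by (intro bexI[of _ "\<xi> \<odot>\<^bsub>A\<^esub> p"]) (simp_all add: e_smult)
    next
      fix u v assume uv: "u \<in> L" "v \<in> L" "\<exists>p \<in> carrier A. ?i (j u) \<otimes>\<^bsub>?W\<^esub> w = ?i (j p)"
        "\<exists>p \<in> carrier A. ?i (j v) \<otimes>\<^bsub>?W\<^esub> w = ?i (j p)"
      then obtain p p' where p: "p \<in> carrier A" "?i (j u) \<otimes>\<^bsub>?W\<^esub> w = ?i (j p)"
        "p' \<in> carrier A" "?i (j v) \<otimes>\<^bsub>?W\<^esub> w = ?i (j p')" by blast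
      have c: "j u \<in> carrier Q" "j v \<in> carrier Q" "j p \<in> carrier Q" "j p' \<in> carrier Q" using uv p Lc by auto
      have "?i (j (u \<oplus>\<^bsub>A\<^esub> v)) \<otimes>\<^bsub>?W\<^esub> w = ?i (j u) \<otimes>\<^bsub>?W\<^esub> w \<oplus>\<^bsub>?W\<^esub> ?i (j v) \<otimes>\<^bsub>?W\<^esub> w"
        unfolding e_add[OF Lc[OF uv(1)] Lc[OF uv(2)]] i_add[OF c(1,2)]
        by (rule W.mult_add_left[OF iW[OF c(1)] iW[OF c(2)] w(1)])
      also have "\<dots> = ?i (j (p \<oplus>\<^bsub>A\<^esub> p'))"
        unfolding p(2,4) e_add[OF p(1,3)] i_add[OF c(3,4)] ..
      finally show "\<exists>p \<in> carrier A. ?i (j (u \<oplus>\<^bsub>A\<^esub> v)) \<otimes>\<^bsub>?W\<^esub> w = ?i (j p)" using p by blast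
    qed
    have "\<exists>\<xi> \<in> D. w \<xi> \<noteq> \<zero>"
      using family_algebra_eqI[OF w(1) W.M.zero_closed] w(2) by (auto simp: family_algebra_simps)
    then obtain \<xi> k where \<xi>: "\<xi> \<in> D" "k \<in> K \<xi>" "j k \<otimes> w \<xi> \<noteq> \<zero>" using K(4) by blast
    have "\<xi> \<odot> (j k \<otimes> w \<xi>) = j k \<otimes> w \<xi>"
      using \<xi> Dc Kc wD by (simp flip: Q.mult_smult_right)
    then have "(?i (j (\<xi> \<odot>\<^bsub>A\<^esub> k)) \<otimes>\<^bsub>?W\<^esub> w) \<xi> \<noteq> \<zero>\<^bsub>?W\<^esub> \<xi>"
      unfolding comp[OF \<xi>(1,2)] using \<xi> by (simp add: family_algebra_simps)
    then have "?i (j (\<xi> \<odot>\<^bsub>A\<^esub> k)) \<otimes>\<^bsub>?W\<^esub> w \<noteq> \<zero>\<^bsub>?W\<^esub>" by metis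
    moreover have "\<xi> \<odot>\<^bsub>A\<^esub> k \<in> L" using \<xi> by (intro GL) (auto simp: G_def)
    ultimately show "\<exists>K. algebra_ideal C A K \<and> jordan_annihilator A K = {\<zero>\<^bsub>A\<^esub>} \<and>
        (\<exists>a \<in> K. ?i (j a) \<otimes>\<^bsub>?W\<^esub> w \<noteq> \<zero>\<^bsub>?W\<^esub>) \<and> (\<forall>a \<in> K. ?i (j a) \<otimes>\<^bsub>?W\<^esub> w \<in> (\<lambda>a. ?i (j a)) ` carrier A)"
      using L ann img by (intro exI[of _ L]) blast
  qed
qed

text \<open>The family with components \<xi>u(\<xi>) exists in the family algebra, and maximality
  supplies an embedding f back into Q over A. By orthogonality \<xi>w = \<xi>i(u(\<xi>)), where i
  embeds Q in families, and f after i is the identity of Q by \<open>embedding_over_base_id\<close>;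
  so x = f w has the required components.\<close>

theorem glue:
  assumes D: "dense_orthogonal C D" and u: "u \<in> D \<rightarrow> carrier Q"
  shows "\<exists>x \<in> carrier Q. \<forall>\<xi> \<in> D. \<xi> \<odot> x = \<xi> \<odot> u \<xi>"
proof -
  let ?W = "family_algebra Q D" and ?i = "\<lambda>q. \<lambda>\<xi> \<in> D. \<xi> \<odot> q"
  note Dc = idem(2)[OF D]
  have uc: "u \<xi> \<in> carrier Q" if "\<xi> \<in> D" for \<xi> using u that by auto
  obtain f where f: "algebra_embedding C ?W Q f" "\<And>a. a \<in> carrier A \<Longrightarrow> f (?i (j a)) = j a"
    using M_quotient_algebra.embeds_in_maximal[OF M_quotient_algebraI[OF family_M_quotients(1)[OF D]] faithful maximal]
    by blast
  note i = family_M_quotients(2)[OF D]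
  have fi: "f (?i q) = q" if "q \<in> carrier Q" for q
    by (rule embedding_over_base_id[OF faithful algebra_embedding_comp[OF i f(1)] f(2) that])
  have f_smult: "f (c \<odot>\<^bsub>?W\<^esub> w) = c \<odot> f w" if "c \<in> carrier C" "w \<in> carrier ?W" for c w
    using f(1) that unfolding algebra_embedding_def by blast
  have iW: "?i q \<in> carrier ?W" if "q \<in> carrier Q" for q
    using i that unfolding algebra_embedding_def by blast
  define w where "w = (\<lambda>\<xi> \<in> D. \<xi> \<odot> u \<xi>)"
  have w: "w \<in> carrier ?W"
    unfolding w_def in_family_algebra using Dc uc idem(3)[OF D] by (simp flip: Q.smult_assoc1)
  have "\<xi> \<odot> f w = \<xi> \<odot> u \<xi>" if \<xi>: "\<xi> \<in> D" for \<xi>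
  proof -
    have "\<xi> \<odot>\<^bsub>?W\<^esub> w = \<xi> \<odot>\<^bsub>?W\<^esub> ?i (u \<xi>)"
      unfolding family_algebra_simps w_def
    proof (intro restrict_ext)
      fix \<chi> assume \<chi>: "\<chi> \<in> D"
      show "\<xi> \<odot> (\<lambda>\<xi> \<in> D. \<xi> \<odot> u \<xi>) \<chi> = \<xi> \<odot> ?i (u \<xi>) \<chi>"
      proof (cases "\<chi> = \<xi>")
        case False
        then have "\<xi> \<odot> (\<chi> \<odot> x) = \<zero>" if "x \<in> carrier Q" for x
          using that \<xi> \<chi> Dc idem(4)[OF D \<xi> \<chi>] by (simp flip: Q.smult_assoc1)
        then show ?thesis using uc \<xi> \<chi> by simp
      qed (use \<chi> in simp)
    qed
    then show ?thesis using f_smult[OF Dc[OF \<xi>]] w iW[OF uc[OF \<xi>]] fi[OF uc[OF \<xi>]] by metis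
  qed
  moreover have "f w \<in> carrier Q" using f(1) w unfolding algebra_embedding_def by blast
  ultimately show ?thesis by blast
qed

end

section \<open>Orthogonal completions\<close>

context supported_quotient
begin

text \<open>Orthogonal sums of elements of K, realized inside Q; \<open>orth_completion_A\<close>
  identifies the case of the whole algebra with O(A). For an ideal K they form an ideal of O(A), the
  source of denominators modulo an ultrafilter.\<close>

definition glued :: "'a set \<Rightarrow> 'v set" where
  "glued K = {x \<in> carrier Q. \<exists>D. dense_orthogonal C D \<and> (\<forall>\<xi> \<in> D. \<exists>k \<in> K. \<xi> \<odot> x = \<xi> \<odot> j k)}"

lemma glued_sub: "x \<in> glued K \<Longrightarrow> x \<in> carrier Q"
  by (simp add: glued_def)

lemma base_in_glued: "\<lbrakk>K \<subseteq> carrier A; k \<in> K\<rbrakk> \<Longrightarrow> j k \<in> glued K"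
  unfolding glued_def using B.dense_orthogonal_one by auto

lemma agree_mult:
  assumes "\<xi> \<in> carrier C" "\<chi> \<in> carrier C" "x \<in> carrier Q" "y \<in> carrier Q" "\<xi> \<odot> x = \<xi> \<odot> y"
  shows "(\<xi> \<otimes>\<^bsub>C\<^esub> \<chi>) \<odot> x = (\<xi> \<otimes>\<^bsub>C\<^esub> \<chi>) \<odot> y" "(\<chi> \<otimes>\<^bsub>C\<^esub> \<xi>) \<odot> x = (\<chi> \<otimes>\<^bsub>C\<^esub> \<xi>) \<odot> y"
proof -
  show *: "(\<chi> \<otimes>\<^bsub>C\<^esub> \<xi>) \<odot> x = (\<chi> \<otimes>\<^bsub>C\<^esub> \<xi>) \<odot> y" using assms by (simp add: Q.smult_assoc1)
  show "(\<xi> \<otimes>\<^bsub>C\<^esub> \<chi>) \<odot> x = (\<xi> \<otimes>\<^bsub>C\<^esub> \<chi>) \<odot> y"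
    using * A.R.m_comm[OF assms(1,2)] by simp
qed

lemma local_add:
  assumes "\<zeta> \<in> carrier C" "x \<in> carrier Q" "x' \<in> carrier Q" "y \<in> carrier Q" "y' \<in> carrier Q"
    and "\<zeta> \<odot> x = \<zeta> \<odot> x'" "\<zeta> \<odot> y = \<zeta> \<odot> y'"
  shows "\<zeta> \<odot> (x \<oplus> y) = \<zeta> \<odot> (x' \<oplus> y')"
  using assms by (simp add: Q.smult_r_distr)

text \<open>One factor is exchanged at a time, with the scalar moved onto it.\<close>

lemma local_mult:
  assumes "\<zeta> \<in> carrier C" "x \<in> carrier Q" "x' \<in> carrier Q" "y \<in> carrier Q" "y' \<in> carrier Q"
    and "\<zeta> \<odot> x = \<zeta> \<odot> x'" "\<zeta> \<odot> y = \<zeta> \<odot> y'"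
  shows "\<zeta> \<odot> (x \<otimes> y) = \<zeta> \<odot> (x' \<otimes> y')"
proof -
  have "\<zeta> \<odot> (x \<otimes> y) = (\<zeta> \<odot> x') \<otimes> y" using assms by (simp flip: Q.mult_smult_left)
  also have "\<dots> = x' \<otimes> (\<zeta> \<odot> y')" using assms by (simp add: Q.mult_smult_left flip: Q.mult_smult_right)
  finally show ?thesis using assms by (simp add: Q.mult_smult_right)
qed

lemma glued_common:
  assumes K: "K \<subseteq> carrier A" and L: "L \<subseteq> carrier A" and x: "x \<in> glued K" and y: "y \<in> glued L"
  shows "\<exists>E. dense_orthogonal C E \<and> (\<forall>\<zeta> \<in> E. (\<exists>k \<in> K. \<zeta> \<odot> x = \<zeta> \<odot> j k) \<and> (\<exists>l \<in> L. \<zeta> \<odot> y = \<zeta> \<odot> j l))"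
proof -
  obtain D where D: "dense_orthogonal C D" "\<And>\<xi>. \<xi> \<in> D \<Longrightarrow> \<exists>k \<in> K. \<xi> \<odot> x = \<xi> \<odot> j k"
    using x by (auto simp: glued_def)
  obtain E where E: "dense_orthogonal C E" "\<And>\<xi>. \<xi> \<in> E \<Longrightarrow> \<exists>k \<in> L. \<xi> \<odot> y = \<xi> \<odot> j k"
    using y by (auto simp: glued_def)
  have "(\<exists>k \<in> K. \<zeta> \<odot> x = \<zeta> \<odot> j k) \<and> (\<exists>l \<in> L. \<zeta> \<odot> y = \<zeta> \<odot> j l)"
    if "\<zeta> \<in> {\<xi> \<otimes>\<^bsub>C\<^esub> \<eta> | \<xi> \<eta>. \<xi> \<in> D \<and> \<eta> \<in> E}" for \<zeta>
  proof -
    from that obtain \<xi> \<eta> where z: "\<xi> \<in> D" "\<eta> \<in> E" "\<zeta> = \<xi> \<otimes>\<^bsub>C\<^esub> \<eta>" by blast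
    note c = idem(2)[OF D(1) z(1)] idem(2)[OF E(1) z(2)]
    obtain k where k: "k \<in> K" "\<xi> \<odot> x = \<xi> \<odot> j k" using D(2)[OF z(1)] by blast
    obtain l where l: "l \<in> L" "\<eta> \<odot> y = \<eta> \<odot> j l" using E(2)[OF z(2)] by blast
    have jk: "j k \<in> carrier Q" "j l \<in> carrier Q" using k l K L by auto
    show ?thesis
      using agree_mult(1)[OF c glued_sub[OF x] jk(1) k(2)] agree_mult(2)[OF c(2,1) glued_sub[OF y] jk(2) l(2)] k l z
      by blast
  qed
  then show ?thesis using B.dense_orthogonal_refine[OF D(1), of "\<lambda>_. E"] E(1) by blast
qed

text \<open>Treats sum and product together: \<open>local\<close> says that the operation respects
  equality over an idempotent, so over a common refinement its value agrees with elements of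
  \<open>N\<close>.\<close>

lemma glued_binary:
  assumes K: "K \<subseteq> carrier A" and L: "L \<subseteq> carrier A" and x: "x \<in> glued K" and y: "y \<in> glued L"
    and closed: "\<And>k l. \<lbrakk>k \<in> K; l \<in> L\<rbrakk> \<Longrightarrow> star k l \<in> N" "\<And>p q. \<lbrakk>p \<in> carrier Q; q \<in> carrier Q\<rbrakk> \<Longrightarrow> op p q \<in> carrier Q"
    and hom: "\<And>k l. \<lbrakk>k \<in> K; l \<in> L\<rbrakk> \<Longrightarrow> j (star k l) = op (j k) (j l)"
    and local: "\<And>\<zeta> p p' q q'. \<lbrakk>\<zeta> \<in> carrier C; p \<in> carrier Q; p' \<in> carrier Q; q \<in> carrier Q; q' \<in> carrier Q;
      \<zeta> \<odot> p = \<zeta> \<odot> p'; \<zeta> \<odot> q = \<zeta> \<odot> q'\<rbrakk> \<Longrightarrow> \<zeta> \<odot> op p q = \<zeta> \<odot> op p' q'"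
  shows "op x y \<in> glued N"
proof -
  obtain E where E: "dense_orthogonal C E" "\<And>\<zeta>. \<zeta> \<in> E \<Longrightarrow> (\<exists>k \<in> K. \<zeta> \<odot> x = \<zeta> \<odot> j k)"
    "\<And>\<zeta>. \<zeta> \<in> E \<Longrightarrow> (\<exists>l \<in> L. \<zeta> \<odot> y = \<zeta> \<odot> j l)"
    using glued_common[OF K L x y] by blast
  have "\<exists>n \<in> N. \<zeta> \<odot> op x y = \<zeta> \<odot> j n" if \<zeta>: "\<zeta> \<in> E" for \<zeta>
  proof -
    obtain k l where kl: "k \<in> K" "\<zeta> \<odot> x = \<zeta> \<odot> j k" "l \<in> L" "\<zeta> \<odot> y = \<zeta> \<odot> j l"
      using E \<zeta> by blast
    have jkl: "j k \<in> carrier Q" "j l \<in> carrier Q" using kl K L by auto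
    have "\<zeta> \<odot> op x y = \<zeta> \<odot> j (star k l)"
      unfolding hom[OF kl(1,3)]
      by (rule local[OF idem(2)[OF E(1) \<zeta>] glued_sub[OF x] jkl(1) glued_sub[OF y] jkl(2) kl(2,4)])
    then show ?thesis using closed(1)[OF kl(1,3)] by blast
  qed
  then show ?thesis using E(1) closed(2)[OF glued_sub[OF x] glued_sub[OF y]] unfolding glued_def by blast
qed

lemma glued_add:
  assumes K: "algebra_ideal C A K" and xy: "x \<in> glued K" "y \<in> glued K"
  shows "x \<oplus> y \<in> glued K"
proof -
  note KD = A.algebra_idealD[OF K]
  have Kc: "k \<in> carrier A" if "k \<in> K" for k using KD(1) that by auto
  show ?thesis
    by (rule glued_binary[where star="add A" and op="add Q", OF KD(1) KD(1) xy])
      (assumption | rule KD(3) Q.M.a_closed e_add Kc local_add)+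
qed

lemma glued_mult:
  assumes K: "algebra_ideal C A K" and x: "x \<in> glued K" and y: "y \<in> glued (carrier A)"
  shows "x \<otimes> y \<in> glued K"
proof -
  note KD = A.algebra_idealD[OF K]
  have Kc: "k \<in> carrier A" if "k \<in> K" for k using KD(1) that by auto
  show ?thesis
    by (rule glued_binary[where star="mult A" and op="mult Q", OF KD(1) subset_refl x y])
      (assumption | rule KD(6) Q.mult_closed e_mult Kc local_mult)+
qed

lemma glued_smult:
  assumes K: "algebra_ideal C A K" and x: "x \<in> glued K" and c: "c \<in> carrier C"
  shows "c \<odot> x \<in> glued K"
proof -
  note KD = A.algebra_idealD[OF K]
  obtain D where D: "dense_orthogonal C D" "\<And>\<xi>. \<xi> \<in> D \<Longrightarrow> \<exists>k \<in> K. \<xi> \<odot> x = \<xi> \<odot> j k"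
    using x by (auto simp: glued_def)
  have "\<exists>k \<in> K. \<xi> \<odot> (c \<odot> x) = \<xi> \<odot> j k" if \<xi>: "\<xi> \<in> D" for \<xi>
  proof -
    obtain k where k: "k \<in> K" "\<xi> \<odot> x = \<xi> \<odot> j k" using D(2)[OF \<xi>] by blast
    then have kc: "k \<in> carrier A" using KD(1) by auto
    have "\<xi> \<odot> (c \<odot> x) = \<xi> \<odot> j (c \<odot>\<^bsub>A\<^esub> k)"
      using smult_commute[OF idem(2)[OF D(1) \<xi>] c] k kc glued_sub[OF x] c by (simp add: e_smult)
    then show ?thesis using KD(5)[OF c k(1)] by blast
  qed
  then show ?thesis using D(1) c glued_sub[OF x] unfolding glued_def by blast
qed

text \<open>Gluing in Q gives x. Over \<xi> it agrees with u(\<xi>), which agrees with elements of K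
  over its own set \<open>E \<xi>\<close>, and the products \<xi>\<eta> form a dense orthogonal
  set.\<close>

lemma glue_in_glued:
  assumes D: "dense_orthogonal C D" and K: "K \<subseteq> carrier A" and u: "\<And>\<xi>. \<xi> \<in> D \<Longrightarrow> u \<xi> \<in> glued K"
  shows "\<exists>x \<in> glued K. \<forall>\<xi> \<in> D. \<xi> \<odot> x = \<xi> \<odot> u \<xi>"
proof -
  have uQ: "u \<xi> \<in> carrier Q" if "\<xi> \<in> D" for \<xi> using u[OF that] by (rule glued_sub)
  obtain x where x: "x \<in> carrier Q" "\<And>\<xi>. \<xi> \<in> D \<Longrightarrow> \<xi> \<odot> x = \<xi> \<odot> u \<xi>"
    using glue[OF D, of u] uQ by auto
  have "\<exists>E. dense_orthogonal C E \<and> (\<forall>\<eta> \<in> E. \<exists>k \<in> K. \<eta> \<odot> u \<xi> = \<eta> \<odot> j k)" if "\<xi> \<in> D" for \<xi>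
    using u[OF that] by (simp add: glued_def)
  then obtain E where E: "\<And>\<xi>. \<xi> \<in> D \<Longrightarrow> dense_orthogonal C (E \<xi>)"
    "\<And>\<xi> \<eta>. \<lbrakk>\<xi> \<in> D; \<eta> \<in> E \<xi>\<rbrakk> \<Longrightarrow> \<exists>k \<in> K. \<eta> \<odot> u \<xi> = \<eta> \<odot> j k" by metis
  have "\<exists>k \<in> K. \<zeta> \<odot> x = \<zeta> \<odot> j k" if "\<zeta> \<in> {\<xi> \<otimes>\<^bsub>C\<^esub> \<eta> | \<xi> \<eta>. \<xi> \<in> D \<and> \<eta> \<in> E \<xi>}" for \<zeta>
  proof -
    from that obtain \<xi> \<eta> where z: "\<xi> \<in> D" "\<eta> \<in> E \<xi>" "\<zeta> = \<xi> \<otimes>\<^bsub>C\<^esub> \<eta>" by blast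
    note c = idem(2)[OF D z(1)] idem(2)[OF E(1)[OF z(1)] z(2)]
    obtain k where k: "k \<in> K" "\<eta> \<odot> u \<xi> = \<eta> \<odot> j k" using E(2)[OF z(1,2)] by blast
    have jk: "j k \<in> carrier Q" using k K by auto
    show ?thesis
      using agree_mult(1)[OF c x(1) uQ[OF z(1)] x(2)[OF z(1)]] agree_mult(2)[OF c(2,1) uQ[OF z(1)] jk k(2)] k z
      by auto
  qed
  with B.dense_orthogonal_refine[OF D E(1)] x(1) have "x \<in> glued K"
    unfolding glued_def by (intro CollectI conjI exI ballI)
  then show ?thesis using x(2) by blast
qed

lemma orth_complete_glued:
  assumes K: "K \<subseteq> carrier A"
  shows "orth_complete C V (glued K)"
  unfolding orth_complete_def
proof (intro conjI allI impI)
  show "glued K \<subseteq> carrier V" using glued_sub Q_sub by auto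
  fix D u assume "dense_orthogonal C D \<and> u \<in> D \<rightarrow> glued K"
  then have D: "dense_orthogonal C D" and u: "\<And>\<xi>. \<xi> \<in> D \<Longrightarrow> u \<xi> \<in> glued K" by auto
  obtain x where x: "x \<in> glued K" "\<And>\<xi>. \<xi> \<in> D \<Longrightarrow> \<xi> \<odot> x = \<xi> \<odot> u \<xi>"
    using glue_in_glued[OF D K, of u] u by blast
  then have "\<forall>\<xi> \<in> D. \<xi> \<odot>\<^bsub>V\<^esub> x = \<xi> \<odot>\<^bsub>V\<^esub> u \<xi>"
    using idem(2)[OF D] glued_sub[OF x(1)] glued_sub[OF u] by simp
  then show "\<exists>x \<in> glued K. \<forall>\<xi> \<in> D. \<xi> \<odot>\<^bsub>V\<^esub> x = \<xi> \<odot>\<^bsub>V\<^esub> u \<xi>" using x(1) by blast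
qed

theorem orth_completion_Q: "orth_completion C V (carrier Q) = carrier Q"
proof
  have "orth_complete C V (carrier Q)"
    unfolding orth_complete_def
  proof (intro conjI allI impI)
    show "carrier Q \<subseteq> carrier V" using Q_sub by auto
    fix D u assume "dense_orthogonal C D \<and> u \<in> D \<rightarrow> carrier Q"
    then have D: "dense_orthogonal C D" and u: "u \<in> D \<rightarrow> carrier Q" by auto
    then have uQ: "u \<xi> \<in> carrier Q" if "\<xi> \<in> D" for \<xi> using that by auto
    obtain x where x: "x \<in> carrier Q" "\<And>\<xi>. \<xi> \<in> D \<Longrightarrow> \<xi> \<odot> x = \<xi> \<odot> u \<xi>" using glue[OF D u] by blast
    then have "\<forall>\<xi> \<in> D. \<xi> \<odot>\<^bsub>V\<^esub> x = \<xi> \<odot>\<^bsub>V\<^esub> u \<xi>" using idem(2)[OF D] uQ by simp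
    then show "\<exists>x \<in> carrier Q. \<forall>\<xi> \<in> D. \<xi> \<odot>\<^bsub>V\<^esub> x = \<xi> \<odot>\<^bsub>V\<^esub> u \<xi>" using x(1) by blast
  qed
  then show "orth_completion C V (carrier Q) \<subseteq> carrier Q" unfolding orth_completion_def by blast
  show "carrier Q \<subseteq> orth_completion C V (carrier Q)" unfolding orth_completion_def by blast
qed

text \<open>For minimality, an orthogonally complete set T containing A glues the local values of x
  to some y. As T is only known to lie in J, the equality y = x comes from
  \<open>separates_J\<close>.\<close>

theorem orth_completion_A: "orth_completion C V (j ` carrier A) = glued (carrier A)"
proof
  have "j ` carrier A \<subseteq> glued (carrier A)" using base_in_glued by blast
  then show "orth_completion C V (j ` carrier A) \<subseteq> glued (carrier A)"
    unfolding orth_completion_def using orth_complete_glued[OF subset_refl] by blast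
  have "x \<in> T" if x: "x \<in> glued (carrier A)" and T: "orth_complete C V T" "j ` carrier A \<subseteq> T" for x T
  proof -
    obtain D where D: "dense_orthogonal C D" "\<And>\<xi>. \<xi> \<in> D \<Longrightarrow> \<exists>k \<in> carrier A. \<xi> \<odot> x = \<xi> \<odot> j k"
      using x by (auto simp: glued_def)
    obtain u where u: "\<And>\<xi>. \<xi> \<in> D \<Longrightarrow> u \<xi> \<in> carrier A \<and> \<xi> \<odot> x = \<xi> \<odot> j (u \<xi>)" using D(2) by metis
    have "(\<lambda>\<xi>. j (u \<xi>)) \<in> D \<rightarrow> T" using u T(2) by auto
    then obtain y where y: "y \<in> T" "\<And>\<xi>. \<xi> \<in> D \<Longrightarrow> \<xi> \<odot>\<^bsub>V\<^esub> y = \<xi> \<odot>\<^bsub>V\<^esub> j (u \<xi>)"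
      using T(1) D(1) unfolding orth_complete_def by blast
    have yJ: "y \<in> carrier J" using y(1) T(1) by (auto simp: orth_complete_def)
    note xQ = glued_sub[OF x]
    have "y \<ominus>\<^bsub>J\<^esub> x = \<zero>\<^bsub>J\<^esub>"
    proof (rule separates_J[OF D(1)])
      fix \<xi> assume \<xi>: "\<xi> \<in> D"
      note c = idem(2)[OF D(1) \<xi>]
      have "scalar_op A \<xi> \<odot>\<^bsub>J\<^esub> y = scalar_op A \<xi> \<odot>\<^bsub>J\<^esub> x"
        using y(2)[OF \<xi>] u[OF \<xi>] c xQ by (simp add: scalar_module_def Q_smult)
      then show "scalar_op A \<xi> \<odot>\<^bsub>J\<^esub> (y \<ominus>\<^bsub>J\<^esub> x) = \<zero>\<^bsub>J\<^esub>"
        using yJ Q_sub[OF xQ] A.scalar_op_in_mult_ring[OF c]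
        by (simp add: H.M.M.minus_eq H.M.act_add H.M.act_minus H.M.M.r_neg)
    qed (use yJ Q_sub[OF xQ] in simp)
    then show ?thesis using y(1) yJ Q_sub[OF xQ] by (simp add: H.M.M.eq_iff_minus_zero)
  qed
  then show "glued (carrier A) \<subseteq> orth_completion C V (j ` carrier A)" unfolding orth_completion_def by blast
qed

text \<open>The operation of Q satisfies the definite description in \<open>orth_op\<close>, and any
  other candidate agrees with it over the products \<xi>\<chi> of the decompositions that the
  candidate comes with.\<close>

lemma orth_op_eq:
  assumes x: "x \<in> glued (carrier A)" and y: "y \<in> glued (carrier A)"
    and closed: "\<And>k l. \<lbrakk>k \<in> carrier A; l \<in> carrier A\<rbrakk> \<Longrightarrow> star k l \<in> carrier A"
      "\<And>p q. \<lbrakk>p \<in> carrier Q; q \<in> carrier Q\<rbrakk> \<Longrightarrow> op p q \<in> carrier Q"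
    and hom: "\<And>k l. \<lbrakk>k \<in> carrier A; l \<in> carrier A\<rbrakk> \<Longrightarrow> j (star k l) = op (j k) (j l)"
    and local: "\<And>\<zeta> p p' q q'. \<lbrakk>\<zeta> \<in> carrier C; p \<in> carrier Q; p' \<in> carrier Q; q \<in> carrier Q; q' \<in> carrier Q;
      \<zeta> \<odot> p = \<zeta> \<odot> p'; \<zeta> \<odot> q = \<zeta> \<odot> q'\<rbrakk> \<Longrightarrow> \<zeta> \<odot> op p q = \<zeta> \<odot> op p' q'"
  shows "orth_op C V (carrier A) j star x y = op x y"
proof -
  note xQ = glued_sub[OF x] and yQ = glued_sub[OF y]
  have op: "op x y \<in> glued (carrier A)"
    by (rule glued_binary[where star=star and op=op, OF subset_refl subset_refl x y])
      (assumption | rule closed hom local)+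
  have key: "(\<xi> \<otimes>\<^bsub>C\<^esub> \<chi>) \<odot>\<^bsub>V\<^esub> op x y = (\<xi> \<otimes>\<^bsub>C\<^esub> \<chi>) \<odot>\<^bsub>V\<^esub> j (star k l)"
    if "\<xi> \<in> carrier C" "\<chi> \<in> carrier C" "k \<in> carrier A" "l \<in> carrier A"
      "\<xi> \<odot>\<^bsub>V\<^esub> x = \<xi> \<odot>\<^bsub>V\<^esub> j k" "\<chi> \<odot>\<^bsub>V\<^esub> y = \<chi> \<odot>\<^bsub>V\<^esub> j l" for \<xi> \<chi> k l
  proof -
    have "\<xi> \<odot> x = \<xi> \<odot> j k" "\<chi> \<odot> y = \<chi> \<odot> j l" using that xQ yQ by simp_all
    note agree = this
    have jc: "j k \<in> carrier Q" "j l \<in> carrier Q" "j (star k l) \<in> carrier Q" using that(3,4) closed(1) by auto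
    have "(\<xi> \<otimes>\<^bsub>C\<^esub> \<chi>) \<odot> op x y = (\<xi> \<otimes>\<^bsub>C\<^esub> \<chi>) \<odot> j (star k l)"
      unfolding hom[OF that(3,4)]
      by (rule local[OF A.R.m_closed[OF that(1,2)] xQ jc(1) yQ jc(2)
            agree_mult(1)[OF that(1,2) xQ jc(1) agree(1)] agree_mult(2)[OF that(2,1) yQ jc(2) agree(2)]])
    then show ?thesis using that(1,2) closed(2)[OF xQ yQ] jc(3) by simp
  qed
  show ?thesis
    unfolding orth_op_def orth_completion_A
  proof (rule the_equality)
    obtain D where D: "dense_orthogonal C D" "\<And>\<xi>. \<xi> \<in> D \<Longrightarrow> \<exists>k \<in> carrier A. \<xi> \<odot> x = \<xi> \<odot> j k"
      using x by (auto simp: glued_def)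
    obtain E where E: "dense_orthogonal C E" "\<And>\<xi>. \<xi> \<in> E \<Longrightarrow> \<exists>k \<in> carrier A. \<xi> \<odot> y = \<xi> \<odot> j k"
      using y by (auto simp: glued_def)
    obtain u where u: "\<And>\<xi>. \<xi> \<in> D \<Longrightarrow> u \<xi> \<in> carrier A \<and> \<xi> \<odot> x = \<xi> \<odot> j (u \<xi>)" using D(2) by metis
    obtain v where v: "\<And>\<xi>. \<xi> \<in> E \<Longrightarrow> v \<xi> \<in> carrier A \<and> \<xi> \<odot> y = \<xi> \<odot> j (v \<xi>)" using E(2) by metis
    have uV: "\<forall>\<xi> \<in> D. \<xi> \<odot>\<^bsub>V\<^esub> x = \<xi> \<odot>\<^bsub>V\<^esub> j (u \<xi>)" and vV: "\<forall>\<chi> \<in> E. \<chi> \<odot>\<^bsub>V\<^esub> y = \<chi> \<odot>\<^bsub>V\<^esub> j (v \<chi>)"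
      using u v idem(2)[OF D(1)] idem(2)[OF E(1)] xQ yQ by simp_all
    have "\<forall>\<xi> \<in> D. \<forall>\<chi> \<in> E. (\<xi> \<otimes>\<^bsub>C\<^esub> \<chi>) \<odot>\<^bsub>V\<^esub> op x y = (\<xi> \<otimes>\<^bsub>C\<^esub> \<chi>) \<odot>\<^bsub>V\<^esub> j (star (u \<xi>) (v \<chi>))"
    proof (intro ballI)
      fix \<xi> \<chi> assume *: "\<xi> \<in> D" "\<chi> \<in> E"
      show "(\<xi> \<otimes>\<^bsub>C\<^esub> \<chi>) \<odot>\<^bsub>V\<^esub> op x y = (\<xi> \<otimes>\<^bsub>C\<^esub> \<chi>) \<odot>\<^bsub>V\<^esub> j (star (u \<xi>) (v \<chi>))"
        by (rule key[OF idem(2)[OF D(1) *(1)] idem(2)[OF E(1) *(2)] conjunct1[OF u[OF *(1)]]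
              conjunct1[OF v[OF *(2)]] bspec[OF uV *(1)] bspec[OF vV *(2)]])
    qed
    moreover have "u \<in> D \<rightarrow> carrier A" "v \<in> E \<rightarrow> carrier A" using u v by auto
    ultimately show "op x y \<in> glued (carrier A) \<and> (\<exists>D E u v. dense_orthogonal C D \<and> dense_orthogonal C E \<and>
        u \<in> D \<rightarrow> carrier A \<and> v \<in> E \<rightarrow> carrier A \<and> (\<forall>\<xi> \<in> D. \<xi> \<odot>\<^bsub>V\<^esub> x = \<xi> \<odot>\<^bsub>V\<^esub> j (u \<xi>)) \<and>
        (\<forall>\<chi> \<in> E. \<chi> \<odot>\<^bsub>V\<^esub> y = \<chi> \<odot>\<^bsub>V\<^esub> j (v \<chi>)) \<and>
        (\<forall>\<xi> \<in> D. \<forall>\<chi> \<in> E. (\<xi> \<otimes>\<^bsub>C\<^esub> \<chi>) \<odot>\<^bsub>V\<^esub> op x y = (\<xi> \<otimes>\<^bsub>C\<^esub> \<chi>) \<odot>\<^bsub>V\<^esub> j (star (u \<xi>) (v \<chi>))))"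
      by (intro conjI op exI[of _ D] exI[of _ E] exI[of _ u] exI[of _ v] D(1) E(1) uV vV)
  next
    fix z assume "z \<in> glued (carrier A) \<and> (\<exists>D E u v. dense_orthogonal C D \<and> dense_orthogonal C E \<and>
        u \<in> D \<rightarrow> carrier A \<and> v \<in> E \<rightarrow> carrier A \<and> (\<forall>\<xi> \<in> D. \<xi> \<odot>\<^bsub>V\<^esub> x = \<xi> \<odot>\<^bsub>V\<^esub> j (u \<xi>)) \<and>
        (\<forall>\<chi> \<in> E. \<chi> \<odot>\<^bsub>V\<^esub> y = \<chi> \<odot>\<^bsub>V\<^esub> j (v \<chi>)) \<and>
        (\<forall>\<xi> \<in> D. \<forall>\<chi> \<in> E. (\<xi> \<otimes>\<^bsub>C\<^esub> \<chi>) \<odot>\<^bsub>V\<^esub> z = (\<xi> \<otimes>\<^bsub>C\<^esub> \<chi>) \<odot>\<^bsub>V\<^esub> j (star (u \<xi>) (v \<chi>))))"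
    then obtain D E u v where z: "z \<in> glued (carrier A)" and D: "dense_orthogonal C D" and E: "dense_orthogonal C E"
      and uv: "u \<in> D \<rightarrow> carrier A" "v \<in> E \<rightarrow> carrier A" "\<forall>\<xi> \<in> D. \<xi> \<odot>\<^bsub>V\<^esub> x = \<xi> \<odot>\<^bsub>V\<^esub> j (u \<xi>)"
        "\<forall>\<chi> \<in> E. \<chi> \<odot>\<^bsub>V\<^esub> y = \<chi> \<odot>\<^bsub>V\<^esub> j (v \<chi>)"
        "\<forall>\<xi> \<in> D. \<forall>\<chi> \<in> E. (\<xi> \<otimes>\<^bsub>C\<^esub> \<chi>) \<odot>\<^bsub>V\<^esub> z = (\<xi> \<otimes>\<^bsub>C\<^esub> \<chi>) \<odot>\<^bsub>V\<^esub> j (star (u \<xi>) (v \<chi>))"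
      by (elim conjE exE) (rule that)
    show "z = op x y"
    proof (rule separates_eq[OF B.dense_orthogonal_refine[OF D, of "\<lambda>_. E"]])
      show "z \<in> carrier Q" "op x y \<in> carrier Q" using glued_sub z op by auto
      fix \<zeta> assume "\<zeta> \<in> {\<xi> \<otimes>\<^bsub>C\<^esub> \<eta> | \<xi> \<eta>. \<xi> \<in> D \<and> \<eta> \<in> E}"
      then obtain \<xi> \<chi> where *: "\<xi> \<in> D" "\<chi> \<in> E" "\<zeta> = \<xi> \<otimes>\<^bsub>C\<^esub> \<chi>" by blast
      have c: "\<xi> \<in> carrier C" "\<chi> \<in> carrier C" using * idem(2)[OF D] idem(2)[OF E] by auto
      have uvc: "u \<xi> \<in> carrier A" "v \<chi> \<in> carrier A" using uv * by auto
      have "\<zeta> \<odot>\<^bsub>V\<^esub> z = \<zeta> \<odot>\<^bsub>V\<^esub> op x y"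
        unfolding *(3) uv(5)[rule_format, OF *(1,2)]
        by (rule key[OF c uvc uv(3)[rule_format, OF *(1)] uv(4)[rule_format, OF *(2)], symmetric])
      then show "\<zeta> \<odot> z = \<zeta> \<odot> op x y"
        using c * glued_sub[OF z] glued_sub[OF op] by simp
    qed (rule E)
  qed
qed

section \<open>O(A) as a subalgebra of Q\<close>

abbreviation OA where "OA \<equiv> O_algebra C V A j"

lemma OA_carrier: "carrier OA = glued (carrier A)"
  by (simp add: O_algebra_def orth_completion_A)

lemma OA_sub: "x \<in> carrier OA \<Longrightarrow> x \<in> carrier Q"
  by (simp add: OA_carrier glued_sub)

lemma OA_zero: "\<zero>\<^bsub>OA\<^esub> = \<zero>"
  by (simp add: O_algebra_def Q_zero)

lemma OA_add:
  assumes "x \<in> carrier OA" "y \<in> carrier OA"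
  shows "x \<oplus>\<^bsub>OA\<^esub> y = x \<oplus> y"
proof -
  have "orth_op C V (carrier A) j (add A) x y = x \<oplus> y"
    by (rule orth_op_eq[where op="add Q", OF assms[unfolded OA_carrier]])
      (assumption | rule A.M.a_closed Q.M.a_closed e_add local_add)+
  then show ?thesis by (simp add: O_algebra_def)
qed

lemma OA_mult:
  assumes "x \<in> carrier OA" "y \<in> carrier OA"
  shows "x \<otimes>\<^bsub>OA\<^esub> y = x \<otimes> y"
proof -
  have "orth_op C V (carrier A) j (mult A) x y = x \<otimes> y"
    by (rule orth_op_eq[where op="mult Q", OF assms[unfolded OA_carrier]])
      (assumption | rule A.mult_closed Q.mult_closed e_mult local_mult)+
  then show ?thesis by (simp add: O_algebra_def)
qed

lemma OA_smult: "\<lbrakk>c \<in> carrier C; x \<in> carrier OA\<rbrakk> \<Longrightarrow> c \<odot>\<^bsub>OA\<^esub> x = c \<odot> x"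
  by (simp add: O_algebra_def[of C V A j] OA_sub[unfolded O_algebra_def])

lemma OA_jordan: "jordan_algebra C OA"
proof (rule jordan_algebra_inj[where h="\<lambda>x. x", OF Q.jordan_algebra_axioms])
  note Ai = A.algebra_ideal_carrier
  show "\<zero>\<^bsub>OA\<^esub> \<in> carrier OA"
    using base_in_glued[OF subset_refl A.M.zero_closed] by (simp add: OA_carrier OA_zero)
  show "x \<oplus>\<^bsub>OA\<^esub> y \<in> carrier OA \<and> x \<oplus>\<^bsub>OA\<^esub> y = x \<oplus> y" if "x \<in> carrier OA" "y \<in> carrier OA" for x y
    using glued_add[OF Ai] that OA_add[OF that] by (simp add: OA_carrier)
  show "x \<otimes>\<^bsub>OA\<^esub> y \<in> carrier OA \<and> x \<otimes>\<^bsub>OA\<^esub> y = x \<otimes> y" if "x \<in> carrier OA" "y \<in> carrier OA" for x y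
    using glued_mult[OF Ai] that OA_mult[OF that] by (simp add: OA_carrier)
  show "c \<odot>\<^bsub>OA\<^esub> x \<in> carrier OA \<and> c \<odot>\<^bsub>OA\<^esub> x = c \<odot> x" if "c \<in> carrier C" "x \<in> carrier OA" for c x
    using glued_smult[OF Ai] that OA_smult[OF that] by (simp add: OA_carrier)
qed (use OA_sub OA_zero in auto)

text \<open>The support is computed in A, for the set X of all multiples kq lying in A. If the rest
  q' = q - \<epsilon>q were nonzero, a denominator a would give a nonzero p = aq' in A. With b = a -
  \<epsilon>a also p = bq, so p lies in X and \<epsilon>p = p, against \<epsilon>q' = 0.\<close>

lemma Q_support:
  assumes q: "q \<in> carrier Q"
  shows "\<exists>\<epsilon> \<in> idempotents C. \<epsilon> \<odot> q = q \<and> (\<forall>\<alpha> \<in> carrier C. \<alpha> \<odot> q = \<zero> \<longrightarrow> \<alpha> \<otimes>\<^bsub>C\<^esub> \<epsilon> = \<zero>\<^bsub>C\<^esub>)"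
proof -
  define X where "X = {p \<in> carrier A. \<exists>k \<in> carrier A. j p = j k \<otimes> q}"
  have "X \<subseteq> carrier A" by (auto simp: X_def)
  from support[OF this] obtain \<epsilon> where \<epsilon>: "\<epsilon> \<in> idempotents C" "\<And>x. x \<in> X \<Longrightarrow> \<epsilon> \<odot>\<^bsub>A\<^esub> x = x"
    "\<And>\<alpha>. \<lbrakk>\<alpha> \<in> carrier C; \<And>x. x \<in> X \<Longrightarrow> \<alpha> \<odot>\<^bsub>A\<^esub> x = \<zero>\<^bsub>A\<^esub>\<rbrakk> \<Longrightarrow> \<alpha> \<otimes>\<^bsub>C\<^esub> \<epsilon> = \<zero>\<^bsub>C\<^esub>" by blast
  note \<epsilon>c = idem_closed[OF \<epsilon>(1)]
  define q' where "q' = q \<ominus> \<epsilon> \<odot> q"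
  have q': "q' \<in> carrier Q" using q \<epsilon>c by (simp add: q'_def)
  have \<epsilon>q': "\<epsilon> \<odot> q' = \<zero>"
    using q \<epsilon>c B.idempotents_square[OF \<epsilon>(1)]
    by (simp add: q'_def Q.M.minus_eq Q.smult_r_distr Q.smult_r_minus Q.M.r_neg flip: Q.smult_assoc1)
  have "q' = \<zero>"
  proof (rule ccontr)
    assume "q' \<noteq> \<zero>"
    then obtain K a where K: "algebra_ideal C A K" "a \<in> K" "j a \<otimes> q' \<noteq> \<zero>"
      "\<And>a. a \<in> K \<Longrightarrow> \<exists>p \<in> carrier A. j a \<otimes> q' = j p" using denominators[OF q'] by metis
    have a: "a \<in> carrier A" using A.algebra_idealD(1)[OF K(1)] K(2) by auto
    obtain p where p: "p \<in> carrier A" "j a \<otimes> q' = j p" using K(4)[OF K(2)] by blast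
    define b where "b = a \<ominus>\<^bsub>A\<^esub> \<epsilon> \<odot>\<^bsub>A\<^esub> a"
    have b: "b \<in> carrier A" using a \<epsilon>c by (simp add: b_def)
    have jb: "j b = j a \<ominus> \<epsilon> \<odot> j a"
    proof -
      have "b \<oplus>\<^bsub>A\<^esub> \<epsilon> \<odot>\<^bsub>A\<^esub> a = a" using a \<epsilon>c by (simp add: b_def A.M.minus_eq A.M.a_assoc A.M.l_neg)
      then have "j b \<oplus> \<epsilon> \<odot> j a = j a" using a b \<epsilon>c by (metis A.smult_closed e_add e_smult)
      then show ?thesis using a b \<epsilon>c
        by (metis Q.M.add.inv_solve_right' Q.M.minus_eq Q.smult_closed e_closed)
    qed
    have "j p = j b \<otimes> q"
      unfolding jb p(2)[symmetric] q'_def using a q \<epsilon>c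
      by (simp add: Q.mult_diff_left Q.mult_diff_right Q.mult_smult_left Q.mult_smult_right)
    then have "p \<in> X" using p b by (auto simp: X_def)
    then have "\<epsilon> \<odot> j p = j p" using \<epsilon>(2) \<epsilon>c p by (simp flip: e_smult)
    moreover have "\<epsilon> \<odot> j p = \<zero>"
      unfolding p(2)[symmetric] using a q' \<epsilon>c \<epsilon>q' by (simp flip: Q.mult_smult_right)
    ultimately show False using K(3) p by simp
  qed
  then have "\<epsilon> \<odot> q = q" using q \<epsilon>c by (simp add: q'_def Q.M.eq_iff_minus_zero)
  moreover have "\<alpha> \<otimes>\<^bsub>C\<^esub> \<epsilon> = \<zero>\<^bsub>C\<^esub>" if \<alpha>: "\<alpha> \<in> carrier C" "\<alpha> \<odot> q = \<zero>" for \<alpha>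
  proof (rule \<epsilon>(3)[OF \<alpha>(1)])
    fix x assume "x \<in> X"
    then obtain k where x: "x \<in> carrier A" "k \<in> carrier A" "j x = j k \<otimes> q" by (auto simp: X_def)
    then have "j (\<alpha> \<odot>\<^bsub>A\<^esub> x) = \<zero>" using \<alpha> q by (simp add: e_smult flip: Q.mult_smult_right)
    then show "\<alpha> \<odot>\<^bsub>A\<^esub> x = \<zero>\<^bsub>A\<^esub>" using x \<alpha> by (simp add: e_eq_zero_iff)
  qed
  ultimately show ?thesis using \<epsilon>(1) by blast
qed

text \<open>A maximal orthogonal set of idempotents over each of which some element of \<open>K\<close> multiplies
  \<open>q\<close> without loss of support is dense, and these elements are glued.\<close>

theorem full_support_multiplier:
  assumes q: "q \<in> carrier Q" and K: "algebra_ideal C A K" and ann: "jordan_annihilator A K = {\<zero>\<^bsub>A\<^esub>}"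
  shows "\<exists>k \<in> glued K. \<forall>\<alpha> \<in> carrier C. \<alpha> \<odot> (k \<otimes> q) = \<zero> \<longrightarrow> \<alpha> \<odot> q = \<zero>"
proof -
  note KD = A.algebra_idealD[OF K]
  have Kc: "k \<in> carrier A" if "k \<in> K" for k using KD(1) that by auto
  define good where "good \<xi> \<longleftrightarrow> \<xi> \<in> idempotents C \<and> (\<exists>k \<in> K. \<forall>\<alpha> \<in> carrier C.
    (\<alpha> \<otimes>\<^bsub>C\<^esub> \<xi>) \<odot> (j k \<otimes> q) = \<zero> \<longrightarrow> (\<alpha> \<otimes>\<^bsub>C\<^esub> \<xi>) \<odot> q = \<zero>)" for \<xi>
  define \<D> where "\<D> = {D. (\<forall>\<xi> \<in> D. good \<xi>) \<and> (\<forall>\<xi> \<in> D. \<forall>\<chi> \<in> D. \<xi> \<noteq> \<chi> \<longrightarrow> \<xi> \<otimes>\<^bsub>C\<^esub> \<chi> = \<zero>\<^bsub>C\<^esub>)}"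
  have "\<exists>D \<in> \<D>. \<forall>X \<in> \<D>. D \<subseteq> X \<longrightarrow> X = D"
  proof (rule subset_Zorn')
    fix Ch assume Ch: "subset.chain \<D> Ch"
    have "\<xi> \<otimes>\<^bsub>C\<^esub> \<chi> = \<zero>\<^bsub>C\<^esub>" if \<xi>: "\<xi> \<in> \<Union>Ch" and \<chi>: "\<chi> \<in> \<Union>Ch" and "\<xi> \<noteq> \<chi>" for \<xi> \<chi>
    proof -
      obtain X Y where XY: "X \<in> Ch" "Y \<in> Ch" "\<xi> \<in> X" "\<chi> \<in> Y" using \<xi> \<chi> by blast
      then have "X \<subseteq> Y \<or> Y \<subseteq> X" "X \<in> \<D>" "Y \<in> \<D>" using Ch by (auto simp: subset_chain_def)
      then show ?thesis using XY \<open>\<xi> \<noteq> \<chi>\<close> unfolding \<D>_def by blast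
    qed
    moreover have "good \<xi>" if "\<xi> \<in> \<Union>Ch" for \<xi> using that Ch by (auto simp: subset_chain_def \<D>_def)
    ultimately show "\<Union>Ch \<in> \<D>" by (simp add: \<D>_def)
  qed
  then obtain D where "D \<in> \<D>" and "\<forall>X \<in> \<D>. D \<subseteq> X \<longrightarrow> X = D" by (rule bexE)
  then have D: "\<And>\<xi>. \<xi> \<in> D \<Longrightarrow> good \<xi>"
    "\<And>\<xi> \<chi>. \<lbrakk>\<xi> \<in> D; \<chi> \<in> D; \<xi> \<noteq> \<chi>\<rbrakk> \<Longrightarrow> \<xi> \<otimes>\<^bsub>C\<^esub> \<chi> = \<zero>\<^bsub>C\<^esub>" "\<And>X. \<lbrakk>X \<in> \<D>; D \<subseteq> X\<rbrakk> \<Longrightarrow> X = D"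
    by (simp_all add: \<D>_def)
  have Dc: "\<xi> \<in> idempotents C" "\<xi> \<in> carrier C" if "\<xi> \<in> D" for \<xi>
    using D(1)[OF that] by (auto simp: good_def idem_closed)
  have max: "\<epsilon> \<in> D" if \<epsilon>: "good \<epsilon>" "\<And>\<xi>. \<xi> \<in> D \<Longrightarrow> \<xi> \<otimes>\<^bsub>C\<^esub> \<epsilon> = \<zero>\<^bsub>C\<^esub>" for \<epsilon>
  proof -
    have "\<epsilon> \<otimes>\<^bsub>C\<^esub> \<xi> = \<zero>\<^bsub>C\<^esub>" if "\<xi> \<in> D" for \<xi>
      using \<epsilon>(2)[OF that] Dc(2)[OF that] \<epsilon>(1) by (simp add: good_def idem_closed A.R.m_comm)
    then have "insert \<epsilon> D \<in> \<D>" using \<epsilon> D(1,2) by (auto simp: \<D>_def)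
    then show ?thesis using D(3) by blast
  qed
  have dense: "dense_orthogonal C D"
  proof (rule B.dense_orthogonalI)
    fix \<beta> assume \<beta>: "\<beta> \<in> idempotents C" "\<And>\<xi>. \<xi> \<in> D \<Longrightarrow> \<beta> \<otimes>\<^bsub>C\<^esub> \<xi> = \<zero>\<^bsub>C\<^esub>"
    note \<beta>c = idem_closed[OF \<beta>(1)]
    have \<beta>': "\<xi> \<otimes>\<^bsub>C\<^esub> \<beta> = \<zero>\<^bsub>C\<^esub>" if "\<xi> \<in> D" for \<xi>
      using \<beta>(2)[OF that] Dc(2)[OF that] \<beta>c by (simp add: A.R.m_comm)
    show "\<beta> = \<zero>\<^bsub>C\<^esub>"
    proof (cases "\<beta> \<odot> q = \<zero>")
      case True
      \<comment> \<open>Over \<beta> there is no support to preserve, so 0 in K is a witness. Then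
        \<beta> belongs to D and is orthogonal to itself.\<close>
      then have "good \<beta>" using \<beta>(1) \<beta>c q KD(2) by (auto simp: good_def Q.smult_assoc1)
      then have "\<beta> \<in> D" using \<beta>' by (rule max)
      then show ?thesis using \<beta>(2) B.idempotents_square[OF \<beta>(1)] by fastforce
    next
      case False
      have \<beta>q: "\<beta> \<odot> q \<in> carrier Q" using q \<beta>c by simp
      then obtain k where k: "k \<in> K" "j k \<otimes> (\<beta> \<odot> q) \<noteq> \<zero>"
        using quotient_annihilator_free[OF faithful K ann \<beta>q] False by blast
      define r where "r = j k \<otimes> (\<beta> \<odot> q)"
      have jkq: "j k \<otimes> q \<in> carrier Q" using Kc[OF k(1)] q by (simp add: Q.mult_closed)
      have r_eq: "r = \<beta> \<odot> (j k \<otimes> q)" using Kc[OF k(1)] q \<beta>c by (simp add: r_def Q.mult_smult_right)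
      have r: "r \<in> carrier Q" "r \<noteq> \<zero>" using k jkq \<beta>c by (simp_all add: r_eq) (simp flip: r_eq add: r_def)
      \<comment> \<open>The support of r = \<beta>(kq) is good, with witness k, and orthogonal to D
        because \<beta> is. By maximality it lies in D, so \<epsilon>\<beta> = 0 and r = \<epsilon>r
        vanishes.\<close>
      obtain \<epsilon> where \<epsilon>: "\<epsilon> \<in> idempotents C" "\<epsilon> \<odot> r = r"
        "\<And>\<alpha>. \<lbrakk>\<alpha> \<in> carrier C; \<alpha> \<odot> r = \<zero>\<rbrakk> \<Longrightarrow> \<alpha> \<otimes>\<^bsub>C\<^esub> \<epsilon> = \<zero>\<^bsub>C\<^esub>" using Q_support[OF r(1)] by blast
      note \<epsilon>c = idem_closed[OF \<epsilon>(1)]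
      have "good \<epsilon>" unfolding good_def
      proof (intro conjI \<epsilon>(1) bexI[OF _ k(1)] ballI impI)
        fix \<alpha> assume \<alpha>: "\<alpha> \<in> carrier C" "(\<alpha> \<otimes>\<^bsub>C\<^esub> \<epsilon>) \<odot> (j k \<otimes> q) = \<zero>"
        have "\<alpha> \<odot> r = (\<alpha> \<otimes>\<^bsub>C\<^esub> \<epsilon>) \<odot> r" using \<alpha>(1) \<epsilon>c r(1) \<epsilon>(2) by (simp add: Q.smult_assoc1)
        also have "\<dots> = \<beta> \<odot> ((\<alpha> \<otimes>\<^bsub>C\<^esub> \<epsilon>) \<odot> (j k \<otimes> q))"
          unfolding r_eq using \<alpha>(1) \<epsilon>c \<beta>c jkq by (intro smult_commute) auto
        finally have "\<alpha> \<odot> r = \<zero>" using \<alpha>(2) \<beta>c by simp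
        then show "(\<alpha> \<otimes>\<^bsub>C\<^esub> \<epsilon>) \<odot> q = \<zero>" using \<epsilon>(3)[OF \<alpha>(1)] q by simp
      qed
      moreover have "\<xi> \<otimes>\<^bsub>C\<^esub> \<epsilon> = \<zero>\<^bsub>C\<^esub>" if \<xi>: "\<xi> \<in> D" for \<xi>
      proof (rule \<epsilon>(3)[OF Dc(2)[OF \<xi>]])
        show "\<xi> \<odot> r = \<zero>"
          using Q.smult_assoc1[OF Dc(2)[OF \<xi>] \<beta>c jkq] \<beta>'[OF \<xi>] jkq by (simp add: r_eq)
      qed
      ultimately have \<epsilon>D: "\<epsilon> \<in> D" by (rule max)
      have "r = \<epsilon> \<odot> (\<beta> \<odot> (j k \<otimes> q))" using \<epsilon>(2) by (simp add: r_eq)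
      also have "\<dots> = \<zero>"
        using Q.smult_assoc1[OF \<epsilon>c \<beta>c jkq] \<beta>'[OF \<epsilon>D] jkq by simp
      finally show ?thesis using r(2) by simp
    qed
  qed (use Dc D(2) in auto)
  \<comment> \<open>The local witnesses are glued to x. That x preserves the support of q is tested
    over each \<xi>, since D separates.\<close>
  obtain k where k: "\<And>\<xi>. \<xi> \<in> D \<Longrightarrow> k \<xi> \<in> K \<and> (\<forall>\<alpha> \<in> carrier C.
    (\<alpha> \<otimes>\<^bsub>C\<^esub> \<xi>) \<odot> (j (k \<xi>) \<otimes> q) = \<zero> \<longrightarrow> (\<alpha> \<otimes>\<^bsub>C\<^esub> \<xi>) \<odot> q = \<zero>)"
    using D(1) unfolding good_def by metis
  obtain x where x: "x \<in> glued K" "\<And>\<xi>. \<xi> \<in> D \<Longrightarrow> \<xi> \<odot> x = \<xi> \<odot> j (k \<xi>)"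
    using glue_in_glued[OF dense KD(1), of "\<lambda>\<xi>. j (k \<xi>)"] base_in_glued[OF KD(1)] k by blast
  note xQ = glued_sub[OF x(1)]
  have "\<alpha> \<odot> q = \<zero>" if \<alpha>: "\<alpha> \<in> carrier C" "\<alpha> \<odot> (x \<otimes> q) = \<zero>" for \<alpha>
  proof (rule separates[OF dense])
    fix \<xi> assume \<xi>: "\<xi> \<in> D"
    note c = Dc(2)[OF \<xi>] Kc[OF conjunct1[OF k[OF \<xi>]]]
    have "(\<alpha> \<otimes>\<^bsub>C\<^esub> \<xi>) \<odot> (j (k \<xi>) \<otimes> q) = \<alpha> \<odot> ((\<xi> \<odot> x) \<otimes> q)"
      using \<alpha>(1) c q x(2)[OF \<xi>] by (simp add: Q.smult_assoc1 Q.mult_smult_left Q.mult_closed)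
    also have "\<dots> = \<xi> \<odot> (\<alpha> \<odot> (x \<otimes> q))"
      using \<alpha>(1) c q xQ by (simp add: Q.mult_smult_left Q.mult_closed smult_commute)
    finally have "(\<alpha> \<otimes>\<^bsub>C\<^esub> \<xi>) \<odot> q = \<zero>" using k[OF \<xi>] \<alpha> c by simp
    then show "\<xi> \<odot> (\<alpha> \<odot> q) = \<zero>"
      using \<alpha>(1) c q smult_commute[of \<xi> \<alpha> q] by (simp add: Q.smult_assoc1)
  qed (use \<alpha> q in simp)
  then show ?thesis using x(1) by blast
qed

end

section \<open>Quotients by ultrafilters\<close>

context scalar_cring
begin

lemma idempotents_complement:
  assumes \<delta>: "\<delta> \<in> idempotents R"
  shows "\<one> \<ominus> \<delta> \<in> idempotents R" and "\<delta> \<otimes> (\<one> \<ominus> \<delta>) = \<zero>"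
proof -
  note c = idempotents_closed[OF \<delta>]
  show 0: "\<delta> \<otimes> (\<one> \<ominus> \<delta>) = \<zero>"
    using c idempotents_square[OF \<delta>] by (simp add: minus_eq r_distr r_minus r_neg)
  have "(\<one> \<ominus> \<delta>) \<otimes> (\<one> \<ominus> \<delta>) = (\<one> \<ominus> \<delta>) \<ominus> \<delta> \<otimes> (\<one> \<ominus> \<delta>)"
    using c by (simp add: minus_eq l_distr l_minus)
  also have "\<dots> = \<one> \<ominus> \<delta>" unfolding 0 using c by (simp add: minus_eq)
  finally show "\<one> \<ominus> \<delta> \<in> idempotents R" using c by (simp add: idempotents_def)
qed

lemma ultrafilterD:
  assumes "idempotent_ultrafilter R B"
  shows "\<alpha> \<in> B \<Longrightarrow> \<alpha> \<in> idempotents R" "\<zero> \<notin> B" "\<lbrakk>\<alpha> \<in> B; \<beta> \<in> B\<rbrakk> \<Longrightarrow> \<alpha> \<otimes> \<beta> \<in> B"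
    and "\<lbrakk>\<alpha> \<in> idempotents R; \<alpha> \<notin> B\<rbrakk> \<Longrightarrow> \<one> \<ominus> \<alpha> \<in> B"
  using assms unfolding idempotent_ultrafilter_def by blast+

lemma ultrafilter_complement:
  assumes B: "idempotent_ultrafilter R B" and \<delta>: "\<delta> \<in> B"
  shows "\<one> \<ominus> \<delta> \<notin> B"
  using ultrafilterD(3)[OF B \<delta>] ultrafilterD(2)[OF B]
    idempotents_complement(2)[OF ultrafilterD(1)[OF B \<delta>]] by metis

text \<open>The join of \<alpha> and \<beta> is the complement of the product of their complements,
  and that product lies in B.\<close>

lemma ultrafilter_join:
  assumes B: "idempotent_ultrafilter R B"
    and \<alpha>: "\<alpha> \<in> idempotents R - B" and \<beta>: "\<beta> \<in> idempotents R - B"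
  shows "\<exists>\<gamma> \<in> idempotents R - B. \<gamma> \<otimes> \<alpha> = \<alpha> \<and> \<gamma> \<otimes> \<beta> = \<beta>"
proof -
  have c: "\<alpha> \<in> carrier R" "\<beta> \<in> carrier R" using \<alpha> \<beta> by (auto simp: idempotents_def)
  define \<delta> where "\<delta> = (\<one> \<ominus> \<alpha>) \<otimes> (\<one> \<ominus> \<beta>)"
  have "\<delta> \<in> B" unfolding \<delta>_def using ultrafilterD(3,4)[OF B] \<alpha> \<beta> by blast
  note \<delta> = this ultrafilterD(1)[OF B this]
  note \<delta>c = idempotents_closed[OF \<delta>(2)]
  have "\<delta> \<otimes> \<alpha> = (\<alpha> \<otimes> (\<one> \<ominus> \<alpha>)) \<otimes> (\<one> \<ominus> \<beta>)" using c by (simp add: \<delta>_def m_ac)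
  then have 1: "\<delta> \<otimes> \<alpha> = \<zero>" using idempotents_complement(2) \<alpha> c by simp
  have "\<delta> \<otimes> \<beta> = (\<beta> \<otimes> (\<one> \<ominus> \<beta>)) \<otimes> (\<one> \<ominus> \<alpha>)" using c by (simp add: \<delta>_def m_ac)
  then have 2: "\<delta> \<otimes> \<beta> = \<zero>" using idempotents_complement(2) \<beta> c by simp
  have "(\<one> \<ominus> \<delta>) \<otimes> \<alpha> = \<alpha>" "(\<one> \<ominus> \<delta>) \<otimes> \<beta> = \<beta>"
    using 1 2 c \<delta>c by (simp_all add: minus_eq l_distr l_minus)
  then show ?thesis
    using ultrafilter_complement[OF B \<delta>(1)] idempotents_complement(1)[OF \<delta>(2)] by blast
qed

end

section \<open>The quotient of an algebra by an ultrafilter\<close>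

locale ultra_algebra = jordan_algebra F A
  for F :: "'f ring" and A :: "('f, 'a) module" (structure) +
  fixes B :: "'f set"
  assumes ultrafilter: "idempotent_ultrafilter F B"
begin

sublocale B: scalar_cring F
  by (rule scalar_cring.intro[OF is_cring])

abbreviation N where "N \<equiv> ultra_kernel F B A"
abbreviation coset where "coset x \<equiv> N +> x"

lemma in_kernel: "x \<in> N \<longleftrightarrow> x \<in> carrier A \<and> (\<exists>\<alpha> \<in> idempotents F - B. \<alpha> \<odot> x = x)"
proof
  assume "x \<in> N"
  then obtain \<alpha> y where *: "\<alpha> \<in> idempotents F - B" "y \<in> carrier A" "x = \<alpha> \<odot> y" "x \<in> carrier A"
    by (auto simp: ultra_kernel_def)
  then have "\<alpha> \<odot> x = x" by (auto simp: idempotents_def simp flip: smult_assoc1)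
  then show "x \<in> carrier A \<and> (\<exists>\<alpha> \<in> idempotents F - B. \<alpha> \<odot> x = x)" using * by blast
next
  assume "x \<in> carrier A \<and> (\<exists>\<alpha> \<in> idempotents F - B. \<alpha> \<odot> x = x)"
  then obtain \<alpha> where "x \<in> carrier A" "\<alpha> \<in> idempotents F - B" "x = \<alpha> \<odot> x" by metis
  then show "x \<in> N" unfolding ultra_kernel_def by blast
qed

text \<open>If \<delta> in B kills x, then 1 - \<delta> lies outside B and fixes x. With
  \<open>kernel_complement\<close> this describes the kernel as the set of elements killed by some
  member of B, the form that supports can be compared with.\<close>

lemma kernel_criterion:
  assumes x: "x \<in> carrier A" and \<delta>: "\<delta> \<in> B" and zero: "\<delta> \<odot> x = \<zero>"
  shows "x \<in> N"
proof -
  note \<delta>i = B.ultrafilterD(1)[OF ultrafilter \<delta>]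
  have "(\<one>\<^bsub>F\<^esub> \<ominus>\<^bsub>F\<^esub> \<delta>) \<odot> x = x"
    using x zero B.idempotents_closed[OF \<delta>i] by (simp add: R.minus_eq smult_l_distr smult_l_minus)
  then show ?thesis
    using x B.ultrafilter_complement[OF ultrafilter \<delta>] B.idempotents_complement(1)[OF \<delta>i] in_kernel by blast
qed

lemma kernel_complement:
  assumes "x \<in> N"
  shows "\<exists>\<delta> \<in> B. \<delta> \<odot> x = \<zero>"
proof -
  obtain \<alpha> where \<alpha>: "x \<in> carrier A" "\<alpha> \<in> idempotents F" "\<alpha> \<notin> B" "\<alpha> \<odot> x = x"
    using assms in_kernel by blast
  have "(\<one>\<^bsub>F\<^esub> \<ominus>\<^bsub>F\<^esub> \<alpha>) \<odot> x = \<zero>"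
    using \<alpha> B.idempotents_closed[OF \<alpha>(2)] by (simp add: R.minus_eq smult_l_distr smult_l_minus M.r_neg)
  then show ?thesis using B.ultrafilterD(4)[OF ultrafilter \<alpha>(2,3)] by blast
qed

text \<open>For sums, the idempotents fixing x and y are replaced by their join, which fixes both
  and stays outside B.\<close>

lemma kernel_ideal: "algebra_ideal F A N"
proof (rule algebra_idealI)
  show "N \<subseteq> carrier A" using in_kernel by blast
  show "\<zero> \<in> N"
    using B.idempotents_zero B.ultrafilterD(2)[OF ultrafilter]
    by (auto simp: in_kernel intro!: bexI[of _ "\<zero>\<^bsub>F\<^esub>"])
next
  fix x y assume "x \<in> N" "y \<in> N"
  then obtain \<alpha> \<beta> where *: "x \<in> carrier A" "y \<in> carrier A" "\<alpha> \<in> idempotents F - B" "\<alpha> \<odot> x = x"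
    "\<beta> \<in> idempotents F - B" "\<beta> \<odot> y = y" unfolding in_kernel by blast
  obtain \<gamma> where \<gamma>: "\<gamma> \<in> idempotents F - B" "\<gamma> \<otimes>\<^bsub>F\<^esub> \<alpha> = \<alpha>" "\<gamma> \<otimes>\<^bsub>F\<^esub> \<beta> = \<beta>"
    using B.ultrafilter_join[OF ultrafilter *(3,5)] by blast
  have c: "\<alpha> \<in> carrier F" "\<beta> \<in> carrier F" "\<gamma> \<in> carrier F" using * \<gamma> by (auto simp: idempotents_def)
  have "\<gamma> \<odot> x = x" "\<gamma> \<odot> y = y"
    using smult_assoc1[of \<gamma> \<alpha> x] smult_assoc1[of \<gamma> \<beta> y] * \<gamma> c by simp_all
  then have "\<gamma> \<odot> (x \<oplus> y) = x \<oplus> y" using c * by (simp add: smult_r_distr)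
  then show "x \<oplus> y \<in> N" using \<gamma>(1) * unfolding in_kernel by blast
next
  fix c x assume c: "c \<in> carrier F" and "x \<in> N"
  then obtain \<alpha> where \<alpha>: "x \<in> carrier A" "\<alpha> \<in> idempotents F - B" "\<alpha> \<odot> x = x" unfolding in_kernel by blast
  have \<alpha>c: "\<alpha> \<in> carrier F" using \<alpha> by (auto simp: idempotents_def)
  have "\<alpha> \<odot> (c \<odot> x) = c \<odot> x"
    using smult_assoc1[of \<alpha> c x] smult_assoc1[of c \<alpha> x] R.m_comm[of \<alpha> c] \<alpha> \<alpha>c c by simp
  then show "c \<odot> x \<in> N" using \<alpha> c unfolding in_kernel by blast
next
  fix a x assume "a \<in> N" and x: "x \<in> carrier A"
  then obtain \<alpha> where \<alpha>: "a \<in> carrier A" "\<alpha> \<in> idempotents F - B" "\<alpha> \<odot> a = a" unfolding in_kernel by blast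
  have \<alpha>c: "\<alpha> \<in> carrier F" using \<alpha> by (auto simp: idempotents_def)
  have "\<alpha> \<odot> (a \<otimes> x) = a \<otimes> x" "\<alpha> \<odot> (x \<otimes> a) = x \<otimes> a"
    using mult_smult_left[OF \<alpha>c \<alpha>(1) x] mult_smult_right[OF \<alpha>c x \<alpha>(1)] \<alpha>(3) by simp_all
  then show "a \<otimes> x \<in> N" "x \<otimes> a \<in> N"
    using \<alpha>(1,2) x mult_closed unfolding in_kernel by blast+
qed

sublocale N: abelian_subgroup "ultra_kernel F B A" A
proof (rule abelian_subgroupI3)
  show "additive_subgroup N A"
    using kernel_ideal by (intro additive_subgroup.intro) (simp add: algebra_ideal_def submodule_def)
qed unfold_locales

lemma coset_eq_iff: "\<lbrakk>x \<in> carrier A; y \<in> carrier A\<rbrakk> \<Longrightarrow> coset x = coset y \<longleftrightarrow> x \<ominus> y \<in> N"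
  using N.a_rcos_module[of y x] N.a_repr_independence'[of x y] N.a_rcos_self[of x]
  by (auto simp: M.minus_eq)

lemma coset_zero: "coset \<zero> = N"
  using N.a_rcos_const[OF N.zero_closed] .

lemma coset_eq_kernel_iff: "x \<in> carrier A \<Longrightarrow> coset x = N \<longleftrightarrow> x \<in> N"
  using coset_eq_iff[of x "\<zero>"] M.minus_equality[of "\<zero>" "\<zero>"]
  by (simp add: coset_zero M.minus_eq)

lemma in_cosetD:
  assumes "x \<in> carrier A" "y \<in> coset x"
  shows "y \<in> carrier A" "coset y = coset x"
  using assms N.a_elemrcos_carrier N.a_repr_independence' by auto

lemma coset_nonempty: "x \<in> carrier A \<Longrightarrow> coset x \<noteq> {}"
  using N.a_rcos_self by blast

text \<open>Multiplication and scalar action in \<open>ultra_quotient\<close>, like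
  \<open>ultra_inclusion\<close>, are unions over representatives; independence of the
  representative makes such a union constant.\<close>

lemma UN_coset:
  assumes "x \<in> carrier A" and "\<And>y. \<lbrakk>y \<in> carrier A; coset y = coset x\<rbrakk> \<Longrightarrow> f y = Z"
  shows "(\<Union>y \<in> coset x. f y) = Z"
  by (rule SUP_eq_const[OF coset_nonempty[OF assms(1)]]) (use in_cosetD[OF assms(1)] assms(2) in blast)

text \<open>The difference ab - xy is (a - x)b + x(b - y), with both summands in the kernel.\<close>

lemma coset_mult:
  assumes "x \<in> carrier A" "y \<in> carrier A"
  shows "rcoset_mult A N (coset x) (coset y) = coset (x \<otimes> y)"
  unfolding rcoset_mult_def
proof (intro UN_coset assms)
  fix a b assume a: "a \<in> carrier A" "coset a = coset x" and b: "b \<in> carrier A" "coset b = coset y"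
  note ND = algebra_idealD[OF kernel_ideal]
  have "a \<ominus> x \<in> N" "b \<ominus> y \<in> N" using coset_eq_iff a b assms by auto
  then have "(a \<ominus> x) \<otimes> b \<in> N" "x \<otimes> (b \<ominus> y) \<in> N" using ND(6,7) assms b by auto
  then have "coset (a \<otimes> b) = coset (x \<otimes> b)" "coset (x \<otimes> b) = coset (x \<otimes> y)"
    using a b assms by (simp_all add: coset_eq_iff mult_closed mult_diff_left mult_diff_right)
  then show "coset (a \<otimes> b) = coset (x \<otimes> y)" by simp
qed

lemma coset_smult:
  assumes c: "c \<in> carrier F" and x: "x \<in> carrier A"
  shows "(\<Union>y \<in> coset x. coset (c \<odot> y)) = coset (c \<odot> x)"
proof (rule UN_coset[OF x])
  fix y assume y: "y \<in> carrier A" "coset y = coset x"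
  then have "c \<odot> (y \<ominus> x) \<in> N"
    using algebra_idealD(5)[OF kernel_ideal c] coset_eq_iff x by auto
  then show "coset (c \<odot> y) = coset (c \<odot> x)"
    using c x y by (simp add: coset_eq_iff M.minus_eq smult_r_distr smult_r_minus)
qed

abbreviation U where "U \<equiv> ultra_quotient F B A"

lemma U_carrier: "carrier U = coset ` carrier A"
  by (auto simp: ultra_quotient_def A_RCOSETS_def')

lemma U_zero: "\<zero>\<^bsub>U\<^esub> = coset \<zero>"
  unfolding coset_zero by (simp add: ultra_quotient_def)

lemma U_add: "\<lbrakk>x \<in> carrier A; y \<in> carrier A\<rbrakk> \<Longrightarrow> coset x \<oplus>\<^bsub>U\<^esub> coset y = coset (x \<oplus> y)"
  by (simp add: ultra_quotient_def N.a_rcos_sum)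

lemma U_mult: "\<lbrakk>x \<in> carrier A; y \<in> carrier A\<rbrakk> \<Longrightarrow> coset x \<otimes>\<^bsub>U\<^esub> coset y = coset (x \<otimes> y)"
  by (simp add: ultra_quotient_def coset_mult)

lemma U_smult: "\<lbrakk>c \<in> carrier F; x \<in> carrier A\<rbrakk> \<Longrightarrow> c \<odot>\<^bsub>U\<^esub> coset x = coset (c \<odot> x)"
  by (simp add: ultra_quotient_def coset_smult)

lemma U_jordan: "jordan_algebra F U"
  by (rule jordan_algebra_image[OF jordan_algebra_axioms, of coset])
    (simp_all add: U_carrier U_zero U_add U_mult U_smult)

end

section \<open>Denominators modulo an ultrafilter\<close>

context supported_quotient
begin

text \<open>If K is an ideal of denominators of q in A, the cosets of \<open>glued K\<close> serve
  for the coset of q: they multiply q into O(A) because they do so locally. Multipliers of full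
  support give a nonzero product and, applied to elements of O(A), a zero annihilator.\<close>

theorem ultra_quotient_M_quotients:
  assumes B: "idempotent_ultrafilter C B"
  shows "M_quotients C (ultra_quotient C B OA) (ultra_quotient C B Q) (ultra_inclusion C B Q)"
proof -
  interpret UQ: ultra_algebra C Q B
    by (intro ultra_algebra.intro ultra_algebra_axioms.intro Q.jordan_algebra_axioms B)
  interpret OA: jordan_algebra C OA by (rule OA_jordan)
  interpret UO: ultra_algebra C OA B
    by (intro ultra_algebra.intro ultra_algebra_axioms.intro OA_jordan B)
  let ?i = "ultra_inclusion C B Q"
  \<comment> \<open>Scalars act alike on both algebras, so the kernel of O(A) is the trace of the
    kernel of Q; this makes the map of quotients injective.\<close>
  have kernel: "x \<in> UO.N \<longleftrightarrow> x \<in> UQ.N" if "x \<in> carrier OA" for x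
    using that OA_sub[OF that] idem_closed OA_smult unfolding UO.in_kernel UQ.in_kernel by auto
  \<comment> \<open>Subtraction in O(A) is compared with that of Q through multiplication by the
    scalar -1.\<close>
  have diff: "x \<ominus>\<^bsub>OA\<^esub> y = x \<ominus> y" if "x \<in> carrier OA" "y \<in> carrier OA" for x y
  proof -
    have "\<ominus>\<^bsub>OA\<^esub> y = \<ominus> y"
      using that OA_sub by (simp add: OA.minus_eq_smult Q.minus_eq_smult OA_smult)
    moreover have "\<ominus>\<^bsub>OA\<^esub> y \<in> carrier OA" using that by simp
    ultimately show ?thesis using OA_add[OF that(1), of "\<ominus>\<^bsub>OA\<^esub> y"] by (simp add: OA.M.minus_eq Q.M.minus_eq)
  qed
  have eq_iff: "UO.coset x = UO.coset y \<longleftrightarrow> UQ.coset x = UQ.coset y" if "x \<in> carrier OA" "y \<in> carrier OA" for x y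
    using that OA_sub kernel[of "x \<ominus>\<^bsub>OA\<^esub> y"]
    by (simp add: UO.coset_eq_iff UQ.coset_eq_iff diff[OF that] flip: diff[OF that])
  have i: "?i (UO.coset x) = UQ.coset x" if "x \<in> carrier OA" for x
    unfolding ultra_inclusion_def by (rule UO.UN_coset[OF that]) (use that eq_iff in blast)
  have emb: "algebra_embedding C UO.U UQ.U ?i"
    unfolding algebra_embedding_def
  proof (intro conjI)
    show "?i \<in> carrier UO.U \<rightarrow> carrier UQ.U" using OA_sub by (auto simp: UO.U_carrier UQ.U_carrier i)
    show "inj_on ?i (carrier UO.U)"
    proof (rule inj_onI)
      fix X Y assume "X \<in> carrier UO.U" "Y \<in> carrier UO.U" and eq: "?i X = ?i Y"
      then obtain x y where "x \<in> carrier OA" "y \<in> carrier OA" "X = UO.coset x" "Y = UO.coset y"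
        unfolding UO.U_carrier by blast
      then show "X = Y" using eq by (simp add: i eq_iff)
    qed
    show "\<forall>x \<in> carrier UO.U. \<forall>y \<in> carrier UO.U. ?i (x \<oplus>\<^bsub>UO.U\<^esub> y) = ?i x \<oplus>\<^bsub>UQ.U\<^esub> ?i y \<and>
        ?i (x \<otimes>\<^bsub>UO.U\<^esub> y) = ?i x \<otimes>\<^bsub>UQ.U\<^esub> ?i y"
      unfolding UO.U_carrier
      by (auto simp: UO.U_add UO.U_mult UQ.U_add UQ.U_mult i OA_sub OA.mult_closed) (simp_all add: OA_add OA_mult)
    show "\<forall>c \<in> carrier C. \<forall>x \<in> carrier UO.U. ?i (c \<odot>\<^bsub>UO.U\<^esub> x) = c \<odot>\<^bsub>UQ.U\<^esub> ?i x"
      unfolding UO.U_carrier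
      by (auto simp: UO.U_smult UQ.U_smult i OA_sub) (simp_all add: OA_smult)
  qed
  show ?thesis
  proof (rule M_quotientsI[OF UO.U_jordan UQ.U_jordan emb])
    fix q' assume q': "q' \<in> carrier UQ.U" "q' \<noteq> \<zero>\<^bsub>UQ.U\<^esub>"
    then obtain q where "q \<in> carrier Q" "q' = UQ.coset q" unfolding UQ.U_carrier by blast
    moreover from this have "q \<notin> UQ.N" using q'(2) by (simp add: UQ.U_zero UQ.coset_zero UQ.coset_eq_kernel_iff)
    ultimately have q: "q \<in> carrier Q" "q' = UQ.coset q" "q \<notin> UQ.N" by simp_all
    then have "q \<noteq> \<zero>" using UQ.N.zero_closed by auto
    then obtain K where K: "algebra_ideal C A K" "jordan_annihilator A K = {\<zero>\<^bsub>A\<^esub>}"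
      "\<And>a. a \<in> K \<Longrightarrow> \<exists>p \<in> carrier A. j a \<otimes> q = j p" using denominators[OF q(1)] by metis
    note KD = A.algebra_idealD[OF K(1)]
    have gO: "k \<in> carrier OA" if "k \<in> glued K" for k
      using that KD(1) unfolding OA_carrier glued_def by blast
    \<comment> \<open>For a multiplier k of full support, a member of B killing kp kills p as well;
      so kp leaves the kernel together with p.\<close>
    have full: "\<exists>k \<in> glued K. k \<otimes> p \<notin> UQ.N" if p: "p \<in> carrier Q" "p \<notin> UQ.N" for p
    proof -
      obtain k where k: "k \<in> glued K" "\<And>\<alpha>. \<lbrakk>\<alpha> \<in> carrier C; \<alpha> \<odot> (k \<otimes> p) = \<zero>\<rbrakk> \<Longrightarrow> \<alpha> \<odot> p = \<zero>"
        using full_support_multiplier[OF p(1) K(1,2)] by blast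
      have "p \<in> UQ.N" if kp: "k \<otimes> p \<in> UQ.N"
      proof -
        obtain \<delta> where \<delta>: "\<delta> \<in> B" "\<delta> \<odot> (k \<otimes> p) = \<zero>" using UQ.kernel_complement[OF kp] by blast
        have "\<delta> \<in> carrier C" using \<delta>(1) B.ultrafilterD(1)[OF B] idem_closed by blast
        then show ?thesis using UQ.kernel_criterion[OF p(1) \<delta>(1)] k(2) \<delta>(2) by blast
      qed
      then show ?thesis using k(1) p(2) by blast
    qed
    have jQ: "j k \<in> carrier Q" if "k \<in> K" for k using that KD(1) by blast
    have mult_in: "k \<otimes> q \<in> carrier OA" if k: "k \<in> glued K" for k
    proof -
      obtain D where D: "dense_orthogonal C D" "\<And>\<xi>. \<xi> \<in> D \<Longrightarrow> \<exists>a \<in> K. \<xi> \<odot> k = \<xi> \<odot> j a"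
        using k by (auto simp: glued_def)
      have "\<exists>p \<in> carrier A. \<xi> \<odot> (k \<otimes> q) = \<xi> \<odot> j p" if \<xi>: "\<xi> \<in> D" for \<xi>
      proof -
        obtain a where a: "a \<in> K" "\<xi> \<odot> k = \<xi> \<odot> j a" using D(2)[OF \<xi>] by blast
        obtain p where p: "p \<in> carrier A" "j a \<otimes> q = j p" using K(3)[OF a(1)] by blast
        have "\<xi> \<odot> (k \<otimes> q) = \<xi> \<odot> j p"
          unfolding p(2)[symmetric]
          by (rule local_mult[OF idem(2)[OF D(1) \<xi>] glued_sub[OF k] jQ[OF a(1)] q(1) q(1) a(2) refl])
        then show ?thesis using p(1) by blast
      qed
      then show ?thesis
        using D(1) Q.mult_closed[OF glued_sub[OF k] q(1)] unfolding OA_carrier glued_def by blast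
    qed
    let ?K = "UO.coset ` glued K"
    interpret UOU: jordan_algebra C UO.U by (rule UO.U_jordan)
    have K': "algebra_ideal C UO.U ?K"
    proof (rule UOU.algebra_idealI)
      show "?K \<subseteq> carrier UO.U" using gO by (auto simp: UO.U_carrier)
      show "\<zero>\<^bsub>UO.U\<^esub> \<in> ?K" using base_in_glued[OF KD(1,2)] by (auto simp: UO.U_zero OA_zero)
      show "x \<oplus>\<^bsub>UO.U\<^esub> y \<in> ?K" if "x \<in> ?K" "y \<in> ?K" for x y
        using that gO glued_add[OF K(1)] by (auto simp: UO.U_add OA_add)
      show "c \<odot>\<^bsub>UO.U\<^esub> x \<in> ?K" if "c \<in> carrier C" "x \<in> ?K" for c x
        using that gO glued_smult[OF K(1)] by (auto simp: UO.U_smult OA_smult)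
      show ax: "a \<otimes>\<^bsub>UO.U\<^esub> x \<in> ?K" if "a \<in> ?K" "x \<in> carrier UO.U" for a x
        using that gO glued_mult[OF K(1)] by (auto simp: UO.U_carrier UO.U_mult OA_mult OA_carrier)
      show "x \<otimes>\<^bsub>UO.U\<^esub> a \<in> ?K" if "a \<in> ?K" "x \<in> carrier UO.U" for a x
        using ax[OF that] that \<open>?K \<subseteq> carrier UO.U\<close> UOU.mult_comm[of x a] by auto
    qed
    have "x = \<zero>\<^bsub>UO.U\<^esub>" if x: "x \<in> jordan_annihilator UO.U ?K" for x
    proof (rule ccontr)
      assume x0: "x \<noteq> \<zero>\<^bsub>UO.U\<^esub>"
      have "x \<in> carrier UO.U" using x by (simp add: jordan_annihilator_def)
      then obtain y where "y \<in> carrier OA" "x = UO.coset y" unfolding UO.U_carrier by blast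
      moreover from this have "y \<notin> UO.N" using x0 by (simp add: UO.U_zero UO.coset_zero UO.coset_eq_kernel_iff)
      ultimately have y: "y \<in> carrier OA" "x = UO.coset y" "y \<notin> UO.N" by simp_all
      then obtain k where k: "k \<in> glued K" "k \<otimes> y \<notin> UQ.N"
        using full[OF OA_sub[OF y(1)]] kernel[OF y(1)] by blast
      have "x \<otimes>\<^bsub>UO.U\<^esub> UO.coset k = \<zero>\<^bsub>UO.U\<^esub>" using x k(1) unfolding jordan_annihilator_def by blast
      then have "UO.coset (y \<otimes>\<^bsub>OA\<^esub> k) = UO.N"
        using y(1,2) gO[OF k(1)] by (simp add: UO.U_zero UO.coset_zero UO.U_mult)
      then have "y \<otimes>\<^bsub>OA\<^esub> k \<in> UO.N"
        using y(1) gO[OF k(1)] by (simp add: UO.coset_eq_kernel_iff OA.mult_closed)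
      then have "k \<otimes> y \<in> UQ.N"
        using kernel[of "y \<otimes>\<^bsub>OA\<^esub> k"] y(1) gO[OF k(1)] OA_sub
        by (simp add: OA.mult_closed OA_mult Q.mult_comm)
      then show False using k(2) by simp
    qed
    then have ann: "jordan_annihilator UO.U ?K = {\<zero>\<^bsub>UO.U\<^esub>}"
      using UOU.algebra_idealD(2)[OF UOU.algebra_ideal_jordan_annihilator[OF K']] by blast
    have prod: "?i (UO.coset k) \<otimes>\<^bsub>UQ.U\<^esub> q' = UQ.coset (k \<otimes> q)" if "k \<in> glued K" for k
      using gO[OF that] glued_sub[OF that] q(1,2) by (simp add: i UQ.U_mult)
    obtain k where k: "k \<in> glued K" "k \<otimes> q \<notin> UQ.N" using full[OF q(1,3)] by blast
    have "?i (UO.coset k) \<otimes>\<^bsub>UQ.U\<^esub> q' \<noteq> \<zero>\<^bsub>UQ.U\<^esub>"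
      unfolding prod[OF k(1)] UQ.U_zero UQ.coset_zero
      using k(2) Q.mult_closed[OF glued_sub[OF k(1)] q(1)] by (simp add: UQ.coset_eq_kernel_iff)
    moreover have "?i X \<otimes>\<^bsub>UQ.U\<^esub> q' \<in> ?i ` carrier UO.U" if X: "X \<in> ?K" for X
    proof -
      obtain k where k: "k \<in> glued K" "X = UO.coset k" using X by blast
      have "?i X \<otimes>\<^bsub>UQ.U\<^esub> q' = ?i (UO.coset (k \<otimes> q))"
        unfolding k(2) prod[OF k(1)] i[OF mult_in[OF k(1)]] ..
      then show ?thesis using mult_in[OF k(1)] by (auto simp: UO.U_carrier)
    qed
    ultimately show "\<exists>K. algebra_ideal C UO.U K \<and> jordan_annihilator UO.U K = {\<zero>\<^bsub>UO.U\<^esub>} \<and>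
        (\<exists>a \<in> K. ?i a \<otimes>\<^bsub>UQ.U\<^esub> q' \<noteq> \<zero>\<^bsub>UQ.U\<^esub>) \<and> (\<forall>a \<in> K. ?i a \<otimes>\<^bsub>UQ.U\<^esub> q' \<in> ?i ` carrier UO.U)"
      using K' ann k(1) by (intro exI[of _ ?K]) blast
  qed
qed

end

text \<open>P(R) over CM(R) meets the abstract assumptions: faithfulness is inherited from R, and
  supports come from \<open>support_exists\<close>.\<close>

lemma (in jordan_hull) supported_quotientI:
  assumes J: "injective_hull (mult_ring C PA) (mult_module PA) J j"
    and Q: "maximal_M_quotients C PA Q j" and emb: "embedded_in_hull C PA J j Q"
  shows "supported_quotient C PA Q J j"
proof -
  have "M_quotients C PA Q j" using Q by (simp add: maximal_M_quotients_def)
  then have 1: "M_quotient_algebra C PA Q j" by (rule M_quotient_algebraI)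
  have 2: "mult_hull C PA J j" by (rule mult_hullI[OF PA.nonassoc_algebra_axioms J])
  show ?thesis
    by (intro supported_quotient.intro 1 2 supported_quotient_axioms.intro PA_faithful Q emb)
      (use support_exists in simp)
qed

theorem proposition3p3:
  fixes F :: "'f ring" and R :: "('f, 'r) module"
    and I :: "('r \<Rightarrow> 'r, 'i) module" and e :: "'r \<Rightarrow> 'i"
  assumes "jordan_algebra F R"
    and "nondegenerate R"
    and "carrier R \<noteq> {\<zero>\<^bsub>R\<^esub>}"
    and "injective_hull (mult_ring F R) (mult_module R) I e"
  shows "M_quotients F R (P_base_algebra F R I e) e \<and>
    (\<forall>(Q :: ('f, 'q) module) k.
       maximal_M_quotients F R Q k \<longrightarrow>
         (\<exists>f. algebra_embedding F (P_base_algebra F R I e) Q f \<and>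
              (\<forall>x \<in> carrier R. f (e x) = k x))) \<and>
    (let C = CM F R I e; P = P_algebra F R I e in
     \<forall>(J :: ('i \<Rightarrow> 'i, 'j) module) j Q.
       injective_hull (mult_ring C P) (mult_module P) J j \<and>
       maximal_M_quotients C P Q j \<and> embedded_in_hull C P J j Q \<longrightarrow>
         (let V = scalar_module P J; OP = O_algebra C V P j in
            carrier OP \<subseteq> carrier Q \<and>
            carrier Q = orth_completion C V (carrier Q) \<and>
            (\<forall>B. idempotent_ultrafilter C B \<longrightarrow>
               M_quotients C (ultra_quotient C B OP) (ultra_quotient C B Q)
                 (ultra_inclusion C B Q))))"
proof -
  interpret R: jordan_algebra F R by fact
  \<comment> \<open>Nondegeneracy is spent at this point; the rest of the argument draws on
    faithfulness of ideals.\<close>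
  interpret jordan_hull F R I e
    by (intro jordan_hull.intro jordan_hull_axioms.intro R.jordan_algebra_axioms
        mult_hullI R.nonassoc_algebra_axioms R.nondegenerate_imp_ideals_faithful assms)
  have "carrier (O_algebra C (scalar_module PA J) PA j) \<subseteq> carrier Q \<and>
      carrier Q = orth_completion C (scalar_module PA J) (carrier Q) \<and>
      (\<forall>B. idempotent_ultrafilter C B \<longrightarrow>
         M_quotients C (ultra_quotient C B (O_algebra C (scalar_module PA J) PA j)) (ultra_quotient C B Q)
           (ultra_inclusion C B Q))"
    if "injective_hull (mult_ring C PA) (mult_module PA) J j \<and>
       maximal_M_quotients C PA Q j \<and> embedded_in_hull C PA J j Q"
    for J :: "('i \<Rightarrow> 'i, 'j) module" and j Q
  proof -
    interpret SQ: supported_quotient C PA Q J j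
      using that supported_quotientI by blast
    show ?thesis
      using SQ.OA_sub SQ.orth_completion_Q SQ.ultra_quotient_M_quotients by blast
  qed
  then show ?thesis
    using PB_M_quotients PB_embeds_in_maximal unfolding Let_def by blast
qed

end
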